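(* Let $f:\Phi\to\Psi$ be a morphism in the classifying category $\mathcal{C}(\mathbb{T})$ of a dependent type theory $\mathbb{T}$ with identity types, and let $\mathcal{F}:\mathcal{C}(\mathbb{T})\to\mathbf{Gpd}$ be the fundamental groupoid functor. (i) If $f\in\mathcal{A}$, then $\mathcal{F}(f):\mathcal{F}(\Phi)\to\mathcal{F}(\Psi)$ is an equivalence of categories which is injective on objects. (ii) If $f\in\mathcal{B}$, then $\mathcal{F}(f):\mathcal{F}(\Phi)\to\mathcal{F}(\Psi)$ is a Grothendieck fibration.
   Context: $\mathbb{T}$ is a Martin-Löf style dependent type theory with standard structural rules and identity types (formation, introduction $\mathrm{r}(a)$, elimination $\mathrm{J}$ with an extra parameter context $\Theta(x,y,u)$, computation $\mathrm{J}(a,a,\mathrm{r}(a),d)=d(a)$; stable under substitution; no reflection rules). $\mathcal{C}(\mathbb{T})$ has contexts as objects and context morphisms (tuples of terms) as morphisms, up to renaming and definitional equality, composition by substitution. A display map is a projection $(\Gamma,x\in A)\to\Gamma$; $\mathcal{A}$ is the class of maps having the left lifting property with respect to all display maps, and $\mathcal{B}$ the class of maps with the right lifting property with respect to all maps in $\mathcal{A}$. Identity contexts $\mathrm{Id}_\Phi(a,b)$ for a context $\Phi$ and $a,b\in\Phi$ are defined by induction on the length of $\Phi$ ($(u\in\mathrm{Id}_A(a,b))$ for $\Phi=(x\in A)$; $(u\in\mathrm{Id}_\Phi(a,b),u_{n+1}\in\mathrm{Id}_{A_{n+1}(b)}(u_!(a_{n+1}),b_{n+1}))$ for $\Phi'=(x\in\Phi,x_{n+1}\in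 A_{n+1}(x))$, with $u_!$ transport) and satisfy analogues of the identity-type rules. Transport: $p_!(e):=\mathrm{J}(a,b,p,[x]e)$ for $p\in\mathrm{Id}_\Phi(a,b)$, $e\in\Omega(a)$. The fundamental groupoid $\mathcal{F}(\Phi)$ has as objects global elements $a\in\Phi$, and as morphisms $a\to b$ classes $[p]$ of closed $p\in\mathrm{Id}_\Phi(a,b)$ modulo homotopy ($p_0\sim p_1$ iff there is a closed element of $\mathrm{Id}_{\mathrm{Id}_\Phi(a,b)}(p_0,p_1)$); composition $[q]\circ[p]=[q_!(p)]$ (transport in $x\mapsto\mathrm{Id}_\Phi(a,x)$), identities $[\mathrm{r}(a)]$. For $f:\Phi\to\Psi$, $\mathcal{F}(f)$ sends $a\mapsto f(a)$ and $[p]\mapsto[\mathrm{J}(a,b,p,[x]\mathrm{r}(f(x)))]$; this gives a functor $\mathcal{F}:\mathcal{C}(\mathbb{T})\to\mathbf{Gpd}$ (small groupoids and functors). A functor $F:A\to B$ between groupoids is a Grothendieck fibration if for every object $a$ of $A$ and every morphism $\beta:F(a)\to b$ in $B$ there is $\alpha:a\to a'$ in $A$ with $F(a')=b$ and $F(\alpha)=\beta$. *)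

theory Defs
  imports Main
begin

section \<open>Raw syntax\<close>

text \<open>
  Variables are de Bruijn indices, so that expressions are automatically taken up to renaming
  of variables. \<open>'s\<close> is a signature of further type and term formers: in \<open>Op c [(k\<^sub>1, e\<^sub>1), \<dots>]\<close>
  the argument \<open>e\<^sub>i\<close> is in the scope of \<open>k\<^sub>i\<close> bound variables. \<open>IdT A a b\<close> is the identity type
  $\mathrm{Id}_A(a,b)$ and \<open>Refl a\<close> is $\mathrm{r}(a)$. \<open>J a b p d t\<close> is $\mathrm{J}(a,b,p,[x,z]d)$ with
  the parameters \<open>z\<close> of the context \<open>\<Theta>\<close> replaced by the tuple \<open>t \<in> \<Theta>(a,b,p)\<close>; these parameters
  have to be explicit because \<open>d\<close> binds them, in addition to \<open>x\<close>: it binds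
  \<open>Suc (length t)\<close> variables, \<open>x\<close> being the outermost one.

  Contexts, telescopes and tuples are lists whose head is the most recent entry:
  the context $(x_1 \in A_1, \ldots, x_n \in A_n)$ is \<open>[A\<^sub>n, \<dots>, A\<^sub>1]\<close>, so that the entry for the
  variable \<open>Var i\<close> is found at position \<open>i\<close>, and \<open>\<Delta> @ \<Gamma>\<close> extends \<open>\<Gamma>\<close> by the telescope \<open>\<Delta>\<close>.
\<close>

datatype 's exp =
    Var nat
  | Op 's "(nat \<times> 's exp) list"
  | IdT "'s exp" "'s exp" "'s exp"
  | Refl "'s exp"
  | J "'s exp" "'s exp" "'s exp" "'s exp" "'s exp list"

type_synonym 's ctx = "'s exp list"
type_synonym 's tup = "'s exp list"

definition upr :: "nat \<Rightarrow> (nat \<Rightarrow> nat) \<Rightarrow> nat \<Rightarrow> nat" where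
  "upr k \<rho> i = (if i < k then i else \<rho> (i - k) + k)"

fun ren :: "(nat \<Rightarrow> nat) \<Rightarrow> 's exp \<Rightarrow> 's exp" where
  "ren \<rho> (Var i) = Var (\<rho> i)"
| "ren \<rho> (Op c es) = Op c (map (\<lambda>(k, e). (k, ren (upr k \<rho>) e)) es)"
| "ren \<rho> (IdT A a b) = IdT (ren \<rho> A) (ren \<rho> a) (ren \<rho> b)"
| "ren \<rho> (Refl a) = Refl (ren \<rho> a)"
| "ren \<rho> (J a b p d t) =
     J (ren \<rho> a) (ren \<rho> b) (ren \<rho> p) (ren (upr (Suc (length t)) \<rho>) d) (map (ren \<rho>) t)"

definition wk :: "nat \<Rightarrow> 's exp \<Rightarrow> 's exp" where
  "wk k = ren (\<lambda>i. i + k)"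

definition ups :: "nat \<Rightarrow> (nat \<Rightarrow> 's exp) \<Rightarrow> nat \<Rightarrow> 's exp" where
  "ups k \<sigma> i = (if i < k then Var i else wk k (\<sigma> (i - k)))"

fun subst :: "(nat \<Rightarrow> 's exp) \<Rightarrow> 's exp \<Rightarrow> 's exp" where
  "subst \<sigma> (Var i) = \<sigma> i"
| "subst \<sigma> (Op c es) = Op c (map (\<lambda>(k, e). (k, subst (ups k \<sigma>) e)) es)"
| "subst \<sigma> (IdT A a b) = IdT (subst \<sigma> A) (subst \<sigma> a) (subst \<sigma> b)"
| "subst \<sigma> (Refl a) = Refl (subst \<sigma> a)"
| "subst \<sigma> (J a b p d t) =
     J (subst \<sigma> a) (subst \<sigma> b) (subst \<sigma> p) (subst (ups (Suc (length t)) \<sigma>) d) (map (subst \<sigma>) t)"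

text \<open>Substitution of a tuple for the innermost \<open>length t\<close> variables.\<close>

definition tsub :: "'s tup \<Rightarrow> nat \<Rightarrow> 's exp" where
  "tsub t i = (if i < length t then t ! i else Var (i - length t))"

abbreviation inst :: "'s tup \<Rightarrow> 's exp \<Rightarrow> 's exp" where
  "inst t \<equiv> subst (tsub t)"

fun subst_tele :: "(nat \<Rightarrow> 's exp) \<Rightarrow> 's ctx \<Rightarrow> 's ctx" where
  "subst_tele \<sigma> [] = []"
| "subst_tele \<sigma> (B # \<Theta>) = subst (ups (length \<Theta>) \<sigma>) B # subst_tele \<sigma> \<Theta>"

abbreviation vars :: "nat \<Rightarrow> 's tup" where
  "vars n \<equiv> map Var [0..<n]"

fun scoped :: "nat \<Rightarrow> 's exp \<Rightarrow> bool" where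
  "scoped n (Var i) \<longleftrightarrow> i < n"
| "scoped n (Op c es) \<longleftrightarrow> (\<forall>(k, e) \<in> set es. scoped (n + k) e)"
| "scoped n (IdT A a b) \<longleftrightarrow> scoped n A \<and> scoped n a \<and> scoped n b"
| "scoped n (Refl a) \<longleftrightarrow> scoped n a"
| "scoped n (J a b p d t) \<longleftrightarrow> scoped n a \<and> scoped n b \<and> scoped n p \<and>
     scoped (n + Suc (length t)) d \<and> (\<forall>e \<in> set t. scoped n e)"

section \<open>Dependent type theories with identity types\<close>

text \<open>
  The judgements \<open>\<Gamma> \<turnstile> A type\<close>, \<open>\<Gamma> \<turnstile> a \<in> A\<close>, \<open>\<Gamma> \<turnstile> A = B type\<close> and \<open>\<Gamma> \<turnstile> a = b \<in> A\<close>.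
\<close>

datatype 's judgement =
    Ty "'s ctx" "'s exp"
  | Tm "'s ctx" "'s exp" "'s exp"
  | TyEq "'s ctx" "'s exp" "'s exp"
  | TmEq "'s ctx" "'s exp" "'s exp" "'s exp"

text \<open>In the following, \<open>T\<close> is the set of derivable judgements of a theory.\<close>

fun wf_ctx :: "'s judgement set \<Rightarrow> 's ctx \<Rightarrow> bool" where
  "wf_ctx T [] \<longleftrightarrow> True"
| "wf_ctx T (A # \<Gamma>) \<longleftrightarrow> wf_ctx T \<Gamma> \<and> Ty \<Gamma> A \<in> T"

fun ctx_eq :: "'s judgement set \<Rightarrow> 's ctx \<Rightarrow> 's ctx \<Rightarrow> bool" where
  "ctx_eq T [] [] \<longleftrightarrow> True"
| "ctx_eq T (A # \<Gamma>) (B # \<Delta>) \<longleftrightarrow> ctx_eq T \<Gamma> \<Delta> \<and> TyEq \<Gamma> A B \<in> T"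
| "ctx_eq T _ _ \<longleftrightarrow> False"

text \<open>
  \<open>elem T \<Gamma> t \<Theta>\<close>: in context \<open>\<Gamma>\<close>, the tuple \<open>t\<close> is an element of the telescope \<open>\<Theta>\<close> over \<open>\<Gamma>\<close>. If
  \<open>\<Theta>\<close> is a context (which makes no reference to \<open>\<Gamma>\<close>), this says that \<open>t\<close> is a context morphism
  from \<open>\<Gamma>\<close> to \<open>\<Theta>\<close>. \<open>elem_eq\<close> is definitional equality of such tuples.
\<close>

fun elem :: "'s judgement set \<Rightarrow> 's ctx \<Rightarrow> 's tup \<Rightarrow> 's ctx \<Rightarrow> bool" where
  "elem T \<Gamma> [] [] \<longleftrightarrow> True"
| "elem T \<Gamma> (a # t) (A # \<Theta>) \<longleftrightarrow> elem T \<Gamma> t \<Theta> \<and> Tm \<Gamma> a (inst t A) \<in> T"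
| "elem T \<Gamma> _ _ \<longleftrightarrow> False"

fun elem_eq :: "'s judgement set \<Rightarrow> 's ctx \<Rightarrow> 's tup \<Rightarrow> 's tup \<Rightarrow> 's ctx \<Rightarrow> bool" where
  "elem_eq T \<Gamma> [] [] [] \<longleftrightarrow> True"
| "elem_eq T \<Gamma> (a # s) (b # t) (A # \<Theta>) \<longleftrightarrow>
     elem_eq T \<Gamma> s t \<Theta> \<and> TmEq \<Gamma> a b (inst s A) \<in> T"
| "elem_eq T \<Gamma> _ _ _ \<longleftrightarrow> False"

text \<open>The telescope $(x \in A, y \in A, u \in \mathrm{Id}_A(x,y))$.\<close>

definition id_tele :: "'s exp \<Rightarrow> 's ctx" where
  "id_tele A = [IdT (wk 2 A) (Var 1) (Var 0), wk 1 A, A]"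

text \<open>
  The substitution $y := x$, $u := \mathrm{r}(x)$, which leads from expressions in context
  $(x, y, u)$ to expressions in context $(x)$.
\<close>

definition diag :: "nat \<Rightarrow> 's exp" where
  "diag = tsub [Refl (Var 0), Var 0]"

text \<open>
  A theory is any set of judgements closed under the rules below; it may have arbitrary further
  type and term formers and be closed under arbitrary further rules. Weakening and
  substitution are combined into closure under substitution along context morphisms.
  In the elimination rule \<open>C\<close> is a type in context
  $(\Gamma, x \in A, y \in A, u \in \mathrm{Id}_A(x,y), z \in \Theta(x,y,u))$ and \<open>d\<close> an element of
  $C(x,x,\mathrm{r}(x),z)$ in context $(\Gamma, x \in A, z \in \Theta(x,x,\mathrm{r}(x)))$.
\<close>

locale type_theory =
  fixes T :: "'s judgement set"
  \<comment> \<open>presuppositions\<close>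
  assumes Ty_ctx: "Ty \<Gamma> A \<in> T \<Longrightarrow> wf_ctx T \<Gamma>"
    and Ty_scoped: "Ty \<Gamma> A \<in> T \<Longrightarrow> scoped (length \<Gamma>) A"
    and Tm_scoped: "Tm \<Gamma> a A \<in> T \<Longrightarrow> scoped (length \<Gamma>) a"
    and Tm_Ty: "Tm \<Gamma> a A \<in> T \<Longrightarrow> Ty \<Gamma> A \<in> T"
    and TyEq_Ty: "TyEq \<Gamma> A B \<in> T \<Longrightarrow> Ty \<Gamma> A \<in> T \<and> Ty \<Gamma> B \<in> T"
    and TmEq_Tm: "TmEq \<Gamma> a b A \<in> T \<Longrightarrow> Tm \<Gamma> a A \<in> T \<and> Tm \<Gamma> b A \<in> T"
  \<comment> \<open>structural rules\<close>
    and TyEq_refl: "Ty \<Gamma> A \<in> T \<Longrightarrow> TyEq \<Gamma> A A \<in> T"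
    and TyEq_sym: "TyEq \<Gamma> A B \<in> T \<Longrightarrow> TyEq \<Gamma> B A \<in> T"
    and TyEq_trans: "TyEq \<Gamma> A B \<in> T \<Longrightarrow> TyEq \<Gamma> B C \<in> T \<Longrightarrow> TyEq \<Gamma> A C \<in> T"
    and TmEq_refl: "Tm \<Gamma> a A \<in> T \<Longrightarrow> TmEq \<Gamma> a a A \<in> T"
    and TmEq_sym: "TmEq \<Gamma> a b A \<in> T \<Longrightarrow> TmEq \<Gamma> b a A \<in> T"
    and TmEq_trans: "TmEq \<Gamma> a b A \<in> T \<Longrightarrow> TmEq \<Gamma> b c A \<in> T \<Longrightarrow> TmEq \<Gamma> a c A \<in> T"
    and Tm_conv: "Tm \<Gamma> a A \<in> T \<Longrightarrow> TyEq \<Gamma> A B \<in> T \<Longrightarrow> Tm \<Gamma> a B \<in> T"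
    and TmEq_conv: "TmEq \<Gamma> a b A \<in> T \<Longrightarrow> TyEq \<Gamma> A B \<in> T \<Longrightarrow> TmEq \<Gamma> a b B \<in> T"
    and Tm_Var: "wf_ctx T \<Gamma> \<Longrightarrow> i < length \<Gamma> \<Longrightarrow> Tm \<Gamma> (Var i) (wk (Suc i) (\<Gamma> ! i)) \<in> T"
    and Ty_subst: "wf_ctx T \<Gamma> \<Longrightarrow> elem T \<Gamma> f \<Delta> \<Longrightarrow> Ty \<Delta> A \<in> T \<Longrightarrow> Ty \<Gamma> (inst f A) \<in> T"
    and Tm_subst: "wf_ctx T \<Gamma> \<Longrightarrow> elem T \<Gamma> f \<Delta> \<Longrightarrow> Tm \<Delta> a A \<in> T \<Longrightarrow>
      Tm \<Gamma> (inst f a) (inst f A) \<in> T"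
    and TyEq_subst: "wf_ctx T \<Gamma> \<Longrightarrow> elem T \<Gamma> f \<Delta> \<Longrightarrow> TyEq \<Delta> A B \<in> T \<Longrightarrow>
      TyEq \<Gamma> (inst f A) (inst f B) \<in> T"
    and TmEq_subst: "wf_ctx T \<Gamma> \<Longrightarrow> elem T \<Gamma> f \<Delta> \<Longrightarrow> TmEq \<Delta> a b A \<in> T \<Longrightarrow>
      TmEq \<Gamma> (inst f a) (inst f b) (inst f A) \<in> T"
    and Ty_cong: "wf_ctx T \<Gamma> \<Longrightarrow> elem_eq T \<Gamma> f g \<Delta> \<Longrightarrow> Ty \<Delta> A \<in> T \<Longrightarrow>
      TyEq \<Gamma> (inst f A) (inst g A) \<in> T"
    and Tm_cong: "wf_ctx T \<Gamma> \<Longrightarrow> elem_eq T \<Gamma> f g \<Delta> \<Longrightarrow> Tm \<Delta> a A \<in> T \<Longrightarrow>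
      TmEq \<Gamma> (inst f a) (inst g a) (inst f A) \<in> T"
  \<comment> \<open>identity types\<close>
    and Id_form: "Tm \<Gamma> a A \<in> T \<Longrightarrow> Tm \<Gamma> b A \<in> T \<Longrightarrow> Ty \<Gamma> (IdT A a b) \<in> T"
    and Id_cong: "TyEq \<Gamma> A A' \<in> T \<Longrightarrow> TmEq \<Gamma> a a' A \<in> T \<Longrightarrow> TmEq \<Gamma> b b' A \<in> T \<Longrightarrow>
      TyEq \<Gamma> (IdT A a b) (IdT A' a' b') \<in> T"
    and Refl_intro: "Tm \<Gamma> a A \<in> T \<Longrightarrow> Tm \<Gamma> (Refl a) (IdT A a a) \<in> T"
    and Refl_cong: "TmEq \<Gamma> a b A \<in> T \<Longrightarrow> TmEq \<Gamma> (Refl a) (Refl b) (IdT A a a) \<in> T"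
    and J_elim: "Ty (\<Theta> @ id_tele A @ \<Gamma>) C \<in> T \<Longrightarrow>
      Tm (subst_tele diag \<Theta> @ A # \<Gamma>) d (subst (ups (length \<Theta>) diag) C) \<in> T \<Longrightarrow>
      Tm \<Gamma> a A \<in> T \<Longrightarrow> Tm \<Gamma> b A \<in> T \<Longrightarrow> Tm \<Gamma> p (IdT A a b) \<in> T \<Longrightarrow>
      elem T \<Gamma> t (subst_tele (tsub [p, b, a]) \<Theta>) \<Longrightarrow>
      Tm \<Gamma> (J a b p d t) (inst (t @ [p, b, a]) C) \<in> T"
    and J_comp: "Ty (\<Theta> @ id_tele A @ \<Gamma>) C \<in> T \<Longrightarrow>
      Tm (subst_tele diag \<Theta> @ A # \<Gamma>) d (subst (ups (length \<Theta>) diag) C) \<in> T \<Longrightarrow>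
      Tm \<Gamma> a A \<in> T \<Longrightarrow> elem T \<Gamma> t (subst_tele (tsub [Refl a, a, a]) \<Theta>) \<Longrightarrow>
      TmEq \<Gamma> (J a a (Refl a) d t) (inst (t @ [a]) d) (inst (t @ [Refl a, a, a]) C) \<in> T"
    and J_cong: "Ty (\<Theta> @ id_tele A @ \<Gamma>) C \<in> T \<Longrightarrow>
      TmEq (subst_tele diag \<Theta> @ A # \<Gamma>) d d' (subst (ups (length \<Theta>) diag) C) \<in> T \<Longrightarrow>
      TmEq \<Gamma> a a' A \<in> T \<Longrightarrow> TmEq \<Gamma> b b' A \<in> T \<Longrightarrow> TmEq \<Gamma> p p' (IdT A a b) \<in> T \<Longrightarrow>
      elem_eq T \<Gamma> t t' (subst_tele (tsub [p, b, a]) \<Theta>) \<Longrightarrow>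
      TmEq \<Gamma> (J a b p d t) (J a' b' p' d' t') (inst (t @ [p, b, a]) C) \<in> T"

section \<open>Categories\<close>

record ('o, 'a) cat =
  Ob :: "'o set"
  Ar :: "'a set"
  Dom :: "'a \<Rightarrow> 'o"
  Cod :: "'a \<Rightarrow> 'o"
  Idn :: "'o \<Rightarrow> 'a"
  Cmp :: "'a \<Rightarrow> 'a \<Rightarrow> 'a"  \<comment> \<open>\<open>Cmp C g f\<close> is \<open>g\<close> after \<open>f\<close>\<close>

definition category :: "('o, 'a) cat \<Rightarrow> bool" where
  "category C \<longleftrightarrow>
     (\<forall>f \<in> Ar C. Dom C f \<in> Ob C \<and> Cod C f \<in> Ob C) \<and>
     (\<forall>X \<in> Ob C. Idn C X \<in> Ar C \<and> Dom C (Idn C X) = X \<and> Cod C (Idn C X) = X) \<and>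
     (\<forall>f \<in> Ar C. \<forall>g \<in> Ar C. Cod C f = Dom C g \<longrightarrow>
        Cmp C g f \<in> Ar C \<and> Dom C (Cmp C g f) = Dom C f \<and> Cod C (Cmp C g f) = Cod C g) \<and>
     (\<forall>f \<in> Ar C. Cmp C f (Idn C (Dom C f)) = f \<and> Cmp C (Idn C (Cod C f)) f = f) \<and>
     (\<forall>f \<in> Ar C. \<forall>g \<in> Ar C. \<forall>h \<in> Ar C. Cod C f = Dom C g \<longrightarrow> Cod C g = Dom C h \<longrightarrow>
        Cmp C h (Cmp C g f) = Cmp C (Cmp C h g) f)"

definition is_iso :: "('o, 'a) cat \<Rightarrow> 'a \<Rightarrow> bool" where
  "is_iso C f \<longleftrightarrow> f \<in> Ar C \<and>
     (\<exists>g \<in> Ar C. Dom C g = Cod C f \<and> Cod C g = Dom C f \<and>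
        Cmp C g f = Idn C (Dom C f) \<and> Cmp C f g = Idn C (Cod C f))"

definition groupoid :: "('o, 'a) cat \<Rightarrow> bool" where
  "groupoid C \<longleftrightarrow> category C \<and> (\<forall>f \<in> Ar C. is_iso C f)"

definition is_functor ::
  "('o, 'a) cat \<Rightarrow> ('p, 'b) cat \<Rightarrow> ('o \<Rightarrow> 'p) \<Rightarrow> ('a \<Rightarrow> 'b) \<Rightarrow> bool" where
  "is_functor C D Fo Fa \<longleftrightarrow> category C \<and> category D \<and>
     (\<forall>X \<in> Ob C. Fo X \<in> Ob D \<and> Fa (Idn C X) = Idn D (Fo X)) \<and>
     (\<forall>f \<in> Ar C. Fa f \<in> Ar D \<and> Dom D (Fa f) = Fo (Dom C f) \<and> Cod D (Fa f) = Fo (Cod C f)) \<and>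
     (\<forall>f \<in> Ar C. \<forall>g \<in> Ar C. Cod C f = Dom C g \<longrightarrow> Fa (Cmp C g f) = Cmp D (Fa g) (Fa f))"

definition nat_iso ::
  "('o, 'a) cat \<Rightarrow> ('p, 'b) cat \<Rightarrow> ('o \<Rightarrow> 'p) \<Rightarrow> ('a \<Rightarrow> 'b) \<Rightarrow> ('o \<Rightarrow> 'p) \<Rightarrow> ('a \<Rightarrow> 'b) \<Rightarrow>
   ('o \<Rightarrow> 'b) \<Rightarrow> bool" where
  "nat_iso C D Fo Fa Go Ga \<eta> \<longleftrightarrow>
     (\<forall>X \<in> Ob C. is_iso D (\<eta> X) \<and> Dom D (\<eta> X) = Fo X \<and> Cod D (\<eta> X) = Go X) \<and>
     (\<forall>f \<in> Ar C. Cmp D (\<eta> (Cod C f)) (Fa f) = Cmp D (Ga f) (\<eta> (Dom C f)))"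

definition equivalence_of_categories ::
  "('o, 'a) cat \<Rightarrow> ('p, 'b) cat \<Rightarrow> ('o \<Rightarrow> 'p) \<Rightarrow> ('a \<Rightarrow> 'b) \<Rightarrow> bool" where
  "equivalence_of_categories C D Fo Fa \<longleftrightarrow> is_functor C D Fo Fa \<and>
     (\<exists>Go Ga. is_functor D C Go Ga \<and>
        (\<exists>\<eta>. nat_iso C C (\<lambda>X. X) (\<lambda>f. f) (Go \<circ> Fo) (Ga \<circ> Fa) \<eta>) \<and>
        (\<exists>\<epsilon>. nat_iso D D (Fo \<circ> Go) (Fa \<circ> Ga) (\<lambda>Y. Y) (\<lambda>g. g) \<epsilon>))"

definition grothendieck_fibration ::
  "('o, 'a) cat \<Rightarrow> ('p, 'b) cat \<Rightarrow> ('o \<Rightarrow> 'p) \<Rightarrow> ('a \<Rightarrow> 'b) \<Rightarrow> bool" where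
  "grothendieck_fibration A B Fo Fa \<longleftrightarrow> groupoid A \<and> groupoid B \<and> is_functor A B Fo Fa \<and>
     (\<forall>a \<in> Ob A. \<forall>\<beta> \<in> Ar B. Dom B \<beta> = Fo a \<longrightarrow>
        (\<exists>\<alpha> \<in> Ar A. Dom A \<alpha> = a \<and> Fo (Cod A \<alpha>) = Cod B \<beta> \<and> Fa \<alpha> = \<beta>))"

definition lifts :: "('o, 'a) cat \<Rightarrow> 'a \<Rightarrow> 'a \<Rightarrow> bool" where
  "lifts C i p \<longleftrightarrow>
     (\<forall>h \<in> Ar C. \<forall>k \<in> Ar C.
        Dom C h = Dom C i \<and> Cod C h = Dom C p \<and> Dom C k = Cod C i \<and> Cod C k = Cod C p \<and>
        Cmp C p h = Cmp C k i \<longrightarrow>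
        (\<exists>j \<in> Ar C. Dom C j = Cod C i \<and> Cod C j = Dom C p \<and> Cmp C j i = h \<and> Cmp C p j = k))"

section \<open>The classifying category\<close>

definition ctx_class :: "'s judgement set \<Rightarrow> 's ctx \<Rightarrow> 's ctx set" where
  "ctx_class T \<Gamma> = {\<Gamma>'. ctx_eq T \<Gamma> \<Gamma>'}"

definition tup_class :: "'s judgement set \<Rightarrow> 's ctx \<Rightarrow> 's ctx \<Rightarrow> 's tup \<Rightarrow> 's tup set" where
  "tup_class T \<Gamma> \<Delta> f = {f'. elem_eq T \<Gamma> f f' \<Delta>}"

type_synonym 's carrow = "'s ctx set \<times> 's ctx set \<times> 's tup set"

definition carrow :: "'s judgement set \<Rightarrow> 's ctx \<Rightarrow> 's ctx \<Rightarrow> 's tup \<Rightarrow> 's carrow" where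
  "carrow T \<Gamma> \<Delta> f = (ctx_class T \<Gamma>, ctx_class T \<Delta>, tup_class T \<Gamma> \<Delta> f)"

definition tup_comp :: "'s tup \<Rightarrow> 's tup \<Rightarrow> 's tup" where
  "tup_comp g f = map (inst f) g"

definition classifying_category :: "'s judgement set \<Rightarrow> ('s ctx set, 's carrow) cat" where
  "classifying_category T =
     \<lparr>Ob = {ctx_class T \<Gamma> | \<Gamma>. wf_ctx T \<Gamma>},
      Ar = {carrow T \<Gamma> \<Delta> f | \<Gamma> \<Delta> f. wf_ctx T \<Gamma> \<and> wf_ctx T \<Delta> \<and> elem T \<Gamma> f \<Delta>},
      Dom = (\<lambda>(X, Y, F). X),
      Cod = (\<lambda>(X, Y, F). Y),
      Idn = (\<lambda>X. (X, X, \<Union>\<Gamma> \<in> X. tup_class T \<Gamma> \<Gamma> (vars (length \<Gamma>)))),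
      Cmp = (\<lambda>(Y', Z, G) (X, Y, F).
        (X, Z, \<Union>\<Gamma> \<in> X. \<Union>\<Delta> \<in> Z. \<Union>f \<in> F. \<Union>g \<in> G. tup_class T \<Gamma> \<Delta> (tup_comp g f)))\<rparr>"

definition display_maps :: "'s judgement set \<Rightarrow> 's carrow set" where
  "display_maps T =
     {carrow T (A # \<Gamma>) \<Gamma> (map Var [1..<Suc (length \<Gamma>)]) | \<Gamma> A. wf_ctx T (A # \<Gamma>)}"

definition class_A :: "'s judgement set \<Rightarrow> 's carrow set" where
  "class_A T = {i \<in> Ar (classifying_category T).
     \<forall>p \<in> display_maps T. lifts (classifying_category T) i p}"

definition class_B :: "'s judgement set \<Rightarrow> 's carrow set" where
  "class_B T = {p \<in> Ar (classifying_category T).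
     \<forall>i \<in> class_A T. lifts (classifying_category T) i p}"

section \<open>Identity contexts\<close>

text \<open>
  \<open>Jc a b p d t\<close> is $\mathrm{J}(a,b,p,[x,z]d)$ for $p \in \mathrm{Id}_\Phi(a,b)$ with \<open>\<Phi>\<close> a context, again
  with an explicit parameter tuple \<open>t\<close>; here \<open>d\<close> binds \<open>length a + length t\<close> variables.
  For $\Phi' = (x \in \Phi, x' \in A(x))$, elimination over \<open>\<Phi>\<close> with the additional parameters
  $x' \in A(x)$, $y' \in A(y)$, $u' \in \mathrm{Id}_{A(y)}(u_!(x'), y')$ reduces the problem to the case
  $y = x$, $u = \mathrm{r}(x)$, where $u_!(x') = x'$ and the elimination rule for
  $\mathrm{Id}_{A(x)}$ applies: its result is $\mathrm{J}(x',y',u',[x'',z'']d(x,x'',z''))(z)$. The renaming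
  below takes \<open>d\<close> from \<open>(x, x'', z'')\<close> to \<open>(x, x', y', u', z, x'', z'')\<close>.
\<close>

fun Jc :: "'s tup \<Rightarrow> 's tup \<Rightarrow> 's tup \<Rightarrow> 's exp \<Rightarrow> 's tup \<Rightarrow> 's exp" where
  "Jc (a' # a) (b' # b) (p' # p) d t =
     (let m = length t in
      Jc a b p
        (J (Var (m + 2)) (Var (m + 1)) (Var m)
           (ren (\<lambda>i. if i \<le> m then i else i + m + 3) d) (vars m))
        (t @ [p', b', a']))"
| "Jc _ _ _ d t = inst t d"

text \<open>Eliminating into a context, as in \<open>transport\<close>, is done componentwise.\<close>

definition transport :: "'s tup \<Rightarrow> 's tup \<Rightarrow> 's tup \<Rightarrow> 's tup \<Rightarrow> 's tup" where
  "transport a b p e = map (\<lambda>z. Jc a b p z e) (vars (length e))"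

text \<open>
  \<open>Idc \<Phi> a b\<close> is $\mathrm{Id}_\Phi(a,b)$. Its last type lives over the variables
  $u \in \mathrm{Id}_\Phi(a,b)$, whence the weakenings.
\<close>

fun Idc :: "'s ctx \<Rightarrow> 's tup \<Rightarrow> 's tup \<Rightarrow> 's ctx" where
  "Idc (A # \<Phi>) (a' # a) (b' # b) =
     (let n = length \<Phi>; w = wk n in
      IdT (w (inst b A)) (hd (transport (map w a) (map w b) (vars n) [w a'])) (w b')
      # Idc \<Phi> a b)"
| "Idc _ _ _ = []"

section \<open>The fundamental groupoid\<close>

text \<open>
  Objects are global elements up to definitional equality, that is, morphisms from the empty
  context.
\<close>

type_synonym 's garrow = "'s tup set \<times> 's tup set \<times> 's tup set"

definition pt_class :: "'s judgement set \<Rightarrow> 's ctx \<Rightarrow> 's tup \<Rightarrow> 's tup set" where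
  "pt_class T \<Phi> a = tup_class T [] \<Phi> a"

definition homotopic ::
  "'s judgement set \<Rightarrow> 's ctx \<Rightarrow> 's tup \<Rightarrow> 's tup \<Rightarrow> 's tup \<Rightarrow> 's tup \<Rightarrow> bool" where
  "homotopic T \<Phi> a b p q \<longleftrightarrow> (\<exists>h. elem T [] h (Idc (Idc \<Phi> a b) p q))"

definition path_class ::
  "'s judgement set \<Rightarrow> 's ctx \<Rightarrow> 's tup \<Rightarrow> 's tup \<Rightarrow> 's tup \<Rightarrow> 's tup set" where
  "path_class T \<Phi> a b p = {q. elem T [] q (Idc \<Phi> a b) \<and> homotopic T \<Phi> a b p q}"

definition fund_groupoid :: "'s judgement set \<Rightarrow> 's ctx \<Rightarrow> ('s tup set, 's garrow) cat" where
  "fund_groupoid T \<Phi> =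
     \<lparr>Ob = {pt_class T \<Phi> a | a. elem T [] a \<Phi>},
      Ar = {(pt_class T \<Phi> a, pt_class T \<Phi> b, path_class T \<Phi> a b p) | a b p.
              elem T [] a \<Phi> \<and> elem T [] b \<Phi> \<and> elem T [] p (Idc \<Phi> a b)},
      Dom = (\<lambda>(X, Y, P). X),
      Cod = (\<lambda>(X, Y, P). Y),
      Idn = (\<lambda>X. (X, X, \<Union>a \<in> X. path_class T \<Phi> a a (map Refl a))),
      Cmp = (\<lambda>(Y', Z, Q) (X, Y, P).
        (X, Z, \<Union>a \<in> X. \<Union>b \<in> Y. \<Union>c \<in> Z. \<Union>p \<in> P. \<Union>q \<in> Q.
                 path_class T \<Phi> a c (transport b c q p)))\<rparr>"

text \<open>For \<open>f : \<Phi> \<rightarrow> \<Psi>\<close>, the functor $\mathcal{F}(f)$ on objects and on arrows.\<close>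

definition fund_ob :: "'s judgement set \<Rightarrow> 's ctx \<Rightarrow> 's tup \<Rightarrow> 's tup set \<Rightarrow> 's tup set" where
  "fund_ob T \<Psi> f X = (\<Union>a \<in> X. pt_class T \<Psi> (tup_comp f a))"

definition ap :: "'s tup \<Rightarrow> 's tup \<Rightarrow> 's tup \<Rightarrow> 's tup \<Rightarrow> 's tup" where
  "ap f a b p = map (\<lambda>e. Jc a b p (Refl e) []) f"

definition fund_ar :: "'s judgement set \<Rightarrow> 's ctx \<Rightarrow> 's tup \<Rightarrow> 's garrow \<Rightarrow> 's garrow" where
  "fund_ar T \<Psi> f = (\<lambda>(X, Y, P).
     (fund_ob T \<Psi> f X, fund_ob T \<Psi> f Y,
      \<Union>a \<in> X. \<Union>b \<in> Y. \<Union>p \<in> P. path_class T \<Psi> (tup_comp f a) (tup_comp f b) (ap f a b p)))"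

end

theory Submission
  imports Defs
begin

text \<open>
  The elimination rule for identity contexts is proved by induction on the length of the context,
  together with the formation and introduction rules. It shows that two terms in context
  $(x, y, u \in \mathrm{Id}_\Phi(x,y))$ that agree definitionally at $(x, x, \mathrm{r}(x))$ are
  homotopic, which gives the groupoid laws and the functoriality of $\mathcal{F}$.

  (i) If $f \in \mathcal{A}$, lifting against dependent projections gives $s : \Psi \to \Phi$ with
  $s \circ f = 1$ and then $\theta(y) \in \mathrm{Id}_\Psi(f(s(y)), y)$. Hence $\mathcal{F}(s)$ is a
  strict left inverse of $\mathcal{F}(f)$, and a right inverse up to the natural isomorphism
  $[\theta]$.

  (ii) For $c = f(a)$, the map $(c, \mathrm{r}(c))$ from the empty context to
  $(y \in \Psi, u \in \mathrm{Id}_\Psi(c,y))$ is in $\mathcal{A}$ by based path induction. If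
  $f \in \mathcal{B}$, lifting it against $f$ gives $j(y,u) \in \Phi$ with $j(c,\mathrm{r}(c)) = a$ and
  $f(j(y,u)) = y$. Again by based path induction there is a path from $a$ to $j(y,u)$ that is
  reflexivity at $(c,\mathrm{r}(c))$, and its image under $f$ is homotopic to $u$.
\<close>

section \<open>Substitutions\<close>

text \<open>The rules for identity contexts cannot be proved one after another. The last type of the
  longer identity context mentions the transport \<open>u_!\<close>, so forming it needs elimination
  one length below. Reflexivity is well typed only because transport along reflexivity computes.
  Eliminating a longer path means eliminating its initial part with x', y', u' as parameters and
  then u' itself, and the computation rule is needed again to turn the type of u' into a plain
  identity type.

  Function types are not assumed, so these parameters are essential. Associativity and preservation
  of composites rest on them too: a second path that ends where the eliminated one begins is passed
  as a parameter.

  \<open>J\<close> records no motive, so the terms built here commute with substitution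
  syntactically, and only their typing depends on the theory. Objects are taken up to definitional
  equality and arrows up to homotopy. Injectivity and the strict condition on objects in the
  fibration property therefore come from lifting squares that commute definitionally, while
  statements about arrows may be settled by elimination.\<close>

definition sh :: "nat \<Rightarrow> nat \<Rightarrow> 's exp" where
  "sh k i = Var (i + k)"

definition scomp :: "(nat \<Rightarrow> 's exp) \<Rightarrow> (nat \<Rightarrow> 's exp) \<Rightarrow> nat \<Rightarrow> 's exp"  (infixl "\<odot>" 55) where
  "(\<tau> \<odot> \<sigma>) i = subst \<tau> (\<sigma> i)"

text \<open>This is the extension t.\<sigma> of explicit-substitution calculi. Instantiation,
  lifting under binders and the diagonals are all expressed by it and \<open>sh\<close>, so
  equations between substitutions become a matter of rewriting.\<close>

definition cat :: "'s tup \<Rightarrow> (nat \<Rightarrow> 's exp) \<Rightarrow> nat \<Rightarrow> 's exp" where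
  "cat t \<sigma> i = (if i < length t then t ! i else \<sigma> (i - length t))"

text \<open>\<open>seg k n\<close> is the generic element of a telescope of length \<open>n\<close> that is followed by \<open>k\<close>
  further entries of the context.\<close>

definition seg :: "nat \<Rightarrow> nat \<Rightarrow> 's tup" where
  "seg k n = map Var [k..<k + n]"

abbreviation sb :: "(nat \<Rightarrow> 's exp) \<Rightarrow> 's tup \<Rightarrow> 's tup" where
  "sb \<sigma> \<equiv> map (subst \<sigma>)"

lemma ups_Var_comp: "ups k (\<lambda>i. Var (\<rho> i)) = (\<lambda>i. Var (upr k \<rho> i))"
  by (auto simp: ups_def upr_def wk_def)

lemma ren_conv_subst: "ren \<rho> e = subst (\<lambda>i. Var (\<rho> i)) e"
proof (induction e arbitrary: \<rho>)
  case (Op c es)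
  then show ?case by (auto simp: ups_Var_comp snds.simps)
qed (auto simp: ups_Var_comp)

text \<open>Lifting under a binder weakens, and weakening is a renaming. The composition law for
  substitutions is therefore reached through the two mixed cases of renaming and
  substitution.\<close>

lemma subst_ren: "subst \<sigma> (ren \<rho> e) = subst (\<lambda>i. \<sigma> (\<rho> i)) e"
proof -
  have *: "(\<lambda>i. ups k \<sigma> (upr k \<rho> i)) = ups k (\<lambda>i. \<sigma> (\<rho> i))" for k \<sigma> \<rho>
    by (auto simp: ups_def upr_def)
  show ?thesis
  proof (induction e arbitrary: \<sigma> \<rho>)
    case (Op c es)
    then show ?case by (auto simp: * snds.simps)
  qed (auto simp: *)
qed

lemma ren_ren: "ren \<rho> (ren \<rho>' e) = ren (\<lambda>i. \<rho> (\<rho>' i)) e"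
proof -
  have "ren \<rho> (ren \<rho>' e) = subst (\<lambda>i. Var (\<rho> i)) (ren \<rho>' e)"
    by (rule ren_conv_subst)
  also have "\<dots> = subst (\<lambda>i. Var (\<rho> (\<rho>' i))) e"
    by (rule subst_ren)
  also have "\<dots> = ren (\<lambda>i. \<rho> (\<rho>' i)) e"
    by (rule ren_conv_subst[symmetric])
  finally show ?thesis .
qed

lemma ren_subst: "ren \<rho> (subst \<sigma> e) = subst (\<lambda>i. ren \<rho> (\<sigma> i)) e"
proof -
  have *: "(\<lambda>i. ren (upr k \<rho>) (ups k \<sigma> i)) = ups k (\<lambda>i. ren \<rho> (\<sigma> i))" for k \<sigma> \<rho>
    by (auto simp: ups_def wk_def ren_ren upr_def fun_eq_iff)
  show ?thesis
  proof (induction e arbitrary: \<sigma> \<rho>)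
    case (Op c es)
    then show ?case by (auto simp: * snds.simps)
  qed (auto simp: *)
qed

lemma subst_subst [simp]: "subst \<tau> (subst \<sigma> e) = subst (\<tau> \<odot> \<sigma>) e"
proof -
  have *: "ups k \<tau> \<odot> ups k \<sigma> = ups k (\<tau> \<odot> \<sigma>)" for k and \<sigma> \<tau> :: "nat \<Rightarrow> 's exp"
    by (auto simp: ups_def scomp_def wk_def subst_ren ren_subst fun_eq_iff)
  show ?thesis
  proof (induction e arbitrary: \<sigma> \<tau>)
    case (Op c es)
    then show ?case by (auto simp: * snds.simps)
  qed (auto simp: * scomp_def[of _ _ "_::nat"])
qed

lemma subst_Var [simp]: "subst Var e = e"
proof -
  have *: "ups k Var = Var" for k
    by (auto simp: ups_def wk_def fun_eq_iff)
  show ?thesis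
  proof (induction e)
    case (Op c es)
    then show ?case by (auto simp: * snds.simps intro!: map_idI)
  qed (auto simp: * intro!: map_idI)
qed

lemma sb_Var [simp]: "sb Var t = t"
  by (simp add: map_idI)

text \<open>This allows a substitution to be cut down to a finite tuple, and it makes closed
  contexts and closed elements invariant under every substitution.\<close>

lemma scoped_subst_cong:
  "scoped n e \<Longrightarrow> \<forall>i<n. \<sigma> i = \<tau> i \<Longrightarrow> subst \<sigma> e = subst \<tau> e"
proof -
  have *: "\<forall>i < n + k. ups k \<sigma> i = ups k \<tau> i" if "\<forall>i<n. \<sigma> i = \<tau> i"
    for n k and \<sigma> \<tau> :: "nat \<Rightarrow> 's exp"
    using that by (auto simp: ups_def)
  show "scoped n e \<Longrightarrow> \<forall>i<n. \<sigma> i = \<tau> i \<Longrightarrow> subst \<sigma> e = subst \<tau> e"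
  proof (induction e arbitrary: n \<sigma> \<tau>)
    case (Op c es)
    have "subst (ups k \<sigma>) e = subst (ups k \<tau>) e" if "(k, e) \<in> set es" for k e
      by (rule Op.IH[OF that _ _ *[OF Op.prems(2), of k]])
         (use Op.prems(1) that in \<open>auto simp: snds.simps\<close>)
    then show ?case by auto
  next
    case (J a b p d t)
    have "subst (ups (Suc (length t)) \<sigma>) d = subst (ups (Suc (length t)) \<tau>) d"
      by (rule J.IH(4)[OF _ *[OF J.prems(2)]]) (use J.prems(1) in simp)
    moreover have "subst \<sigma> e = subst \<tau> e" if "e \<in> set t" for e
      by (rule J.IH(5)[OF that _ J.prems(2)]) (use J.prems(1) that in simp)
    moreover have "subst \<sigma> a = subst \<tau> a" "subst \<sigma> b = subst \<tau> b" "subst \<sigma> p = subst \<tau> p"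
      by (rule J.IH(1-3)[OF _ J.prems(2)], use J.prems(1) in simp)+
    ultimately show ?case by simp
  next
    case (IdT A a b)
    have "subst \<sigma> A = subst \<tau> A" "subst \<sigma> a = subst \<tau> a" "subst \<sigma> b = subst \<tau> b"
      by (rule IdT.IH[OF _ IdT.prems(2)], use IdT.prems(1) in simp)+
    then show ?case by simp
  next
    case (Refl a)
    have "subst \<sigma> a = subst \<tau> a"
      by (rule Refl.IH[OF _ Refl.prems(2)], use Refl.prems(1) in simp)
    then show ?case by simp
  qed simp
qed

lemma wk_conv: "wk k = subst (sh k)"
  by (simp add: wk_def sh_def[abs_def] ren_conv_subst fun_eq_iff)

lemma sh_app [simp]: "sh k i = Var (i + k)"
  by (simp add: sh_def)

lemma sh_0 [simp]: "sh 0 = Var"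
  by (simp add: fun_eq_iff)

lemma scomp_assoc [simp]: "\<tau> \<odot> (\<sigma> \<odot> \<rho>) = \<tau> \<odot> \<sigma> \<odot> \<rho>"
  by (simp add: scomp_def fun_eq_iff)

lemma scomp_Var [simp]: "\<tau> \<odot> Var = \<tau>" "Var \<odot> \<sigma> = \<sigma>"
  by (auto simp: scomp_def fun_eq_iff)

lemma sb_sb [simp]: "sb \<tau> (sb \<sigma> t) = sb (\<tau> \<odot> \<sigma>) t"
  by simp

declare map_map [simp del] \<comment> \<open>would destroy the normal forms \<open>sb \<sigma> (seg k n)\<close> and \<open>map Refl (sb \<sigma> a)\<close>\<close>

lemma cat_Nil [simp]: "cat [] \<sigma> = \<sigma>"
  by (simp add: cat_def fun_eq_iff)

lemma cat_append [simp]: "cat (s @ t) \<sigma> = cat s (cat t \<sigma>)"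
  by (auto simp: cat_def nth_append fun_eq_iff)

lemma scomp_cat [simp]: "\<tau> \<odot> cat t \<sigma> = cat (sb \<tau> t) (\<tau> \<odot> \<sigma>)"
  by (auto simp: cat_def scomp_def fun_eq_iff)

lemma tsub_cat: "tsub t = cat t Var"
  by (auto simp: cat_def tsub_def fun_eq_iff)

lemma ups_cat: "ups k \<sigma> = cat (seg 0 k) (sh k \<odot> \<sigma>)"
  by (auto simp: cat_def ups_def seg_def scomp_def wk_conv fun_eq_iff)

lemma cat_sh: "length t \<le> k \<Longrightarrow> cat t \<sigma> \<odot> sh k = \<sigma> \<odot> sh (k - length t)"
  by (auto simp: cat_def scomp_def fun_eq_iff)

lemma sh_sh: "sh j \<odot> sh k = sh (j + k)"
  by (auto simp: scomp_def fun_eq_iff)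

lemma scomp_sh_sh: "\<rho> \<odot> sh j \<odot> sh k = \<rho> \<odot> sh (j + k)"
  by (auto simp: scomp_def fun_eq_iff add.commute add.left_commute)

lemma length_seg [simp]: "length (seg k n) = n"
  by (simp add: seg_def)

lemma nth_seg [simp]: "i < n \<Longrightarrow> seg k n ! i = Var (k + i)"
  by (simp add: seg_def)

lemma seg_0 [simp]: "seg k 0 = []"
  by (simp add: seg_def)

lemma seg_Suc: "seg k (Suc n) = Var k # seg (Suc k) n"
  by (simp add: seg_def upt_conv_Cons del: upt_Suc)

lemma vars_seg: "vars n = seg 0 n"
  by (simp add: seg_def)

lemma sb_seg_sh [simp]: "sb (sh j) (seg k n) = seg (k + j) n"
  by (rule nth_equalityI) auto

lemma sb_seg_skip: "length t \<le> k \<Longrightarrow> sb (cat t \<sigma>) (seg k n) = sb \<sigma> (seg (k - length t) n)"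
  by (rule nth_equalityI) (auto simp: cat_def)

lemma sb_seg_hit: "length t = n \<Longrightarrow> sb (cat t \<sigma>) (seg 0 n) = t"
  by (rule nth_equalityI) (auto simp: cat_def)

lemma cat_lookup_skip: "length t \<le> i \<Longrightarrow> cat t \<sigma> i = \<sigma> (i - length t)"
  by (simp add: cat_def)

lemma cat_seg_sh: "j = k + n \<Longrightarrow> cat (seg k n) (sh j) = sh k"
  by (auto simp: cat_def fun_eq_iff)

lemma cat_inst: "length t = k \<Longrightarrow> cat t \<sigma> \<odot> ups k \<tau> = cat t (\<sigma> \<odot> \<tau>)"
  by (simp add: ups_cat cat_sh sb_seg_hit)

section \<open>Judgements and substitution\<close>

lemma ups_comp: "ups k \<tau> \<odot> ups k \<sigma> = ups k (\<tau> \<odot> \<sigma>)"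
  by (simp add: ups_cat cat_sh sb_seg_hit)

lemma ups_ups: "ups k (ups l \<sigma>) = ups (k + l) \<sigma>"
  by (auto simp: ups_def wk_def ren_ren fun_eq_iff add.assoc add.commute[of l])

lemma ups_Var [simp]: "ups k Var = Var"
  by (auto simp: ups_def wk_def)

lemma ups_0 [simp]: "ups 0 \<sigma> = \<sigma>"
  by (simp add: ups_cat)

lemma length_subst_tele [simp]: "length (subst_tele \<sigma> \<Theta>) = length \<Theta>"
  by (induction \<Theta>) auto

lemma subst_tele_subst_tele [simp]:
  "subst_tele \<tau> (subst_tele \<sigma> \<Theta>) = subst_tele (\<tau> \<odot> \<sigma>) \<Theta>"
  by (induction \<Theta>) (auto simp: ups_comp)

lemma subst_tele_Var [simp]: "subst_tele Var \<Theta> = \<Theta>"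
  by (induction \<Theta>) auto

lemma subst_tele_append [simp]:
  "subst_tele \<sigma> (\<Theta>' @ \<Theta>) = subst_tele (ups (length \<Theta>) \<sigma>) \<Theta>' @ subst_tele \<sigma> \<Theta>"
  by (induction \<Theta>') (auto simp: ups_ups)

lemma nth_subst_tele:
  "i < length \<Theta> \<Longrightarrow> subst_tele \<sigma> \<Theta> ! i = subst (ups (length \<Theta> - Suc i) \<sigma>) (\<Theta> ! i)"
  by (induction \<Theta> arbitrary: i) (auto simp: nth_Cons split: nat.splits)

lemma cat_comp_sh_drop:
  "k \<le> length t \<Longrightarrow> cat t \<sigma> \<odot> sh k = cat (drop k t) \<sigma>"
  by (auto simp: cat_def scomp_def fun_eq_iff add.commute)

lemma map_cat_upt: "map (cat t \<sigma>) [0..<length t] = t"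
  by (rule nth_equalityI) (auto simp: cat_def)

context type_theory
begin

section \<open>Substitutions and tuples up to definitional equality\<close>

text \<open>Typing is treated as the reflexive instance of definitional equality, so that every rule
  needs to be stated for equality only.\<close>

abbreviation "wfc \<equiv> wf_ctx T"
abbreviation "tye \<Gamma> A B \<equiv> TyEq \<Gamma> A B \<in> T"
abbreviation "tme \<Gamma> a b A \<equiv> TmEq \<Gamma> a b A \<in> T"
abbreviation "ele \<equiv> elem_eq T"

text \<open>Substitutions are total functions, constrained only at the variables of \<Gamma>. The
  type of variable i refers to the entries declared before it, so it is instantiated by
  \<open>\<sigma> \<odot> sh (Suc i)\<close>, the part of \<sigma> that concerns them.
  Well-formedness of both contexts is included so that it need not be carried separately.\<close>

definition sme :: "'s ctx \<Rightarrow> (nat \<Rightarrow> 's exp) \<Rightarrow> (nat \<Rightarrow> 's exp) \<Rightarrow> 's ctx \<Rightarrow> bool" where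
  "sme \<Delta> \<sigma> \<tau> \<Gamma> \<longleftrightarrow> wfc \<Delta> \<and> wfc \<Gamma> \<and>
     (\<forall>i < length \<Gamma>. tme \<Delta> (\<sigma> i) (\<tau> i) (subst (\<sigma> \<odot> sh (Suc i)) (\<Gamma> ! i)))"

text \<open>Over the empty context this is \<open>ctx_eq\<close>. The relative version is needed
  because identity contexts depend on their endpoints.\<close>

fun teq :: "'s ctx \<Rightarrow> 's ctx \<Rightarrow> 's ctx \<Rightarrow> bool" where
  "teq \<Gamma> [] [] \<longleftrightarrow> wfc \<Gamma>"
| "teq \<Gamma> (A # \<Theta>) (B # \<Theta>') \<longleftrightarrow> teq \<Gamma> \<Theta> \<Theta>' \<and> tye (\<Theta> @ \<Gamma>) A B"
| "teq \<Gamma> _ _ \<longleftrightarrow> False"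

lemma Tm_iff: "Tm \<Gamma> a A \<in> T \<longleftrightarrow> tme \<Gamma> a a A"
  using TmEq_refl TmEq_Tm by blast

lemma Ty_iff: "Ty \<Gamma> A \<in> T \<longleftrightarrow> tye \<Gamma> A A"
  using TyEq_refl TyEq_Ty by blast

lemma tye_wf: "tye \<Gamma> A B \<Longrightarrow> wfc \<Gamma>"
  using TyEq_Ty Ty_ctx by blast

lemma tme_tye: "tme \<Gamma> a b A \<Longrightarrow> tye \<Gamma> A A"
  using TmEq_Tm Tm_Ty Ty_iff by blast

lemma tme_wf: "tme \<Gamma> a b A \<Longrightarrow> wfc \<Gamma>"
  using tme_tye tye_wf by blast

lemma tme_refl1: "tme \<Gamma> a b A \<Longrightarrow> tme \<Gamma> a a A"
  using TmEq_trans TmEq_sym by blast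

lemma elem_iff: "elem T \<Gamma> t \<Theta> \<longleftrightarrow> ele \<Gamma> t t \<Theta>"
  by (induction t arbitrary: \<Theta>; case_tac \<Theta>) (auto simp: Tm_iff)

lemma ele_length: "ele \<Gamma> s t \<Theta> \<Longrightarrow> length s = length \<Theta> \<and> length t = length \<Theta>"
  by (induction T \<Gamma> s t \<Theta> rule: elem_eq.induct) auto

lemma ele_refl1: "ele \<Gamma> s t \<Theta> \<Longrightarrow> ele \<Gamma> s s \<Theta>"
proof (induction \<Theta> arbitrary: s t)
  case Nil
  then show ?case by (cases s; cases t) auto
next
  case (Cons A \<Theta>)
  then show ?case by (cases s; cases t) (auto intro: tme_refl1)
qed

lemma ele_nth: "ele \<Delta> s t \<Theta> \<longleftrightarrow> length s = length \<Theta> \<and> length t = length \<Theta> \<and>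
  (\<forall>i < length \<Theta>. tme \<Delta> (s ! i) (t ! i) (inst (drop (Suc i) s) (\<Theta> ! i)))"
proof (induction \<Theta> arbitrary: s t)
  case Nil
  then show ?case by (cases s; cases t) auto
next
  case (Cons A \<Theta>)
  then show ?case by (cases s; cases t) (auto simp: nth_Cons split: nat.splits)
qed

lemma wf_append: "wfc (\<Theta> @ \<Gamma>) \<Longrightarrow> wfc \<Gamma>"
  by (induction \<Theta>) auto

lemma wf_drop: "wfc \<Gamma> \<Longrightarrow> wfc (drop i \<Gamma>)"
  by (metis append_take_drop_id wf_append)

lemma wf_nth: "wfc \<Gamma> \<Longrightarrow> i < length \<Gamma> \<Longrightarrow> Ty (drop (Suc i) \<Gamma>) (\<Gamma> ! i) \<in> T"
  by (metis Cons_nth_drop_Suc wf_ctx.simps(2) wf_drop)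

lemma wf_scoped: "wfc \<Gamma> \<Longrightarrow> i < length \<Gamma> \<Longrightarrow> scoped (length \<Gamma> - Suc i) (\<Gamma> ! i)"
  using Ty_scoped[OF wf_nth] by simp

text \<open>Equality of tuples takes its types at the left tuple. Congruence of types moves each
  component on the right to a type instantiated by the right tuple itself.\<close>

lemma ele_right_closed: "wfc \<Delta> \<Longrightarrow> wfc \<Gamma> \<Longrightarrow> ele \<Delta> s t \<Gamma> \<Longrightarrow> elem T \<Delta> t \<Gamma>"
proof (induction \<Gamma> arbitrary: s t)
  case Nil
  then show ?case by (cases s; cases t) auto
next
  case (Cons A \<Gamma>)
  then obtain a s' b t' where [simp]: "s = a # s'" "t = b # t'"
    by (cases s; cases t) auto
  have "tye \<Delta> (inst s' A) (inst t' A)"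
    using Cons by (intro Ty_cong) auto
  with Cons show ?case
    using Tm_conv[of \<Delta> b "inst s' A" "inst t' A"] TmEq_Tm[of \<Delta> a b "inst s' A"] by auto
qed

lemma inst_map_scoped:
  "scoped n A \<Longrightarrow> inst (map \<sigma> [0..<n]) A = subst \<sigma> A"
  by (rule scoped_subst_cong) (auto simp: tsub_cat cat_def)

lemma sme_ele: "sme \<Delta> \<sigma> \<tau> \<Gamma> \<Longrightarrow> ele \<Delta> (map \<sigma> [0..<length \<Gamma>]) (map \<tau> [0..<length \<Gamma>]) \<Gamma>"
proof -
  assume a: "sme \<Delta> \<sigma> \<tau> \<Gamma>"
  have "subst (\<sigma> \<odot> sh (Suc i)) (\<Gamma> ! i) = inst (drop (Suc i) (map \<sigma> [0..<length \<Gamma>])) (\<Gamma> ! i)"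
    if "i < length \<Gamma>" for i
    by (rule scoped_subst_cong[OF wf_scoped[OF _ that]])
       (use a that in \<open>auto simp: sme_def tsub_cat cat_def scomp_def add.commute\<close>)
  with a show ?thesis by (auto simp: ele_nth sme_def simp del: drop_map)
qed

text \<open>The rules of the theory substitute tuples, so \<sigma> and \<tau> are replaced by their
  values at the variables of \<Gamma>. Congruence changes \<sigma> into \<tau> inside A, and
  substitution along \<tau> then changes A into B.\<close>

lemma sme_tye:
  assumes s: "sme \<Delta> \<sigma> \<tau> \<Gamma>" and "tye \<Gamma> A B"
  shows "tye \<Delta> (subst \<sigma> A) (subst \<tau> B)"
proof -
  let ?s = "map \<sigma> [0..<length \<Gamma>]" and ?t = "map \<tau> [0..<length \<Gamma>]"
  have sc: "scoped (length \<Gamma>) A" "scoped (length \<Gamma>) B"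
    using assms TyEq_Ty Ty_scoped by blast+
  have wf: "wfc \<Delta>" "wfc \<Gamma>" using s by (auto simp: sme_def)
  have "tye \<Delta> (inst ?s A) (inst ?t A)"
    using wf(1) sme_ele[OF s] by (rule Ty_cong) (use assms TyEq_Ty in blast)
  moreover have "tye \<Delta> (inst ?t A) (inst ?t B)"
    using wf(1) ele_right_closed[OF wf sme_ele[OF s]] assms(2) by (rule TyEq_subst)
  ultimately have "tye \<Delta> (inst ?s A) (inst ?t B)" by (rule TyEq_trans)
  then show ?thesis using sc by (simp add: inst_map_scoped)
qed

lemma sme_tme:
  assumes s: "sme \<Delta> \<sigma> \<tau> \<Gamma>" and "tme \<Gamma> a b A"
  shows "tme \<Delta> (subst \<sigma> a) (subst \<tau> b) (subst \<sigma> A)"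
proof -
  let ?s = "map \<sigma> [0..<length \<Gamma>]" and ?t = "map \<tau> [0..<length \<Gamma>]"
  have sc: "scoped (length \<Gamma>) A" "scoped (length \<Gamma>) a" "scoped (length \<Gamma>) b"
    using assms TmEq_Tm Tm_Ty Tm_scoped Ty_scoped by blast+
  have wf: "wfc \<Delta>" "wfc \<Gamma>" using s by (auto simp: sme_def)
  have "tme \<Delta> (inst ?s a) (inst ?t a) (inst ?s A)"
    using wf(1) sme_ele[OF s] by (rule Tm_cong) (use assms TmEq_Tm in blast)
  moreover have "tye \<Delta> (inst ?t A) (inst ?s A)"
    by (rule TyEq_sym, rule Ty_cong[OF wf(1) sme_ele[OF s]]) (use assms TmEq_Tm Tm_Ty in blast)
  moreover have "tme \<Delta> (inst ?t a) (inst ?t b) (inst ?t A)"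
    using wf(1) ele_right_closed[OF wf sme_ele[OF s]] assms(2) by (rule TmEq_subst)
  ultimately have "tme \<Delta> (inst ?s a) (inst ?t b) (inst ?s A)"
    using TmEq_trans TmEq_conv by blast
  then show ?thesis using sc by (simp add: inst_map_scoped)
qed

lemma sme_wf: "sme \<Delta> \<sigma> \<tau> \<Gamma> \<Longrightarrow> wfc \<Delta>" "sme \<Delta> \<sigma> \<tau> \<Gamma> \<Longrightarrow> wfc \<Gamma>"
  by (auto simp: sme_def)

lemma sme_refl1: "sme \<Delta> \<sigma> \<tau> \<Gamma> \<Longrightarrow> sme \<Delta> \<sigma> \<sigma> \<Gamma>"
  by (auto simp: sme_def intro: tme_refl1)

lemma sme_drop_ty:
  assumes s: "sme \<Delta> \<sigma> \<tau> \<Gamma>" and i: "i < length \<Gamma>"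
  shows "tye \<Delta> (subst (\<sigma> \<odot> sh (Suc i)) (\<Gamma> ! i)) (subst (\<tau> \<odot> sh (Suc i)) (\<Gamma> ! i))"
proof -
  have "sme \<Delta> (\<sigma> \<odot> sh (Suc i)) (\<tau> \<odot> sh (Suc i)) (drop (Suc i) \<Gamma>)"
    using s by (auto simp: sme_def wf_drop scomp_sh_sh scomp_def[of _ "sh _"] add.commute)
  then show ?thesis by (rule sme_tye) (use i s in \<open>auto simp: Ty_iff[symmetric] sme_def intro!: wf_nth\<close>)
qed

lemma sme_sym: "sme \<Delta> \<sigma> \<tau> \<Gamma> \<Longrightarrow> sme \<Delta> \<tau> \<sigma> \<Gamma>"
proof -
  assume a: "sme \<Delta> \<sigma> \<tau> \<Gamma>"
  have "tme \<Delta> (\<tau> i) (\<sigma> i) (subst (\<tau> \<odot> sh (Suc i)) (\<Gamma> ! i))" if "i < length \<Gamma>" for i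
    by (rule TmEq_conv[OF TmEq_sym sme_drop_ty[OF a that]]) (use a that in \<open>simp add: sme_def\<close>)
  with a show ?thesis by (auto simp: sme_def)
qed

lemma sme_trans: "sme \<Delta> \<sigma> \<tau> \<Gamma> \<Longrightarrow> sme \<Delta> \<tau> \<rho> \<Gamma> \<Longrightarrow> sme \<Delta> \<sigma> \<rho> \<Gamma>"
proof -
  assume a: "sme \<Delta> \<sigma> \<tau> \<Gamma>" and b: "sme \<Delta> \<tau> \<rho> \<Gamma>"
  have "tme \<Delta> (\<sigma> i) (\<rho> i) (subst (\<sigma> \<odot> sh (Suc i)) (\<Gamma> ! i))" if "i < length \<Gamma>" for i
  proof -
    have "tme \<Delta> (\<tau> i) (\<rho> i) (subst (\<sigma> \<odot> sh (Suc i)) (\<Gamma> ! i))"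
      using b that by (intro TmEq_conv[OF _ TyEq_sym[OF sme_drop_ty[OF a that]]]) (auto simp: sme_def)
    with a that show ?thesis using TmEq_trans by (auto simp: sme_def)
  qed
  with a b show ?thesis by (auto simp: sme_def)
qed

lemma sme_sh: "wfc (\<Theta> @ \<Gamma>) \<Longrightarrow> k = length \<Theta> \<Longrightarrow> sme (\<Theta> @ \<Gamma>) (sh k) (sh k) \<Gamma>"
proof -
  assume a: "wfc (\<Theta> @ \<Gamma>)" "k = length \<Theta>"
  have "tme (\<Theta> @ \<Gamma>) (Var (i + k)) (Var (i + k)) (subst (sh k \<odot> sh (Suc i)) (\<Gamma> ! i))"
    if "i < length \<Gamma>" for i
    using Tm_Var[OF a(1), of "i + k"] a that
    by (auto simp: wk_conv Tm_iff sh_sh nth_append add.commute)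
  with a show ?thesis by (auto simp: sme_def wf_append)
qed

lemma sme_Var: "wfc \<Gamma> \<Longrightarrow> sme \<Gamma> Var Var \<Gamma>"
  using sme_sh[of "[]" \<Gamma> 0] by simp

lemma sme_comp:
  assumes "sme \<Delta>' \<sigma>' \<tau>' \<Delta>" "sme \<Delta> \<sigma> \<tau> \<Gamma>"
  shows "sme \<Delta>' (\<sigma>' \<odot> \<sigma>) (\<tau>' \<odot> \<tau>) \<Gamma>"
proof -
  have "tme \<Delta>' (subst \<sigma>' (\<sigma> i)) (subst \<tau>' (\<tau> i)) (subst (\<sigma>' \<odot> \<sigma> \<odot> sh (Suc i)) (\<Gamma> ! i))"
    if "i < length \<Gamma>" for i
    using sme_tme[OF assms(1), of "\<sigma> i" "\<tau> i" "subst (\<sigma> \<odot> sh (Suc i)) (\<Gamma> ! i)"] assms(2) that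
    by (simp add: sme_def)
  then show ?thesis using assms by (auto simp: sme_def scomp_def[of _ _ "_ :: nat"])
qed

text \<open>This is the typing rule for \<open>cat\<close>. The substitutions met later are mostly
  iterated extensions of weakenings, and are typed by repeated use of it.\<close>

lemma sme_cat:
  assumes "sme \<Delta> \<sigma> \<tau> \<Gamma>" "wfc (\<Theta> @ \<Gamma>)" "ele \<Delta> s t (subst_tele \<sigma> \<Theta>)"
  shows "sme \<Delta> (cat s \<sigma>) (cat t \<tau>) (\<Theta> @ \<Gamma>)"
proof -
  have l: "length s = length \<Theta>" "length t = length \<Theta>"
    using assms(3) ele_length by fastforce+
  have "tme \<Delta> (cat s \<sigma> i) (cat t \<tau> i) (subst (cat s \<sigma> \<odot> sh (Suc i)) ((\<Theta> @ \<Gamma>) ! i))"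
    if i: "i < length \<Theta> + length \<Gamma>" for i
  proof (cases "i < length \<Theta>")
    case True
    with assms(3) have "tme \<Delta> (s ! i) (t ! i)
       (inst (drop (Suc i) s) (subst (ups (length \<Theta> - Suc i) \<sigma>) (\<Theta> ! i)))"
      by (simp add: ele_nth nth_subst_tele)
    then show ?thesis using True l
      by (simp add: cat_def[of _ _ i] cat_comp_sh_drop nth_append tsub_cat cat_inst)
  next
    case False
    then have "tme \<Delta> (\<sigma> (i - length \<Theta>)) (\<tau> (i - length \<Theta>))
        (subst (\<sigma> \<odot> sh (Suc (i - length \<Theta>))) (\<Gamma> ! (i - length \<Theta>)))"
      using assms(1) i by (simp add: sme_def)
    then show ?thesis using False l
      by (simp add: cat_def[of _ _ i] cat_sh nth_append Suc_diff_le)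
  qed
  with assms show ?thesis by (auto simp: sme_def)
qed

lemma sme_split:
  assumes "sme \<Delta> \<sigma> \<tau> (\<Theta> @ \<Gamma>)" "k = length \<Theta>"
  shows "sme \<Delta> (\<sigma> \<odot> sh k) (\<tau> \<odot> sh k) \<Gamma>"
    and "ele \<Delta> (map \<sigma> [0..<k]) (map \<tau> [0..<k]) (subst_tele (\<sigma> \<odot> sh k) \<Theta>)"
proof -
  have "tme \<Delta> (\<sigma> (i + k)) (\<tau> (i + k)) (subst (\<sigma> \<odot> sh (k + Suc i)) (\<Gamma> ! i))" if "i < length \<Gamma>" for i
  proof -
    have "i + k < length (\<Theta> @ \<Gamma>)" "(\<Theta> @ \<Gamma>) ! (i + k) = \<Gamma> ! i" "Suc (i + k) = k + Suc i"
      using that assms(2) by (simp_all add: nth_append)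
    with assms(1) show ?thesis unfolding sme_def by metis
  qed
  then show "sme \<Delta> (\<sigma> \<odot> sh k) (\<tau> \<odot> sh k) \<Gamma>"
    using assms wf_append[of \<Theta> \<Gamma>] unfolding sme_def by (simp add: scomp_sh_sh scomp_def[of _ "sh _"])
  have "cat (drop (Suc i) (map \<sigma> [0..<length \<Theta>])) (\<sigma> \<odot> sh (length \<Theta>)) = \<sigma> \<odot> sh (Suc i)"
    if "i < length \<Theta>" for i
    using that by (auto simp: cat_def scomp_def fun_eq_iff add.commute)
  moreover have "tme \<Delta> (\<sigma> i) (\<tau> i) (subst (\<sigma> \<odot> sh (Suc i)) (\<Theta> ! i))" if "i < length \<Theta>" for i
  proof -
    have "i < length (\<Theta> @ \<Gamma>)" "(\<Theta> @ \<Gamma>) ! i = \<Theta> ! i"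
      using that by (simp_all add: nth_append)
    with assms(1) show ?thesis unfolding sme_def by metis
  qed
  ultimately show "ele \<Delta> (map \<sigma> [0..<k]) (map \<tau> [0..<k]) (subst_tele (\<sigma> \<odot> sh k) \<Theta>)"
    using assms(2) by (auto simp: ele_nth nth_subst_tele tsub_cat cat_inst simp del: drop_map)
qed

lemma map_sh_upt: "map (sh k) [0..<n] = seg k n"
  by (rule nth_equalityI) (auto simp: add.commute)

lemma ele_seg:
  assumes "wfc (\<Theta>' @ \<Theta> @ \<Gamma>)" "k = length \<Theta>'" "n = length \<Theta>" "m = k + n"
  shows "ele (\<Theta>' @ \<Theta> @ \<Gamma>) (seg k n) (seg k n) (subst_tele (sh m) \<Theta>)"
  using sme_split(2)[OF sme_sh[OF assms(1,2)] assms(3)] assms by (simp add: map_sh_upt sh_sh)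

lemma ele_tele_ty:
  assumes "wfc (\<Theta> @ \<Gamma>)" "ele \<Gamma> s t \<Theta>"
  shows "sme \<Gamma> (cat s Var) (cat t Var) (\<Theta> @ \<Gamma>)"
  using sme_cat[OF sme_Var assms(1)] assms wf_append by auto

lemma map_cat_upt': "length t = n \<Longrightarrow> map (cat t \<sigma>) [0..<n] = t"
  using map_cat_upt by blast

lemma ele_sym:
  assumes "wfc (\<Theta> @ \<Gamma>)" "ele \<Gamma> s t \<Theta>"
  shows "ele \<Gamma> t s \<Theta>"
  using sme_split(2)[OF sme_sym[OF ele_tele_ty[OF assms]] refl] ele_length[OF assms(2)]
  by (simp add: cat_sh map_cat_upt')

lemma ele_refl2: "wfc (\<Theta> @ \<Gamma>) \<Longrightarrow> ele \<Gamma> s t \<Theta> \<Longrightarrow> ele \<Gamma> t t \<Theta>"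
  using ele_sym ele_refl1 by blast

lemma ele_trans:
  assumes "wfc (\<Theta> @ \<Gamma>)" "ele \<Gamma> s t \<Theta>" "ele \<Gamma> t u \<Theta>"
  shows "ele \<Gamma> s u \<Theta>"
proof -
  have l: "length s = length \<Theta>" "length u = length \<Theta>"
    using assms(2,3) ele_length by blast+
  show ?thesis
    using sme_split(2)[OF sme_trans[OF ele_tele_ty[OF assms(1,2)] ele_tele_ty[OF assms(1,3)]] refl]
    by (simp add: cat_sh l map_cat_upt')
qed

section \<open>Definitional equality of telescopes and context conversion\<close>

lemma teq_length: "teq \<Gamma> \<Theta> \<Theta>' \<Longrightarrow> length \<Theta> = length \<Theta>'"
  by (induction \<Gamma> \<Theta> \<Theta>' rule: teq.induct) auto

lemma teq_wf: "teq \<Gamma> \<Theta> \<Theta>' \<Longrightarrow> wfc (\<Theta> @ \<Gamma>)"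
  by (induction \<Gamma> \<Theta> \<Theta>' rule: teq.induct) (auto dest: TyEq_Ty)

lemma teq_refl: "teq \<Gamma> \<Theta> \<Theta> \<longleftrightarrow> wfc (\<Theta> @ \<Gamma>)"
  by (induction \<Theta>) (auto simp: Ty_iff)

lemma cat_sing_sh: "cat [Var 0] (sh (Suc 0)) = Var"
  using cat_seg_sh[of 1 0 1] by (simp add: seg_Suc)

lemma sme_Cons_conv:
  assumes "sme \<Gamma> Var Var \<Delta>" "tye \<Gamma> B A" "Ty \<Delta> A \<in> T"
  shows "sme (B # \<Gamma>) Var Var (A # \<Delta>)"
proof -
  have wf: "wfc (B # \<Gamma>)" "wfc (A # \<Delta>)"
    using assms sme_wf TyEq_Ty by auto
  have sh: "sme (B # \<Gamma>) (sh 1) (sh 1) \<Gamma>"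
    using sme_sh[of "[B]" \<Gamma> 1] wf by simp
  have "tme (B # \<Gamma>) (Var 0) (Var 0) (subst (sh 1) B)"
    using ele_seg[of "[]" "[B]" \<Gamma> 0 1 1] wf by (simp add: seg_Suc tsub_cat)
  then have "ele (B # \<Gamma>) [Var 0] [Var 0] (subst_tele (sh 1 \<odot> Var) [A])"
    using TmEq_conv[OF _ sme_tye[OF sh assms(2)]] by (simp add: tsub_cat)
  from sme_cat[OF sme_comp[OF sh assms(1)] _ this] wf show ?thesis
    by (simp add: cat_sing_sh)
qed

text \<open>Context conversion is not among the rules. It is recovered as substitution along the
  identity, which is a morphism in both directions between equal contexts.\<close>

lemma teq_sme:
  "teq \<Gamma> \<Theta> \<Theta>' \<Longrightarrow> wfc (\<Theta>' @ \<Gamma>) \<and> sme (\<Theta>' @ \<Gamma>) Var Var (\<Theta> @ \<Gamma>) \<and> sme (\<Theta> @ \<Gamma>) Var Var (\<Theta>' @ \<Gamma>)"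
proof (induction \<Gamma> \<Theta> \<Theta>' rule: teq.induct)
  case (1 \<Gamma>)
  then show ?case by (simp add: sme_Var)
next
  case (2 \<Gamma> A \<Theta> B \<Theta>')
  then have "tye (\<Theta>' @ \<Gamma>) A B"
    using sme_tye[of "\<Theta>' @ \<Gamma>" Var Var] by fastforce
  moreover from this have "tye (\<Theta>' @ \<Gamma>) B A" by (rule TyEq_sym)
  ultimately show ?case using 2 sme_Cons_conv TyEq_Ty by auto
qed auto

lemma teq_sym: "teq \<Gamma> \<Theta> \<Theta>' \<Longrightarrow> teq \<Gamma> \<Theta>' \<Theta>"
proof (induction \<Gamma> \<Theta> \<Theta>' rule: teq.induct)
  case (2 \<Gamma> A \<Theta> B \<Theta>')
  then have "tye (\<Theta>' @ \<Gamma>) A B"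
    using sme_tye[of "\<Theta>' @ \<Gamma>" Var Var] teq_sme by fastforce
  with 2 TyEq_sym show ?case by auto
qed auto

lemma teq_trans: "teq \<Gamma> \<Theta> \<Theta>' \<Longrightarrow> teq \<Gamma> \<Theta>' \<Theta>'' \<Longrightarrow> teq \<Gamma> \<Theta> \<Theta>''"
proof (induction \<Gamma> \<Theta> \<Theta>' arbitrary: \<Theta>'' rule: teq.induct)
  case (2 \<Gamma> A \<Theta> B \<Theta>')
  then obtain C \<Psi> where [simp]: "\<Theta>'' = C # \<Psi>" by (cases \<Theta>'') auto
  from 2 have "tye (\<Theta> @ \<Gamma>) B C"
    using sme_tye[of "\<Theta> @ \<Gamma>" Var Var] teq_sme by fastforce
  with 2 TyEq_trans show ?case by auto
qed auto

lemma ele_conv: "teq \<Gamma> \<Theta> \<Theta>' \<Longrightarrow> ele \<Gamma> s t \<Theta> \<Longrightarrow> ele \<Gamma> s t \<Theta>'"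
proof (induction \<Gamma> \<Theta> \<Theta>' arbitrary: s t rule: teq.induct)
  case (2 \<Gamma> A \<Theta> B \<Theta>')
  then obtain a s' b t' where [simp]: "s = a # s'" "t = b # t'"
    by (cases s; cases t) auto
  have "sme \<Gamma> (cat s' Var) (cat s' Var) (\<Theta> @ \<Gamma>)"
    using 2 by (intro ele_tele_ty) (auto dest: teq_wf ele_refl1)
  with 2 have "tye \<Gamma> (inst s' A) (inst s' B)"
    by (auto simp: tsub_cat intro: sme_tye)
  with 2 show ?case using TmEq_conv by auto
qed auto

lemma sme_ups:
  assumes "sme \<Delta> \<sigma> \<tau> \<Gamma>" "wfc (\<Theta> @ \<Gamma>)" "wfc (subst_tele \<sigma> \<Theta> @ \<Delta>)" "k = length \<Theta>"
  shows "sme (subst_tele \<sigma> \<Theta> @ \<Delta>) (ups k \<sigma>) (ups k \<tau>) (\<Theta> @ \<Gamma>)"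
  unfolding ups_cat
proof (rule sme_cat)
  show "sme (subst_tele \<sigma> \<Theta> @ \<Delta>) (sh k \<odot> \<sigma>) (sh k \<odot> \<tau>) \<Gamma>"
    using assms by (intro sme_comp[OF sme_sh]) auto
  show "ele (subst_tele \<sigma> \<Theta> @ \<Delta>) (seg 0 k) (seg 0 k) (subst_tele (sh k \<odot> \<sigma>) \<Theta>)"
    using ele_seg[of "[]" "subst_tele \<sigma> \<Theta>" \<Delta> 0 k k] assms by simp
qed fact

lemma teq_subst:
  "teq \<Gamma> \<Theta> \<Theta>' \<Longrightarrow> sme \<Delta> \<sigma> \<tau> \<Gamma> \<Longrightarrow> teq \<Delta> (subst_tele \<sigma> \<Theta>) (subst_tele \<tau> \<Theta>')"
proof (induction \<Gamma> \<Theta> \<Theta>' rule: teq.induct)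
  case (2 \<Gamma> A \<Theta> B \<Theta>')
  then have "sme (subst_tele \<sigma> \<Theta> @ \<Delta>) (ups (length \<Theta>) \<sigma>) (ups (length \<Theta>) \<tau>) (\<Theta> @ \<Gamma>)"
    by (intro sme_ups) (auto dest: teq_wf)
  from sme_tye[OF this] 2 show ?case using teq_length by fastforce
qed (auto dest: sme_wf)

text \<open>The reflexive case of \<open>teq_subst\<close>: a telescope is well formed exactly when
  it equals itself.\<close>

lemma wf_subst: "sme \<Delta> \<sigma> \<tau> \<Gamma> \<Longrightarrow> wfc (\<Theta> @ \<Gamma>) \<Longrightarrow> wfc (subst_tele \<sigma> \<Theta> @ \<Delta>)"
  using teq_subst[of \<Gamma> \<Theta> \<Theta>, OF _ sme_refl1] teq_refl by blast

lemma sme_ups': 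
  assumes "sme \<Delta> \<sigma> \<tau> \<Gamma>" "wfc (\<Theta> @ \<Gamma>)" "k = length \<Theta>"
  shows "sme (subst_tele \<sigma> \<Theta> @ \<Delta>) (ups k \<sigma>) (ups k \<tau>) (\<Theta> @ \<Gamma>)"
  using assms wf_subst sme_ups by blast

lemma ele_subst: "ele \<Gamma> s t \<Theta> \<Longrightarrow> sme \<Delta> \<sigma> \<tau> \<Gamma> \<Longrightarrow> ele \<Delta> (sb \<sigma> s) (sb \<tau> t) (subst_tele \<sigma> \<Theta>)"
proof (induction \<Theta> arbitrary: s t)
  case Nil
  then show ?case by (cases s; cases t) auto
next
  case (Cons A \<Theta>)
  then obtain a s' b t' where [simp]: "s = a # s'" "t = b # t'"
    by (cases s; cases t) auto
  have "tme \<Delta> (subst \<sigma> a) (subst \<tau> b) (subst \<sigma> (inst s' A))"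
    using Cons by (intro sme_tme) auto
  with Cons ele_length[of \<Gamma> s' t' \<Theta>] show ?case
    by (auto simp: tsub_cat cat_inst)
qed

lemma ele_append:
  "length s2 = length \<Theta>2 \<Longrightarrow> length s1 = length \<Theta>1 \<Longrightarrow> length t2 = length \<Theta>2 \<Longrightarrow> length t1 = length \<Theta>1 \<Longrightarrow>
   ele \<Gamma> (s1 @ s2) (t1 @ t2) (\<Theta>1 @ \<Theta>2) \<longleftrightarrow>
   ele \<Gamma> s2 t2 \<Theta>2 \<and> ele \<Gamma> s1 t1 (subst_tele (cat s2 Var) \<Theta>1)"
proof (induction \<Theta>1 arbitrary: s1 t1)
  case Nil
  then show ?case by (cases s1; cases t1) auto
next
  case (Cons A \<Theta>1)
  then show ?case
    by (cases s1; cases t1) (auto simp: tsub_cat cat_inst)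
qed

lemma subst_tele_scoped_cong:
  "wfc (\<Theta> @ \<Gamma>) \<Longrightarrow> \<forall>i < length \<Gamma>. \<sigma> i = \<tau> i \<Longrightarrow> subst_tele \<sigma> \<Theta> = subst_tele \<tau> \<Theta>"
proof (induction \<Theta>)
  case (Cons A \<Theta>)
  have "subst (ups (length \<Theta>) \<sigma>) A = subst (ups (length \<Theta>) \<tau>) A"
    by (rule scoped_subst_cong[of "length (\<Theta> @ \<Gamma>)"])
       (use Cons.prems Ty_scoped[of "\<Theta> @ \<Gamma>" A] in \<open>auto simp: ups_def\<close>)
  with Cons show ?case by auto
qed auto

lemma subst_tele_closed: "wfc \<Phi> \<Longrightarrow> subst_tele \<sigma> \<Phi> = \<Phi>"
  using subst_tele_scoped_cong[of \<Phi> "[]" \<sigma> Var] by simp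

lemma tme_closed: "tme [] a b A \<Longrightarrow> subst \<sigma> a = a"
  using scoped_subst_cong[of 0 a \<sigma> Var] TmEq_Tm Tm_scoped by fastforce

lemma ele_closed: "ele [] s t \<Phi> \<Longrightarrow> sb \<sigma> s = s"
proof (induction \<Phi> arbitrary: s t)
  case Nil
  then show ?case by (cases s; cases t) auto
next
  case (Cons A \<Phi>)
  then show ?case by (cases s; cases t) (auto intro: tme_closed)
qed

end

section \<open>Identity contexts and their elimination rule\<close>

text \<open>That this tuple inhabits the identity context is not immediate: each later component is
  expected in a type that mentions transport along the earlier ones.\<close>

abbreviation rl :: "'s tup \<Rightarrow> 's tup" where
  "rl \<equiv> map Refl"

lemma sb_rl [simp]: "sb \<sigma> (rl a) = rl (sb \<sigma> a)"
  by (simp add: map_map)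

lemma ups_sh: "ups (j + k) \<sigma> \<odot> sh j = sh j \<odot> ups k \<sigma>"
  by (auto simp: ups_def scomp_def fun_eq_iff wk_conv sh_sh)

lemma ups_sh': "ups j \<sigma> \<odot> sh j = sh j \<odot> \<sigma>"
  using ups_sh[of j 0 \<sigma>] by simp

lemma cat_single [simp]: "cat [a] (cat s \<sigma>) = cat (a # s) \<sigma>"
  by (auto simp: cat_def fun_eq_iff nth_Cons split: nat.splits)

lemma cat_Cons_append [simp]: "cat (a # (s @ t)) \<sigma> = cat (a # s) (cat t \<sigma>)"
  using cat_append[of "a # s" t \<sigma>] by simp

lemma cat_Cons_0 [simp]: "cat (a # s) \<sigma> 0 = a"
  by (simp add: cat_def)

lemma cat_Cons_Suc [simp]: "cat (a # s) \<sigma> (Suc i) = cat s \<sigma> i"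
  by (simp add: cat_def)

lemma seg_add: "seg k (m + n) = seg k m @ seg (k + m) n"
  by (rule nth_equalityI) (auto simp: nth_append)

text \<open>The method of the recursive call in \<open>Jc\<close>, with its renaming written as a
  substitution. In the context (x, x', y', u', z) it eliminates u'. The variables x', y', u' lie
  just beyond the m parameters z, whence the indices m + 2, m + 1 and m.\<close>

definition Jstep :: "nat \<Rightarrow> 's exp \<Rightarrow> 's exp" where
  "Jstep m d = J (Var (m + 2)) (Var (m + 1)) (Var m) (subst (ups (Suc m) (sh (m + 3))) d) (seg 0 m)"

lemma Jc_Cons: "Jc (a' # a) (b' # b) (p' # p) d t =
  Jc a b p (Jstep (length t) d) (t @ [p', b', a'])"
proof -
  have *: "(\<lambda>i. Var (if i \<le> m then i else i + m + 3)) = ups (Suc m) (sh (m + 3))" for m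
    by (auto simp: ups_def wk_conv fun_eq_iff)
  show ?thesis by (simp only: Jc.simps Let_def Jstep_def ren_conv_subst vars_seg *)
qed

declare Jc.simps(1) [simp del]

lemma Jstep_subst: "subst (ups (k + m + 3) \<sigma>) (Jstep m d) = Jstep m (subst (ups (Suc k + m) \<sigma>) d)"
proof -
  have 1: "ups (Suc m) (ups (k + m + 3) \<sigma>) \<odot> ups (Suc m) (sh (m + 3)) =
    ups (Suc m) (sh (m + 3)) \<odot> ups (Suc k + m) \<sigma>"
  proof -
    have "ups (Suc k + m) \<sigma> = ups (Suc m) (ups k \<sigma>)" "k + m + 3 = m + 3 + k"
      by (simp_all add: ups_ups ac_simps)
    then show ?thesis by (simp only: ups_comp ups_sh)
  qed
  have 2: "sb (ups (k + m + 3) \<sigma>) (seg 0 m) = seg 0 m"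
    by (rule nth_equalityI) (auto simp: ups_def)
  show ?thesis by (simp add: Jstep_def 1 2) (simp add: ups_def)
qed

text \<open>The recursion of \<open>Jc\<close> is purely syntactic, so naturality is inherited from
  \<open>Jstep\<close>. The length hypotheses make the three tuples run out together; otherwise the
  last clause would instantiate d by a tuple of the wrong length.\<close>

lemma Jc_subst:
  "length a = length b \<Longrightarrow> length b = length p \<Longrightarrow> subst \<sigma> (Jc a b p d t) =
     Jc (sb \<sigma> a) (sb \<sigma> b) (sb \<sigma> p) (subst (ups (length a + length t) \<sigma>) d) (sb \<sigma> t)"
proof (induction a arbitrary: b p d t)
  case Nil
  then show ?case by (simp add: tsub_cat cat_inst)
next
  case (Cons a' a)
  then obtain b' b0 p' p0 where "b = b' # b0" "p = p' # p0"
    by (cases b; cases p) auto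
  with Cons show ?case
    using Jstep_subst[of "length a" "length t" \<sigma> d] by (simp add: Jc_Cons ac_simps numeral_3_eq_3)
qed

abbreviation tr1 :: "'s tup \<Rightarrow> 's tup \<Rightarrow> 's tup \<Rightarrow> 's exp \<Rightarrow> 's exp" where
  "tr1 a b p e \<equiv> Jc a b p (Var 0) [e]"

lemma tr1_subst:
  "length a = length b \<Longrightarrow> length b = length p \<Longrightarrow>
   subst \<sigma> (tr1 a b p e) = tr1 (sb \<sigma> a) (sb \<sigma> b) (sb \<sigma> p) (subst \<sigma> e)"
  by (simp add: Jc_subst) (simp add: ups_def)

lemma Idc_Cons: "Idc (A # \<Phi>) (a' # a) (b' # b) =
   IdT (subst (sh (length \<Phi>)) (subst (cat b Var) A))
     (tr1 (sb (sh (length \<Phi>)) a) (sb (sh (length \<Phi>)) b) (seg 0 (length \<Phi>)) (subst (sh (length \<Phi>)) a'))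
     (subst (sh (length \<Phi>)) b') # Idc \<Phi> a b"
  by (simp add: Let_def transport_def wk_conv tsub_cat vars_seg)

declare Idc.simps(1) [simp del]

lemma length_Idc: "length a = length \<Phi> \<Longrightarrow> length b = length \<Phi> \<Longrightarrow> length (Idc \<Phi> a b) = length \<Phi>"
proof (induction \<Phi> arbitrary: a b)
  case (Cons A \<Phi>)
  then show ?case by (cases a; cases b) (auto simp: Idc_Cons)
qed auto

lemma Idc_subst: "length a = length \<Phi> \<Longrightarrow> length b = length \<Phi> \<Longrightarrow>
   subst_tele \<sigma> (Idc \<Phi> a b) = Idc (subst_tele \<sigma> \<Phi>) (sb \<sigma> a) (sb \<sigma> b)"
proof (induction \<Phi> arbitrary: a b)
  case (Cons A \<Phi>)
  then obtain a' as b' bs where [simp]: "a = a' # as" "b = b' # bs"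
    by (cases a; cases b) auto
  have "sb (ups (length \<Phi>) \<sigma>) (seg 0 (length \<Phi>)) = seg 0 (length \<Phi>)"
    by (rule nth_equalityI) (auto simp: ups_def)
  with Cons show ?case
    by (simp add: Idc_Cons length_Idc tr1_subst ups_sh' cat_inst)
qed auto

text \<open>\<open>idt \<Phi>\<close> is the telescope $(x \in \Phi, y \in \Phi, u \in \mathrm{Id}_\Phi(x,y))$, and \<open>diagc\<close> is the
  analogue of \<open>diag\<close> for it.\<close>

definition idt :: "'s ctx \<Rightarrow> 's ctx" where
  "idt \<Phi> = (let n = length \<Phi> in
     Idc (subst_tele (sh (n + n)) \<Phi>) (seg n n) (seg 0 n) @ subst_tele (sh n) \<Phi> @ \<Phi>)"

lemma length_idt [simp]: "length (idt \<Phi>) = length \<Phi> + length \<Phi> + length \<Phi>"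
  by (simp add: idt_def Let_def length_Idc)

definition diagc :: "nat \<Rightarrow> nat \<Rightarrow> 's exp" where
  "diagc n = cat (rl (seg 0 n) @ seg 0 n) Var"

lemma diag_eq: "diag = cat [Refl (Var 0), Var 0] Var"
  by (simp add: diag_def tsub_cat)

context type_theory
begin

text \<open>The rules for identity contexts over telescopes of length \<open>n\<close>. They depend on each other and
  are proved by a simultaneous induction on \<open>n\<close>.\<close>

definition idc_ok :: "nat \<Rightarrow> bool" where
  "idc_ok n \<longleftrightarrow> (\<forall>\<Gamma> \<Phi> \<Phi>' a a' b b'. length \<Phi> = n \<longrightarrow> teq \<Gamma> \<Phi> \<Phi>' \<longrightarrow> ele \<Gamma> a a' \<Phi> \<longrightarrow>
     ele \<Gamma> b b' \<Phi> \<longrightarrow> teq \<Gamma> (Idc \<Phi> a b) (Idc \<Phi>' a' b'))"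

definition refl_ok :: "nat \<Rightarrow> bool" where
  "refl_ok n \<longleftrightarrow> (\<forall>\<Gamma> \<Phi> a a'. length \<Phi> = n \<longrightarrow> wfc (\<Phi> @ \<Gamma>) \<longrightarrow> ele \<Gamma> a a' \<Phi> \<longrightarrow>
     ele \<Gamma> (rl a) (rl a') (Idc \<Phi> a a))"

text \<open>The conditions on the motive c and the methods are kept apart from the arguments,
  because they are what has to be carried from a context to a shorter one in the induction. Two
  methods are allowed so that congruence and typing are a single rule.\<close>

definition Jprem :: "'s ctx \<Rightarrow> 's ctx \<Rightarrow> 's ctx \<Rightarrow> 's exp \<Rightarrow> 's exp \<Rightarrow> 's exp \<Rightarrow> bool" where
  "Jprem \<Gamma> \<Phi> \<Theta> c d d' \<longleftrightarrow> Ty (\<Theta> @ idt \<Phi> @ \<Gamma>) c \<in> T \<and>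
     tme (subst_tele (diagc (length \<Phi>)) \<Theta> @ \<Phi> @ \<Gamma>) d d' (subst (ups (length \<Theta>) (diagc (length \<Phi>))) c)"

definition J_ok :: "nat \<Rightarrow> bool" where
  "J_ok n \<longleftrightarrow> (\<forall>\<Gamma> \<Phi> \<Theta> c d d' a a' b b' p p' t t'. length \<Phi> = n \<longrightarrow> Jprem \<Gamma> \<Phi> \<Theta> c d d' \<longrightarrow>
     ele \<Gamma> a a' \<Phi> \<longrightarrow> ele \<Gamma> b b' \<Phi> \<longrightarrow> ele \<Gamma> p p' (Idc \<Phi> a b) \<longrightarrow>
     ele \<Gamma> t t' (subst_tele (cat (p @ b @ a) Var) \<Theta>) \<longrightarrow>
     tme \<Gamma> (Jc a b p d t) (Jc a' b' p' d' t') (subst (cat (t @ p @ b @ a) Var) c))"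

definition Jcomp_ok :: "nat \<Rightarrow> bool" where
  "Jcomp_ok n \<longleftrightarrow> (\<forall>\<Gamma> \<Phi> \<Theta> c d a t. length \<Phi> = n \<longrightarrow> Jprem \<Gamma> \<Phi> \<Theta> c d d \<longrightarrow>
     ele \<Gamma> a a \<Phi> \<longrightarrow> ele \<Gamma> t t (subst_tele (cat (rl a @ a @ a) Var) \<Theta>) \<longrightarrow>
     tme \<Gamma> (Jc a a (rl a) d t) (inst (t @ a) d) (subst (cat (t @ rl a @ a @ a) Var) c))"

section \<open>The generic path, and transport of a single element\<close>

lemma idt_wf:
  assumes "idc_ok n" "length \<Phi> = n" "wfc (\<Phi> @ \<Gamma>)"
  shows "wfc (idt \<Phi> @ \<Gamma>)"
proof -
  let ?K = "subst_tele (sh n) \<Phi> @ \<Phi> @ \<Gamma>"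
  have K: "wfc ?K"
    using assms by (intro wf_subst[OF sme_sh]) (auto intro: wf_append)
  have "wfc (subst_tele (sh (n + n)) \<Phi> @ ?K)"
    using assms K sme_sh[of "subst_tele (sh n) \<Phi> @ \<Phi>" \<Gamma> "n + n"] by (intro wf_subst) auto
  moreover have "ele ?K (seg n n) (seg n n) (subst_tele (sh (n + n)) \<Phi>)"
    using assms K by (intro ele_seg) auto
  moreover have "ele ?K (seg 0 n) (seg 0 n) (subst_tele (sh (n + n)) \<Phi>)"
    using assms K ele_seg[of "[]" "subst_tele (sh n) \<Phi>" "\<Phi> @ \<Gamma>" 0 n n] by (simp add: sh_sh)
  ultimately have "teq ?K (Idc (subst_tele (sh (n + n)) \<Phi>) (seg n n) (seg 0 n))
      (Idc (subst_tele (sh (n + n)) \<Phi>) (seg n n) (seg 0 n))"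
    by (intro assms(1)[unfolded idc_ok_def, rule_format]) (use assms in \<open>auto simp: teq_refl\<close>)
  then show ?thesis using assms by (simp add: idt_def Let_def teq_refl)
qed

lemma sme_idt:
  assumes "idc_ok n" "length \<Phi> = n" "wfc (\<Phi> @ \<Gamma>)" "sme \<Delta> \<sigma> \<tau> \<Gamma>"
    and x: "ele \<Delta> x x' (subst_tele \<sigma> \<Phi>)" and y: "ele \<Delta> y y' (subst_tele \<sigma> \<Phi>)"
    and u: "ele \<Delta> u u' (Idc (subst_tele \<sigma> \<Phi>) x y)"
  shows "sme \<Delta> (cat u (cat y (cat x \<sigma>))) (cat u' (cat y' (cat x' \<tau>))) (idt \<Phi> @ \<Gamma>)"
proof -
  have l: "length x = n" "length y = n"
    using ele_length x y assms(2) by fastforce+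
  have wf: "wfc (idt \<Phi> @ \<Gamma>)" using idt_wf assms by blast
  have 1: "sme \<Delta> (cat x \<sigma>) (cat x' \<tau>) (\<Phi> @ \<Gamma>)"
    using assms by (intro sme_cat) auto
  have 2: "sme \<Delta> (cat y (cat x \<sigma>)) (cat y' (cat x' \<tau>)) (subst_tele (sh n) \<Phi> @ \<Phi> @ \<Gamma>)"
    by (rule sme_cat[OF 1])
      (use wf y l assms(2) wf_append in \<open>auto simp: idt_def Let_def cat_sh\<close>)
  have "ele \<Delta> u u' (subst_tele (cat y (cat x \<sigma>)) (Idc (subst_tele (sh (n + n)) \<Phi>) (seg n n) (seg 0 n)))"
    using u l assms(2) by (simp add: Idc_subst cat_sh sb_seg_hit sb_seg_skip)
  from sme_cat[OF 2 _ this] wf assms(2) show ?thesis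
    by (simp add: idt_def Let_def)
qed

text \<open>Beyond m further entries, the generic u, y and x occupy the blocks starting at m, m + n
  and m + n + n, and \<Gamma> begins at m + n + n + n. These offsets recur in all motives
  below.\<close>

lemma idt_ele:
  assumes "wfc (\<Theta> @ idt \<Phi> @ \<Gamma>)" "n = length \<Phi>" "m = length \<Theta>"
  shows "ele (\<Theta> @ idt \<Phi> @ \<Gamma>) (seg (m + n + n) n) (seg (m + n + n) n) (subst_tele (sh (m + n + n + n)) \<Phi>)"
    and "ele (\<Theta> @ idt \<Phi> @ \<Gamma>) (seg (m + n) n) (seg (m + n) n) (subst_tele (sh (m + n + n + n)) \<Phi>)"
    and "ele (\<Theta> @ idt \<Phi> @ \<Gamma>) (seg m n) (seg m n)
      (Idc (subst_tele (sh (m + n + n + n)) \<Phi>) (seg (m + n + n) n) (seg (m + n) n))"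
proof -
  let ?I = "Idc (subst_tele (sh (n + n)) \<Phi>) (seg n n) (seg 0 n)"
  have I: "idt \<Phi> = ?I @ subst_tele (sh n) \<Phi> @ \<Phi>" "length ?I = n"
    using assms by (auto simp: idt_def Let_def length_Idc)
  show "ele (\<Theta> @ idt \<Phi> @ \<Gamma>) (seg (m + n + n) n) (seg (m + n + n) n) (subst_tele (sh (m + n + n + n)) \<Phi>)"
    using ele_seg[of "\<Theta> @ ?I @ subst_tele (sh n) \<Phi>" \<Phi> \<Gamma> "m + n + n" n "m + n + n + n"] assms I by simp
  show "ele (\<Theta> @ idt \<Phi> @ \<Gamma>) (seg (m + n) n) (seg (m + n) n) (subst_tele (sh (m + n + n + n)) \<Phi>)"
    using ele_seg[of "\<Theta> @ ?I" "subst_tele (sh n) \<Phi>" "\<Phi> @ \<Gamma>" "m + n" n "m + n + n"] assms I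
    by (simp add: sh_sh)
  show "ele (\<Theta> @ idt \<Phi> @ \<Gamma>) (seg m n) (seg m n)
      (Idc (subst_tele (sh (m + n + n + n)) \<Phi>) (seg (m + n + n) n) (seg (m + n) n))"
    using ele_seg[of "\<Theta>" "?I" "subst_tele (sh n) \<Phi> @ \<Phi> @ \<Gamma>" "m" n "m + n"] assms I
    by (simp add: Idc_subst sh_sh add_ac)
qed

text \<open>Transport is elimination with one parameter in A(x), motive A(y), and the parameter
  itself as method. The shift by n + n carries A past y and u; the block starting at 1 + n is y seen
  beyond u and the parameter.\<close>

lemma tr1_prem:
  assumes "idc_ok n" "length \<Phi> = n" "wfc (A # \<Phi> @ \<Gamma>)"
  shows "Jprem \<Gamma> \<Phi> [subst (sh (n + n)) A] (subst (cat (seg (1 + n) n) (sh (1 + n + n + n))) A) (Var 0) (Var 0)"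
proof -
  let ?A = "subst (sh (n + n)) A"
  have wf: "wfc (idt \<Phi> @ \<Gamma>)" using assms idt_wf by auto
  have "sme (idt \<Phi> @ \<Gamma>) (sh (n + n)) (sh (n + n)) (\<Phi> @ \<Gamma>)"
    using sme_sh[of "Idc (subst_tele (sh (n + n)) \<Phi>) (seg n n) (seg 0 n) @ subst_tele (sh n) \<Phi>" "\<Phi> @ \<Gamma>" "n + n"]
      wf assms(2) by (simp add: idt_def Let_def length_Idc)
  then have wf': "wfc ([?A] @ idt \<Phi> @ \<Gamma>)"
    using wf assms sme_tye Ty_iff by auto
  have "sme ([?A] @ idt \<Phi> @ \<Gamma>) (cat (seg (1 + n) n) (sh (1 + n + n + n)))
      (cat (seg (1 + n) n) (sh (1 + n + n + n))) (\<Phi> @ \<Gamma>)"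
    using sme_sh[of "[?A] @ idt \<Phi>" \<Gamma> "1 + n + n + n"] idt_ele(2)[OF wf', of n 1] wf' assms
    by (intro sme_cat) auto
  from sme_tye[OF this] have 1: "Ty ([?A] @ idt \<Phi> @ \<Gamma>) (subst (cat (seg (1 + n) n) (sh (1 + n + n + n))) A) \<in> T"
    using assms Ty_iff by auto
  have 2: "tme (A # \<Phi> @ \<Gamma>) (Var 0) (Var 0) (subst (sh 1) A)"
    using ele_seg[of "[]" "[A]" "\<Phi> @ \<Gamma>" 0 1 1] assms by (simp add: seg_Suc tsub_cat)
  from 1 2 assms(2) show ?thesis
    by (simp add: Jprem_def diagc_def cat_sh ups_cat sb_seg_skip sb_seg_hit cat_seg_sh seg_Suc sh_sh
     )
qed

lemma tr1_ok:
  assumes "idc_ok n" "J_ok n" "length \<Phi> = n" "wfc (A # \<Phi> @ \<Gamma>)"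
    "ele \<Gamma> a a' \<Phi>" "ele \<Gamma> b b' \<Phi>" "ele \<Gamma> p p' (Idc \<Phi> a b)" "tme \<Gamma> e e' (subst (cat a Var) A)"
  shows "tme \<Gamma> (tr1 a b p e) (tr1 a' b' p' e') (subst (cat b Var) A)"
proof -
  have l: "length a = n" "length b = n" "length p = n"
    using assms ele_length by (metis length_Idc)+
  show ?thesis
    using assms(2)[unfolded J_ok_def, rule_format, OF assms(3) tr1_prem[OF assms(1,3,4)] assms(5-7),
      of "[e]" "[e']"] assms(8) l
    by (simp add: tsub_cat cat_sh sb_seg_skip sb_seg_hit)
qed

lemma tr1_comp:
  assumes "idc_ok n" "Jcomp_ok n" "length \<Phi> = n" "wfc (A # \<Phi> @ \<Gamma>)"
    "ele \<Gamma> a a \<Phi>" "tme \<Gamma> e e (subst (cat a Var) A)"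
  shows "tme \<Gamma> (tr1 a a (rl a) e) e (subst (cat a Var) A)"
proof -
  have l: "length a = n"
    using assms ele_length by metis
  show ?thesis
    using assms(2)[unfolded Jcomp_ok_def, rule_format, OF assms(3) tr1_prem[OF assms(1,3,4)] assms(5),
      of "[e]"] assms(6) l
    by (simp add: tsub_cat cat_sh sb_seg_skip sb_seg_hit)
qed

text \<open>Only the last entry is new. It is formed over the generic u, where typing the transport
  of a0 along u uses elimination at length n.\<close>

lemma idc_step:
  assumes "idc_ok n" "J_ok n"
  shows "idc_ok (Suc n)"
  unfolding idc_ok_def
proof (intro allI impI)
  fix \<Gamma> \<Psi> \<Psi>' and aa aa' bb bb' :: "'s tup"
  assume h: "length \<Psi> = Suc n" "teq \<Gamma> \<Psi> \<Psi>'" "ele \<Gamma> aa aa' \<Psi>" "ele \<Gamma> bb bb' \<Psi>"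
  from h(1,2) obtain A \<Phi> A' \<Phi>' where [simp]: "\<Psi> = A # \<Phi>" "\<Psi>' = A' # \<Phi>'"
    by (cases \<Psi>; cases \<Psi>') auto
  from h(3,4) obtain a0 a a0' a' b0 b b0' b' where
    [simp]: "aa = a0 # a" "aa' = a0' # a'" "bb = b0 # b" "bb' = b0' # b'"
    by (cases aa; cases aa'; cases bb; cases bb') auto
  from h have h': "length \<Phi> = n" "teq \<Gamma> \<Phi> \<Phi>'" "tye (\<Phi> @ \<Gamma>) A A'" "ele \<Gamma> a a' \<Phi>" "ele \<Gamma> b b' \<Phi>"
      "tme \<Gamma> a0 a0' (inst a A)" "tme \<Gamma> b0 b0' (inst b A)"
    by auto
  then have l: "length a = n" "length b = n" "length a' = n" "length b' = n" "length \<Phi>' = n"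
    using ele_length teq_length by metis+
  have teq: "teq \<Gamma> (Idc \<Phi> a b) (Idc \<Phi>' a' b')"
    using assms(1) h' unfolding idc_ok_def by blast
  let ?K = "Idc \<Phi> a b @ \<Gamma>"
  have K: "sme ?K (sh n) (sh n) \<Gamma>"
    using teq_wf[OF teq] l h' by (intro sme_sh) (auto simp: length_Idc)
  have wf: "wfc (A # \<Phi> @ \<Gamma>)" using teq_wf[OF h(2)] by simp
  have b: "sme \<Gamma> (cat b Var) (cat b' Var) (\<Phi> @ \<Gamma>)"
    using wf h' by (intro ele_tele_ty) auto
  have ty: "tye ?K (subst (sh n) (subst (cat b Var) A)) (subst (sh n) (subst (cat b' Var) A'))"
    using sme_tye[OF K sme_tye[OF b h'(3)]] .
  have b0: "tme ?K (subst (sh n) b0) (subst (sh n) b0') (subst (sh n) (subst (cat b Var) A))"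
    using sme_tme[OF K] h' by (simp add: tsub_cat del: subst_subst)
  have a0: "tme ?K (subst (sh n) a0) (subst (sh n) a0') (subst (sh n) (subst (cat a Var) A))"
    using sme_tme[OF K] h' by (simp add: tsub_cat del: subst_subst)
  have A: "subst (cat (sb (sh n) s) Var) (subst (ups n (sh n)) A) = subst (sh n) (subst (cat s Var) A)"
    if "length s = n" for s using that by (simp add: cat_inst)
  have u: "ele ?K (seg 0 n) (seg 0 n) (Idc (subst_tele (sh n) \<Phi>) (sb (sh n) a) (sb (sh n) b))"
    using ele_seg[of "[]" "Idc \<Phi> a b" \<Gamma> 0 n n] teq_wf[OF teq] l h' by (simp add: length_Idc Idc_subst)
  have "tme ?K (tr1 (sb (sh n) a) (sb (sh n) b) (seg 0 n) (subst (sh n) a0))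
     (tr1 (sb (sh n) a') (sb (sh n) b') (seg 0 n) (subst (sh n) a0')) 
     (subst (cat (sb (sh n) b) Var) (subst (ups n (sh n)) A))"
    by (rule tr1_ok[OF assms, of "subst_tele (sh n) \<Phi>"])
      (use wf_subst[OF K, of "A # \<Phi>"] wf h' l K A[of a] a0 u in \<open>auto intro!: ele_subst\<close>)
  from Id_cong[OF ty this[unfolded A[OF l(2)]] b0]
  teq l h'(1) show "teq \<Gamma> (Idc \<Psi> aa bb) (Idc \<Psi>' aa' bb')"
    by (simp add: Idc_Cons)
qed

text \<open>Transport along reflexivity is definitionally trivial, so over \<open>rl a\<close> the
  last type of the identity context is a plain identity type. Both the introduction rule and the
  reduction of elimination to \<open>J\<close> go through this conversion.\<close>

lemma refl_conv:
  assumes "idc_ok n" "Jcomp_ok n" "length \<Phi> = n" "wfc (A # \<Phi> @ \<Gamma>)" "ele \<Gamma> a a \<Phi>"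
    and "tme \<Gamma> a0 a0 (subst (cat a Var) A)" "tme \<Gamma> b0 b0 (subst (cat a Var) A)"
  shows "tye \<Gamma> (IdT (subst (cat a Var) A) a0 b0)
    (subst (cat (rl a) Var) (hd (Idc (A # \<Phi>) (a0 # a) (b0 # a))))"
proof -
  have l: "length a = n" using assms(3,5) ele_length by metis
  have "tye \<Gamma> (IdT (subst (cat a Var) A) a0 b0) (IdT (subst (cat a Var) A) (tr1 a a (rl a) a0) b0)"
    using tr1_comp[OF assms(1-6)] assms(6,7) by (intro Id_cong) (auto intro: TmEq_sym tme_tye)
  with l assms(3) show ?thesis
    by (simp add: Idc_Cons tr1_subst cat_sh sb_seg_hit)
qed

lemma refl_step:
  assumes "idc_ok n" "Jcomp_ok n" "refl_ok n"
  shows "refl_ok (Suc n)"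
  unfolding refl_ok_def
proof (intro allI impI)
  fix \<Gamma> \<Psi> and aa aa' :: "'s tup"
  assume h: "length \<Psi> = Suc n" "wfc (\<Psi> @ \<Gamma>)" "ele \<Gamma> aa aa' \<Psi>"
  from h(1) obtain A \<Phi> where [simp]: "\<Psi> = A # \<Phi>"
    by (cases \<Psi>) auto
  from h(3) obtain a0 a a0' a' where [simp]: "aa = a0 # a" "aa' = a0' # a'"
    by (cases aa; cases aa') auto
  from h have h': "length \<Phi> = n" "wfc (A # \<Phi> @ \<Gamma>)" "ele \<Gamma> a a' \<Phi>" "tme \<Gamma> a0 a0' (subst (cat a Var) A)"
    by (auto simp: tsub_cat)
  have "tye \<Gamma> (IdT (subst (cat a Var) A) a0 a0)
    (subst (cat (rl a) Var) (hd (Idc (A # \<Phi>) (a0 # a) (a0 # a))))"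
    by (rule refl_conv[OF assms(1,2)]) (use h' ele_refl1 tme_refl1 in auto)
  with h' assms(3) show "ele \<Gamma> (rl aa) (rl aa') (Idc \<Psi> aa aa)"
    by (auto simp: Idc_Cons refl_ok_def tsub_cat intro: TmEq_conv Refl_cong)
qed

end

lemma cat_peel:
  "0 < i \<Longrightarrow> cat (a # s) \<sigma> i = cat s \<sigma> (i - 1)"
  "0 < k \<Longrightarrow> sb (cat (a # s) \<sigma>) (seg k n) = sb (cat s \<sigma>) (seg (k - 1) n)"
  "0 < k \<Longrightarrow> cat (a # s) \<sigma> \<odot> sh k = cat s \<sigma> \<odot> sh (k - 1)"
  by (auto simp: cat_def scomp_def fun_eq_iff intro!: nth_equalityI)

lemmas cat_simps = cat_peel tsub_cat cat_sh sb_seg_hit sb_seg_skip cat_seg_sh sh_sh scomp_sh_sh cat_inst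

text \<open>For $\Phi' = (x \in \Phi, x' \in A(x))$, \<open>last_entries\<close> is the telescope
  $(x' \in A(x), y' \in A(y), u' \in \mathrm{Id}_{A(y)}(u_!(x'),y'))$ over \<open>idt \<Phi>\<close>, and \<open>reorder\<close> substitutes
  the variables of the context $(x,y,u,x',y',u')$ for those of \<open>idt \<Phi>'\<close>.\<close>

definition last_entries :: "nat \<Rightarrow> 's exp \<Rightarrow> 's ctx" where
  "last_entries n A = [IdT (subst (cat (seg (2 + n) n) (sh (2 + n + n + n))) A)
        (tr1 (seg (2 + n + n) n) (seg (2 + n) n) (seg 2 n) (Var 1)) (Var 0),
        subst (cat (seg (1 + n) n) (sh (1 + n + n + n))) A, subst (sh (n + n)) A]"

definition reorder :: "nat \<Rightarrow> nat \<Rightarrow> 's exp" where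
  "reorder n = cat (Var 0 # seg 3 n) (cat (Var 1 # seg (3 + n) n) (cat (Var 2 # seg (3 + n + n) n)
      (sh (3 + n + n + n))))"

context type_theory
begin

section \<open>The induction step for elimination and computation\<close>

lemma tme_Var: "wfc \<Gamma> \<Longrightarrow> i < length \<Gamma> \<Longrightarrow> tme \<Gamma> (Var i) (Var i) (subst (sh (Suc i)) (\<Gamma> ! i))"
  using Tm_Var Tm_iff by (simp add: wk_conv)

lemma tme_Var_012:
  "wfc (A # \<Gamma>) \<Longrightarrow> tme (A # \<Gamma>) (Var 0) (Var 0) (subst (sh 1) A)"
  "wfc (B # A # \<Gamma>) \<Longrightarrow> tme (B # A # \<Gamma>) (Var 1) (Var 1) (subst (sh 2) A)"
  "wfc (C # B # A # \<Gamma>) \<Longrightarrow> tme (C # B # A # \<Gamma>) (Var 2) (Var 2) (subst (sh 3) A)"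
  using tme_Var[of "A # \<Gamma>" 0] tme_Var[of "B # A # \<Gamma>" 1] tme_Var[of "C # B # A # \<Gamma>" 2]
  by (simp_all add: numeral_3_eq_3 numeral_2_eq_2)

lemma id_tele_eq: "id_tele A = [IdT (subst (sh 2) A) (Var 1) (Var 0), subst (sh 1) A, A]"
  by (simp add: id_tele_def wk_conv)

lemma id_tele_wf:
  assumes "Ty \<Gamma> A \<in> T"
  shows "wfc (id_tele A @ \<Gamma>)"
proof -
  have 1: "wfc (A # \<Gamma>)" using assms Ty_ctx by auto
  then have 2: "Ty (A # \<Gamma>) (subst (sh 1) A) \<in> T"
    using sme_tye[OF sme_sh[of "[A]" \<Gamma> 1]] assms Ty_iff by auto
  with 1 have 3: "wfc (subst (sh 1) A # A # \<Gamma>)" by auto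
  have "tme (subst (sh 1) A # A # \<Gamma>) (Var 0) (Var 0) (subst (sh 2) A)"
    using tme_Var_012(1)[OF 3] by (simp add: cat_simps numeral_2_eq_2)
  moreover have "tme (subst (sh 1) A # A # \<Gamma>) (Var 1) (Var 1) (subst (sh 2) A)"
    using tme_Var_012(2)[OF 3] .
  ultimately show ?thesis using Id_form 3 Tm_iff by (auto simp: id_tele_eq)
qed

lemma J_cong_length:
  assumes "length \<Theta> = m" "Ty (\<Theta> @ id_tele A @ \<Gamma>) C \<in> T"
    "tme (subst_tele diag \<Theta> @ A # \<Gamma>) d d' (subst (ups m diag) C)"
    "tme \<Gamma> a a' A" "tme \<Gamma> b b' A" "tme \<Gamma> p p' (IdT A a b)" "ele \<Gamma> t t' (subst_tele (tsub [p, b, a]) \<Theta>)"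
  shows "tme \<Gamma> (J a b p d t) (J a' b' p' d' t') (inst (t @ [p, b, a]) C)"
  using J_cong assms by blast

lemma J_comp_length:
  assumes "length \<Theta> = m" "Ty (\<Theta> @ id_tele A @ \<Gamma>) C \<in> T"
    "tme (subst_tele diag \<Theta> @ A # \<Gamma>) d d (subst (ups m diag) C)"
    "tme \<Gamma> a a A" "ele \<Gamma> t t (subst_tele (tsub [Refl a, a, a]) \<Theta>)"
  shows "tme \<Gamma> (J a a (Refl a) d t) (inst (t @ [a]) d) (inst (t @ [Refl a, a, a]) C)"
  using J_comp assms elem_iff Tm_iff by blast

lemma Jprem_wf: "Jprem \<Gamma> \<Phi> \<Theta> c d d' \<Longrightarrow> wfc (\<Phi> @ \<Gamma>) \<and> wfc (\<Theta> @ idt \<Phi> @ \<Gamma>)"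
  unfolding Jprem_def by (blast dest: Ty_ctx tme_wf wf_append)

text \<open>The inner elimination. Once y = x and u is reflexivity, \<zeta> reads a path u' from x'
  to y' in the type A(x) as a path in the longer context, so c becomes a motive for \<open>J\<close>
  at A(x). The stage \<Delta> is arbitrary because this is applied both to the generic x and, for
  the computation rule, to the given endpoint.\<close>

lemma Jprem_stage:
  assumes n: "idc_ok n" "Jcomp_ok n" "refl_ok n" "idc_ok (Suc n)" "length \<Phi> = n" "length \<Theta> = m"
    and J: "Jprem \<Gamma> (A # \<Phi>) \<Theta> c d d'" and \<sigma>: "sme \<Delta> \<sigma> \<sigma> \<Gamma>" and x: "ele \<Delta> x x (subst_tele \<sigma> \<Phi>)"
    and \<zeta>_def: "\<zeta> = cat (Var 0 # rl (sb (sh 3) x)) (cat (Var 1 # sb (sh 3) x) (cat (Var 2 # sb (sh 3) x) (sh 3 \<odot> \<sigma>)))"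
  shows "Ty (subst_tele \<zeta> \<Theta> @ id_tele (subst (cat x \<sigma>) A) @ \<Delta>) (subst (ups m \<zeta>) c) \<in> T"
    and "tme (subst_tele diag (subst_tele \<zeta> \<Theta>) @ subst (cat x \<sigma>) A # \<Delta>)
      (subst (ups (Suc m) (cat x \<sigma>)) d) (subst (ups (Suc m) (cat x \<sigma>)) d')
      (subst (ups m diag) (subst (ups m \<zeta>) c))"
proof -
  let ?A = "subst (cat x \<sigma>) A"
  let ?K = "id_tele ?A @ \<Delta>"
  let ?x = "sb (sh 3) x"
  have l: "length x = n" using x n(5) ele_length by fastforce
  have wf\<Phi>: "wfc (A # \<Phi> @ \<Gamma>)" and wf: "wfc (\<Theta> @ idt (A # \<Phi>) @ \<Gamma>)"
    using Jprem_wf[OF J] by simp_all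
  have x\<sigma>: "sme \<Delta> (cat x \<sigma>) (cat x \<sigma>) (\<Phi> @ \<Gamma>)"
    using wf\<Phi> x \<sigma> by (intro sme_cat) auto
  then have A: "Ty \<Delta> ?A \<in> T" using wf\<Phi> sme_tye Ty_iff by auto
  then have K: "wfc ?K" by (rule id_tele_wf)
  have shK: "sme ?K (sh 3) (sh 3) \<Delta>" using K by (intro sme_sh) (auto simp: id_tele_eq)
  have x3: "ele ?K ?x ?x (subst_tele (sh 3 \<odot> \<sigma>) \<Phi>)"
    using ele_subst[OF x shK] by simp
  have K': "wfc (IdT (subst (sh 2) ?A) (Var 1) (Var 0) # subst (sh 1) ?A # ?A # \<Delta>)"
    using K by (simp only: id_tele_eq append_Cons append_Nil)
  have A3: "subst (cat ?x (sh 3 \<odot> \<sigma>)) A = subst (sh 3) ?A" by simp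
  have lx: "length ?x = n" using l by simp
  have v2: "tme ?K (Var 2) (Var 2) (subst (sh 3) ?A)"
    using tme_Var_012(3)[OF K'] by (simp only: id_tele_eq append_Cons append_Nil)
  have v1: "tme ?K (Var 1) (Var 1) (subst (sh 3) ?A)"
    using tme_Var_012(2)[OF K'] by (simp add: id_tele_eq sh_sh numeral_3_eq_3 numeral_2_eq_2)
  have v0: "tme ?K (Var 0) (Var 0) (IdT (subst (sh 3) ?A) (Var 2) (Var 1))"
    using tme_Var_012(1)[OF K'] by (simp add: id_tele_eq sh_sh numeral_3_eq_3 numeral_2_eq_2)
  have wf3: "wfc (subst_tele (sh 3 \<odot> \<sigma>) (A # \<Phi>) @ ?K)"
    using wf_subst[OF sme_comp[OF shK \<sigma>], of "A # \<Phi>"] wf\<Phi> by simp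
  \<comment> \<open>The variable u' has the plain identity type, whereas the identity context
    expects a path out of the transport of x' along reflexivity.\<close>
  have "tye ?K (IdT (subst (cat ?x Var) (subst (ups n (sh 3 \<odot> \<sigma>)) A)) (Var 2) (Var 1))
      (subst (cat (rl ?x) Var) (hd (Idc (subst_tele (sh 3 \<odot> \<sigma>) (A # \<Phi>)) (Var 2 # ?x) (Var 1 # ?x))))"
    unfolding subst_tele.simps n(5)
  proof (rule refl_conv[OF n(1,2)])
    show "length (subst_tele (sh 3 \<odot> \<sigma>) \<Phi>) = n" using n(5) by simp
    show "wfc (subst (ups n (sh 3 \<odot> \<sigma>)) A # subst_tele (sh 3 \<odot> \<sigma>) \<Phi> @ ?K)"
      using wf3 by (simp only: subst_tele.simps n(5) append_Cons)
    show "ele ?K ?x ?x (subst_tele (sh 3 \<odot> \<sigma>) \<Phi>)" by (rule x3)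
    show "tme ?K (Var 2) (Var 2) (subst (cat ?x Var) (subst (ups n (sh 3 \<odot> \<sigma>)) A))"
      using v2 by (simp only: subst_subst cat_inst[OF lx] A3 scomp_Var)
    show "tme ?K (Var 1) (Var 1) (subst (cat ?x Var) (subst (ups n (sh 3 \<odot> \<sigma>)) A))"
      using v1 by (simp only: subst_subst cat_inst[OF lx] A3 scomp_Var)
  qed
  then have v0: "tme ?K (Var 0) (Var 0)
      (subst (cat (rl ?x) Var) (hd (Idc (subst_tele (sh 3 \<odot> \<sigma>) (A # \<Phi>)) (Var 2 # ?x) (Var 1 # ?x))))"
    using TmEq_conv[OF v0] by (simp only: subst_subst cat_inst[OF lx] A3 scomp_Var)
  have 1: "sme ?K \<zeta> \<zeta> (idt (A # \<Phi>) @ \<Gamma>)"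
    unfolding \<zeta>_def
  proof (rule sme_idt[OF n(4)])
    show "sme ?K (sh 3 \<odot> \<sigma>) (sh 3 \<odot> \<sigma>) \<Gamma>" using sme_comp[OF shK \<sigma>] .
    show "ele ?K (Var 2 # ?x) (Var 2 # ?x) (subst_tele (sh 3 \<odot> \<sigma>) (A # \<Phi>))"
      using x3 v2 n(5) l by (simp add: cat_simps)
    show "ele ?K (Var 1 # ?x) (Var 1 # ?x) (subst_tele (sh 3 \<odot> \<sigma>) (A # \<Phi>))"
      using x3 v1 n(5) l by (simp add: cat_simps)
    have "ele ?K (rl ?x) (rl ?x) (Idc (subst_tele (sh 3 \<odot> \<sigma>) \<Phi>) ?x ?x)"
      using n(3) x3 n(5) wf3 unfolding refl_ok_def by auto
    with v0 show "ele ?K (Var 0 # rl ?x) (Var 0 # rl ?x)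
        (Idc (subst_tele (sh 3 \<odot> \<sigma>) (A # \<Phi>)) (Var 2 # ?x) (Var 1 # ?x))"
      by (simp add: Idc_Cons tsub_cat)
  qed (use n wf\<Phi> in auto)
  show "Ty (subst_tele \<zeta> \<Theta> @ ?K) (subst (ups m \<zeta>) c) \<in> T"
    using sme_tye[OF sme_ups'[OF 1 wf n(6)[symmetric]]] J Ty_iff Jprem_def by auto
  have 2: "sme (?A # \<Delta>) (ups 1 (cat x \<sigma>)) (ups 1 (cat x \<sigma>)) (A # \<Phi> @ \<Gamma>)"
    using sme_ups'[OF x\<sigma>, of "[A]" 1] wf\<Phi> by simp
  have d: "tme (subst_tele (diagc (Suc n)) \<Theta> @ A # \<Phi> @ \<Gamma>) d d' (subst (ups m (diagc (Suc n))) c)"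
    using J n by (simp add: Jprem_def)
  \<comment> \<open>Inserting x into the diagonal of the longer context gives the ordinary diagonal
    followed by \<zeta>; hence d has the type that \<open>J\<close> requires of its method.\<close>
  have 3: "ups 1 (cat x \<sigma>) \<odot> diagc (Suc n) = diag \<odot> \<zeta>"
    using l by (simp add: diag_eq diagc_def \<zeta>_def ups_cat seg_Suc cat_simps)
  have 4: "ups (Suc m) (cat x \<sigma>) = ups m (ups 1 (cat x \<sigma>))" by (simp add: ups_ups)
  have "sme (subst_tele (ups 1 (cat x \<sigma>) \<odot> diagc (Suc n)) \<Theta> @ ?A # \<Delta>)
      (ups m (ups 1 (cat x \<sigma>))) (ups m (ups 1 (cat x \<sigma>))) (subst_tele (diagc (Suc n)) \<Theta> @ A # \<Phi> @ \<Gamma>)"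
    using sme_ups'[OF 2, of "subst_tele (diagc (Suc n)) \<Theta>" m] tme_wf[OF d] n(6) by simp
  from sme_tme[OF this d] show "tme (subst_tele diag (subst_tele \<zeta> \<Theta>) @ ?A # \<Delta>)
      (subst (ups (Suc m) (cat x \<sigma>)) d) (subst (ups (Suc m) (cat x \<sigma>)) d')
      (subst (ups m diag) (subst (ups m \<zeta>) c))"
    by (simp only: subst_subst subst_tele_subst_tele 3 ups_comp 4)
qed

text \<open>The outer elimination. The variables x', y', u' join the parameters, which puts them
  after u and explains the reordering \<pi>. What remains is to type \<open>Jstep\<close> over the
  diagonal of \<Phi>, where the inner elimination applies.\<close>

lemma Jprem_step:
  assumes n: "idc_ok n" "J_ok n" "Jcomp_ok n" "refl_ok n" "idc_ok (Suc n)" "length \<Phi> = n" "length \<Theta> = m"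
    and J: "Jprem \<Gamma> (A # \<Phi>) \<Theta> c d d'"
    and \<pi>_def: "\<pi> = reorder n"
    and \<Xi>_def: "\<Xi> = last_entries n A"
  shows "Jprem \<Gamma> \<Phi> (subst_tele \<pi> \<Theta> @ \<Xi>) (subst (ups m \<pi>) c) (Jstep m d) (Jstep m d')"
proof -
  note \<pi>_def = \<pi>_def[unfolded reorder_def] and \<Xi>_def = \<Xi>_def[unfolded last_entries_def]
  let ?G = "idt \<Phi> @ \<Gamma>"
  let ?A0 = "subst (sh (n + n)) A"
  let ?A1 = "subst (cat (seg (1 + n) n) (sh (1 + n + n + n))) A"
  let ?A2 = "subst (cat (seg (2 + n) n) (sh (2 + n + n + n))) A"
  let ?t = "tr1 (seg (2 + n + n) n) (seg (2 + n) n) (seg 2 n) (Var 1)"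
  have wf\<Phi>: "wfc (A # \<Phi> @ \<Gamma>)" and wf: "wfc (\<Theta> @ idt (A # \<Phi>) @ \<Gamma>)"
    using Jprem_wf[OF J] by simp_all
  have G1: "Ty ([?A0] @ ?G) ?A1 \<in> T"
    using tr1_prem[OF n(1,6) wf\<Phi>] by (simp add: Jprem_def)
  have G2: "wfc ([?A1, ?A0] @ ?G)" using G1 Ty_ctx[OF G1] by simp
  have A2_eq: "subst (sh 1) ?A1 = ?A2"
    by (simp add: sh_sh numeral_2_eq_2)
  have v0: "tme ([?A1, ?A0] @ ?G) (Var 0) (Var 0) ?A2"
    using tme_Var_012(1)[of ?A1 "?A0 # ?G"] G2 A2_eq by (simp del: subst_subst)
  have v1: "tme ([?A1, ?A0] @ ?G) (Var 1) (Var 1) (subst (cat (seg (2 + n + n) n) Var) (subst (ups n (sh (2 + n + n + n))) A))"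
    using tme_Var_012(2)[of ?A1 ?A0 ?G] G2 by (simp add: cat_simps)
  have tr: "tme ([?A1, ?A0] @ ?G) ?t ?t (subst (cat (seg (2 + n) n) Var) (subst (ups n (sh (2 + n + n + n))) A))"
  proof -
    have "sme ([?A1, ?A0] @ ?G) (sh (2 + n + n + n)) (sh (2 + n + n + n)) \<Gamma>"
      using sme_sh[of "[?A1, ?A0] @ idt \<Phi>" \<Gamma> "2 + n + n + n"] G2 n(6) by (simp add: ac_simps)
    from wf_subst[OF this, of "A # \<Phi>"] wf\<Phi>
    have wf2: "wfc (subst (ups n (sh (2 + n + n + n))) A # subst_tele (sh (2 + n + n + n)) \<Phi> @ [?A1, ?A0] @ ?G)"
      by (simp only: subst_tele.simps append_Cons n(6))
    have 2: "2 = length [?A1, ?A0]" and l: "length (subst_tele (sh (2 + n + n + n)) \<Phi>) = n"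
      using n(6) by simp_all
    show ?thesis by (rule tr1_ok[OF n(1,2) l wf2 idt_ele[OF G2 n(6)[symmetric] 2] v1])
  qed
  have "Ty ([?A1, ?A0] @ ?G) (IdT ?A2 ?t (Var 0)) \<in> T"
    using v0 tr by (intro Id_form) (auto simp: Tm_iff cat_simps)
  with G2 have K: "wfc (\<Xi> @ ?G)" by (simp add: \<Xi>_def)
  let ?K = "\<Xi> @ ?G"
  have l\<Xi>: "length \<Xi> = 3" by (simp add: \<Xi>_def)
  note E = idt_ele[OF K n(6)[symmetric] l\<Xi>[symmetric]]
  have u: "tme ?K (Var 0) (Var 0) (IdT (subst (cat (seg (3 + n) n) (sh (3 + n + n + n))) A)
        (tr1 (seg (3 + n + n) n) (seg (3 + n) n) (seg 3 n) (Var 2)) (Var 1))"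
    using tme_Var_012(1)[of "IdT ?A2 ?t (Var 0)" "?A1 # ?A0 # ?G"] K
    by (simp add: cat_simps \<Xi>_def tr1_subst numeral_3_eq_3 numeral_2_eq_2)
  have y: "tme ?K (Var 1) (Var 1) (subst (cat (seg (3 + n) n) (sh (3 + n + n + n))) A)"
    using tme_Var_012(2)[of "IdT ?A2 ?t (Var 0)" "?A1" "?A0 # ?G"] K
    by (simp add: cat_simps \<Xi>_def numeral_3_eq_3 numeral_2_eq_2)
  have x: "tme ?K (Var 2) (Var 2) (subst (cat (seg (3 + n + n) n) (sh (3 + n + n + n))) A)"
    using tme_Var_012(3)[of "IdT ?A2 ?t (Var 0)" ?A1 ?A0 ?G] K
    by (simp add: cat_simps \<Xi>_def numeral_3_eq_3 numeral_2_eq_2)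
  have \<pi>: "sme ?K \<pi> \<pi> (idt (A # \<Phi>) @ \<Gamma>)"
    unfolding \<pi>_def
  proof (rule sme_idt[OF n(5)])
    show "sme ?K (sh (3 + n + n + n)) (sh (3 + n + n + n)) \<Gamma>"
      using sme_sh[of "\<Xi> @ idt \<Phi>" \<Gamma> "3 + n + n + n"] K n l\<Xi> by (simp add: ac_simps)
    show "ele ?K (Var 2 # seg (3 + n + n) n) (Var 2 # seg (3 + n + n) n) (subst_tele (sh (3 + n + n + n)) (A # \<Phi>))"
      using E(1) x n(6) by (simp add: tsub_cat cat_inst)
    show "ele ?K (Var 1 # seg (3 + n) n) (Var 1 # seg (3 + n) n) (subst_tele (sh (3 + n + n + n)) (A # \<Phi>))"
      using E(2) y n(6) by (simp add: tsub_cat cat_inst)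
    show "ele ?K (Var 0 # seg 3 n) (Var 0 # seg 3 n) (Idc (subst_tele (sh (3 + n + n + n)) (A # \<Phi>))
        (Var 2 # seg (3 + n + n) n) (Var 1 # seg (3 + n) n))"
      using E(3) u n(6)
      by (simp add: Idc_Cons tr1_subst tsub_cat cat_inst cat_sh sb_seg_skip sb_seg_hit cat_lookup_skip add.commute[of n 3])
  qed (use n wf\<Phi> in auto)
  have wf\<Theta>: "wfc (subst_tele \<pi> \<Theta> @ ?K)" using wf_subst[OF \<pi> wf] .
  have 1: "Ty (subst_tele \<pi> \<Theta> @ ?K) (subst (ups m \<pi>) c) \<in> T"
    using sme_tye[OF sme_ups'[OF \<pi> wf n(7)[symmetric]]] J Ty_iff Jprem_def by auto
  let ?\<delta> = "diagc n"
  have X: "ele (\<Phi> @ \<Gamma>) (seg 0 n) (seg 0 n) (subst_tele (sh n) \<Phi>)"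
    using ele_seg[of "[]" \<Phi> \<Gamma> 0 n n] wf\<Phi> n by simp
  have sh\<Phi>: "sme (\<Phi> @ \<Gamma>) (sh n) (sh n) \<Gamma>" using sme_sh[of \<Phi> \<Gamma> n] wf\<Phi> n by simp
  have "ele (\<Phi> @ \<Gamma>) (rl (seg 0 n)) (rl (seg 0 n)) (Idc (subst_tele (sh n) \<Phi>) (seg 0 n) (seg 0 n))"
    using n(4)[unfolded refl_ok_def, rule_format, OF _ _ X] wf_subst[OF sh\<Phi>] wf\<Phi> n by simp
  from sme_idt[OF n(1,6) _ sh\<Phi> X X this] wf\<Phi>
  have \<delta>: "sme (\<Phi> @ \<Gamma>) ?\<delta> ?\<delta> ?G" by (simp add: diagc_def cat_simps)
  let ?\<Theta>' = "subst_tele (ups 3 ?\<delta>) (subst_tele \<pi> \<Theta>)"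
  let ?\<Xi>' = "subst_tele ?\<delta> \<Xi>"
  let ?H = "?\<Theta>' @ ?\<Xi>' @ \<Phi> @ \<Gamma>"
  have H: "wfc ?H" using wf_subst[OF \<delta>, of "subst_tele \<pi> \<Theta> @ \<Xi>"] wf\<Theta> by (simp add: l\<Xi>)
  have lH: "length ?\<Theta>' = m" "length ?\<Xi>' = 3" using n(7) l\<Xi> by simp_all
  \<comment> \<open>Over the diagonal both x' and y' lie in A(x), but the type of u' still contains
    transport along reflexivity.\<close>
  have \<Xi>': "?\<Xi>' = [IdT (subst (sh 2) A) (tr1 (seg 2 n) (seg 2 n) (rl (seg 2 n)) (Var 1)) (Var 0), subst (sh 1) A, A]"
    by (simp add: \<Xi>_def diagc_def ups_cat seg_Suc cat_simps tr1_subst numeral_2_eq_2)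
  let ?X = "seg (m + 3) n" and ?\<sigma> = "sh (m + 3 + n)"
  have \<sigma>: "sme ?H ?\<sigma> ?\<sigma> \<Gamma>"
    using sme_sh[OF H[folded append_assoc], of "m + 3 + n"] lH
    by (simp only: length_append append_assoc n(6) simp_thms add.assoc)
  have XH: "ele ?H ?X ?X (subst_tele ?\<sigma> \<Phi>)"
  proof -
    have H': "wfc ((?\<Theta>' @ ?\<Xi>') @ \<Phi> @ \<Gamma>)" using H by (simp only: append_assoc)
    have "m + 3 = length (?\<Theta>' @ ?\<Xi>')" by (simp only: length_append lH)
    from ele_seg[OF H' this n(6)[symmetric] refl] show ?thesis by (simp only: append_assoc)
  qed
  define A' where "A' = subst (sh (m + 3)) A"
  have A': "A' = subst (cat ?X ?\<sigma>) A" by (simp add: A'_def cat_simps)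
  have "ele ?H (seg m 3) (seg m 3) (subst_tele (sh (m + 3)) ?\<Xi>')"
    using ele_seg[OF H, of m 3 "m + 3"] lH by simp
  then have v: "tme ?H (Var (m + 2)) (Var (m + 2)) A'" "tme ?H (Var (m + 1)) (Var (m + 1)) A'"
      "tme ?H (Var m) (Var m) (IdT A' (tr1 ?X ?X (rl ?X) (Var (m + 2))) (Var (m + 1)))"
    unfolding \<Xi>' A'_def
    by (simp_all add: seg_Suc cat_simps ups_cat numeral_3_eq_3 numeral_2_eq_2 tr1_subst)
  \<comment> \<open>The computation rule at length n removes that transport, so that u' becomes an
    admissible argument of \<open>J\<close>.\<close>
  have "tme ?H (tr1 ?X ?X (rl ?X) (Var (m + 2))) (Var (m + 2)) (subst (cat ?X Var) (subst (ups n ?\<sigma>) A))"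
    using wf_subst[OF \<sigma>, of "A # \<Phi>"] wf\<Phi> n XH v(1) A'
    by (intro tr1_comp[OF n(1,3), of "subst_tele ?\<sigma> \<Phi>"]) (auto simp: cat_inst)
  then have "tme ?H (tr1 ?X ?X (rl ?X) (Var (m + 2))) (Var (m + 2)) A'"
    by (simp add: cat_inst A')
  with v have p: "tme ?H (Var m) (Var m) (IdT A' (Var (m + 2)) (Var (m + 1)))"
    by (intro TmEq_conv[OF v(3)] Id_cong) (auto intro: tme_tye)
  define \<zeta> :: "nat \<Rightarrow> 's exp" where "\<zeta> = cat (Var 0 # rl (sb (sh 3) ?X)) (cat (Var 1 # sb (sh 3) ?X) (cat (Var 2 # sb (sh 3) ?X) (sh 3 \<odot> ?\<sigma>)))"
  note S = Jprem_stage[OF n(1,3,4,5,6,7) J \<sigma> XH \<zeta>_def, folded A']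
  let ?v = "[Var m, Var (m + 1), Var (m + 2)]"
  \<comment> \<open>Evaluating \<zeta> at u', y', x' agrees with the reordered diagonal, weakened
    past the parameters. This identifies the result type of the inner elimination with the type that
    the outer one demands.\<close>
  have eq: "cat ?v Var \<odot> \<zeta> = sh m \<odot> ups 3 ?\<delta> \<odot> \<pi>"
    by (simp add: \<zeta>_def \<pi>_def diagc_def ups_cat cat_simps seg_Suc numeral_3_eq_3 numeral_2_eq_2)
  have t: "ele ?H (seg 0 m) (seg 0 m) (subst_tele (tsub ?v) (subst_tele \<zeta> \<Theta>))"
    using ele_seg[of "[]" ?\<Theta>' "?\<Xi>' @ \<Phi> @ \<Gamma>" 0 m m] H lH(1)
    by (simp only: tsub_cat eq subst_tele_subst_tele scomp_assoc append_Nil list.size add_0 simp_thms)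
  have "tme ?H (J (Var (m + 2)) (Var (m + 1)) (Var m) (subst (ups (Suc m) (cat ?X ?\<sigma>)) d) (seg 0 m))
       (J (Var (m + 2)) (Var (m + 1)) (Var m) (subst (ups (Suc m) (cat ?X ?\<sigma>)) d') (seg 0 m))
      (inst (seg 0 m @ ?v) (subst (ups m \<zeta>) c))"
    by (rule J_cong_length[OF _ S v(1,2) p t]) (simp add: n(7))
  moreover have "subst (ups (length (subst_tele \<pi> \<Theta> @ \<Xi>)) ?\<delta>) (subst (ups m \<pi>) c) =
      inst (seg 0 m @ ?v) (subst (ups m \<zeta>) c)"
  proof -
    have "ups (m + 3) ?\<delta> \<odot> ups m \<pi> = ups m (ups 3 ?\<delta> \<odot> \<pi>)"
      by (simp add: ups_comp flip: ups_ups)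
    also have "\<dots> = cat (seg 0 m) (cat ?v Var \<odot> \<zeta>)" by (simp only: eq ups_cat[of m] scomp_assoc)
    finally show ?thesis using n l\<Xi> by (simp add: tsub_cat cat_inst)
  qed
  ultimately have "tme ?H (Jstep m d) (Jstep m d') (subst (ups (length (subst_tele \<pi> \<Theta> @ \<Xi>)) ?\<delta>) (subst (ups m \<pi>) c))"
    by (simp add: Jstep_def cat_seg_sh)
  with 1 show ?thesis using n l\<Xi> by (simp add: Jprem_def)
qed

lemma ele_appendI:
  "ele \<Gamma> s2 t2 \<Theta>2 \<Longrightarrow> ele \<Gamma> s1 t1 (subst_tele (cat s2 Var) \<Theta>1) \<Longrightarrow> ele \<Gamma> (s1 @ s2) (t1 @ t2) (\<Theta>1 @ \<Theta>2)"
  using ele_append ele_length by (metis length_subst_tele)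

text \<open>Supplying the arguments in the order of the outer elimination and then undoing the
  reordering yields the arguments of the elimination over the longer context.\<close>

lemma step_tele_eq:
  assumes "length p = n" "length b = n" "length a = n"
  shows "cat [p0, b0, a0] Var \<odot> ups 3 (cat (p @ b @ a) Var) \<odot> reorder n =
    cat (p0 # p) (cat (b0 # b) (cat (a0 # a) Var))"
proof -
  have "cat [p0, b0, a0] Var \<odot> ups 3 (cat (p @ b @ a) Var) = cat [p0, b0, a0] (cat p (cat b (cat a Var)))"
    by (simp add: cat_inst)
  with assms show ?thesis
    by (simp add: reorder_def cat_simps)
qed

text \<open>By the recursion equation of \<open>Jc\<close> this is the rule at length n, with the
  last entries of the path and of its endpoints appended to the parameters.\<close>

lemma J_step:
  assumes n: "idc_ok n" "J_ok n" "Jcomp_ok n" "refl_ok n" "idc_ok (Suc n)"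
  shows "J_ok (Suc n)"
  unfolding J_ok_def
proof (intro allI impI)
  fix \<Gamma> \<Psi> \<Theta> c d d' and aa aa' bb bb' pp pp' t t' :: "'s tup"
  assume h: "length \<Psi> = Suc n" "Jprem \<Gamma> \<Psi> \<Theta> c d d'" "ele \<Gamma> aa aa' \<Psi>" "ele \<Gamma> bb bb' \<Psi>"
    "ele \<Gamma> pp pp' (Idc \<Psi> aa bb)" "ele \<Gamma> t t' (subst_tele (cat (pp @ bb @ aa) Var) \<Theta>)"
  from h(1) obtain A \<Phi> where \<Psi> [simp]: "\<Psi> = A # \<Phi>" by (cases \<Psi>) auto
  from h(3,4) obtain a0 a a0' a' b0 b b0' b' where
    [simp]: "aa = a0 # a" "aa' = a0' # a'" "bb = b0 # b" "bb' = b0' # b'"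
    by (cases aa; cases aa'; cases bb; cases bb') auto
  from h(5) obtain p0 p p0' p' where [simp]: "pp = p0 # p" "pp' = p0' # p'"
    by (cases pp; cases pp') (auto simp: Idc_Cons)
  have e: "length \<Phi> = n" "ele \<Gamma> a a' \<Phi>" "ele \<Gamma> b b' \<Phi>" "ele \<Gamma> p p' (Idc \<Phi> a b)"
    using h by (auto simp: Idc_Cons)
  then have l: "length a = n" "length b = n" "length a' = n" "length b' = n"
    using ele_length by metis+
  then have lp: "length p = n" "length p' = n"
    using ele_length[OF e(4)] e(1) by (simp_all add: length_Idc)
  define m where "m = length \<Theta>"
  have lt: "length t = m" "length t' = m" using ele_length[OF h(6)] by (simp_all add: m_def)
  define \<pi> :: "nat \<Rightarrow> 's exp" where "\<pi> = reorder n"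
  define \<Xi> where "\<Xi> = last_entries n A"
  have l\<Xi>: "length \<Xi> = 3" by (simp add: \<Xi>_def last_entries_def)
  have P: "Jprem \<Gamma> \<Phi> (subst_tele \<pi> \<Theta> @ \<Xi>) (subst (ups m \<pi>) c) (Jstep m d) (Jstep m d')"
    by (rule Jprem_step[OF n e(1) m_def[symmetric] h(2)[unfolded \<Psi>] \<pi>_def \<Xi>_def])
  let ?\<rho> = "cat (p @ b @ a) Var"
  note eq = step_tele_eq[OF lp(1) l(2,1), of p0 b0 a0, folded \<pi>_def]
  have "ele \<Gamma> [p0, b0, a0] [p0', b0', a0'] (subst_tele ?\<rho> \<Xi>)"
    using h(3-5) l lp e(1)
    by (simp add: \<Xi>_def last_entries_def Idc_Cons cat_simps ups_cat seg_Suc tr1_subst numeral_2_eq_2)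
  moreover have "ele \<Gamma> t t' (subst_tele (cat [p0, b0, a0] Var) (subst_tele (ups 3 ?\<rho>) (subst_tele \<pi> \<Theta>)))"
    using h(6) by (simp only: subst_tele_subst_tele scomp_assoc eq) simp
  ultimately have "ele \<Gamma> (t @ [p0, b0, a0]) (t' @ [p0', b0', a0']) (subst_tele ?\<rho> (subst_tele \<pi> \<Theta> @ \<Xi>))"
    unfolding subst_tele_append l\<Xi> by (rule ele_appendI)
  from n(2)[unfolded J_ok_def, rule_format, OF e(1) P e(2-4) this]
  have "tme \<Gamma> (Jc aa bb pp d t) (Jc aa' bb' pp' d' t')
      (subst (cat t (cat [p0, b0, a0] ?\<rho>)) (subst (ups m \<pi>) c))"
    using lt cat_append[of "[p0, b0, a0]" "p @ b @ a" Var] by (simp add: Jc_Cons)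
  moreover have "cat t (cat [p0, b0, a0] ?\<rho>) \<odot> ups m \<pi> = cat (t @ pp @ bb @ aa) Var"
    using lt(1) eq by (simp add: cat_inst)
  ultimately show "tme \<Gamma> (Jc aa bb pp d t) (Jc aa' bb' pp' d' t') (subst (cat (t @ pp @ bb @ aa) Var) c)"
    by (simp only: subst_subst)
qed

text \<open>Two computations in succession: the outer one exposes the method \<open>Jstep\<close>,
  and the plain rule for \<open>J\<close> then evaluates that method.\<close>

lemma Jcomp_step:
  assumes n: "idc_ok n" "J_ok n" "Jcomp_ok n" "refl_ok n" "idc_ok (Suc n)"
  shows "Jcomp_ok (Suc n)"
  unfolding Jcomp_ok_def
proof (intro allI impI)
  fix \<Gamma> \<Psi> \<Theta> c d and aa t :: "'s tup"
  assume h: "length \<Psi> = Suc n" "Jprem \<Gamma> \<Psi> \<Theta> c d d" "ele \<Gamma> aa aa \<Psi>"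
    "ele \<Gamma> t t (subst_tele (cat (rl aa @ aa @ aa) Var) \<Theta>)"
  from h(1) obtain A \<Phi> where \<Psi> [simp]: "\<Psi> = A # \<Phi>" by (cases \<Psi>) auto
  from h(3) obtain a0 a where [simp]: "aa = a0 # a" by (cases aa) auto
  have e: "length \<Phi> = n" "ele \<Gamma> a a \<Phi>" "tme \<Gamma> a0 a0 (subst (cat a Var) A)"
    using h by (auto simp: tsub_cat)
  have wf: "wfc (A # \<Phi> @ \<Gamma>)" using Jprem_wf[OF h(2)] by simp
  have l: "length a = n" using e ele_length by metis
  define m where "m = length \<Theta>"
  have lt: "length t = m" using ele_length[OF h(4)] by (simp_all add: m_def)
  define \<pi> :: "nat \<Rightarrow> 's exp" where "\<pi> = reorder n"
  define \<Xi> where "\<Xi> = last_entries n A"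
  have l\<Xi>: "length \<Xi> = 3" by (simp add: \<Xi>_def last_entries_def)
  have P: "Jprem \<Gamma> \<Phi> (subst_tele \<pi> \<Theta> @ \<Xi>) (subst (ups m \<pi>) c) (Jstep m d) (Jstep m d)"
    by (rule Jprem_step[OF n e(1) m_def[symmetric] h(2)[unfolded \<Psi>] \<pi>_def \<Xi>_def])
  let ?\<rho> = "cat (rl a @ a @ a) Var" and ?v = "[Refl a0, a0, a0]"
  note eq = step_tele_eq[of "rl a" n a a "Refl a0" a0 a0, folded \<pi>_def]
  have r: "tme \<Gamma> (Refl a0) (Refl a0) (IdT (subst (cat a Var) A) (tr1 a a (rl a) a0) a0)"
    by (rule TmEq_conv[OF Refl_cong[OF e(3)]])
      (use refl_conv[OF n(1,3) e(1) wf e(2,3,3)] l e(1) in \<open>simp add: Idc_Cons tr1_subst cat_simps\<close>)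
  have "ele \<Gamma> ?v ?v (subst_tele ?\<rho> \<Xi>)"
    using r e(3) l by (simp add: \<Xi>_def last_entries_def cat_simps ups_cat seg_Suc tr1_subst numeral_2_eq_2)
  moreover have t: "ele \<Gamma> t t (subst_tele (cat ?v Var) (subst_tele (ups 3 ?\<rho>) (subst_tele \<pi> \<Theta>)))"
    using h(4) l by (simp only: subst_tele_subst_tele scomp_assoc eq length_map) simp
  ultimately have "ele \<Gamma> (t @ ?v) (t @ ?v) (subst_tele ?\<rho> (subst_tele \<pi> \<Theta> @ \<Xi>))"
    unfolding subst_tele_append l\<Xi> by (rule ele_appendI)
  from n(3)[unfolded Jcomp_ok_def, rule_format, OF e(1) P e(2) this]
  have "tme \<Gamma> (Jc aa aa (rl aa) d t) (inst ((t @ ?v) @ a) (Jstep m d))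
      (subst (cat t (cat ?v ?\<rho>)) (subst (ups m \<pi>) c))"
    using lt cat_append[of ?v "rl a @ a @ a" Var] by (simp add: Jc_Cons)
  moreover have "cat t (cat ?v ?\<rho>) \<odot> ups m \<pi> = cat (t @ rl aa @ aa @ aa) Var"
    using lt(1) eq l by (simp add: cat_inst)
  ultimately have 1: "tme \<Gamma> (Jc aa aa (rl aa) d t) (inst ((t @ ?v) @ a) (Jstep m d))
      (subst (cat (t @ rl aa @ aa @ aa) Var) c)"
    by (simp only: subst_subst)
  \<comment> \<open>Instantiated at the arguments, the outer method is a \<open>J\<close> applied to
    \<open>Refl a0\<close>, so it computes once more.\<close>
  have "inst ((t @ ?v) @ a) (Jstep m d) = J a0 a0 (Refl a0) (subst (ups (Suc m) (tsub ((t @ ?v) @ a) \<odot> sh (m + 3))) d) t"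
    using lt sb_seg_hit[of t m] by (simp add: Jstep_def tsub_cat ups_comp cat_lookup_skip numeral_2_eq_2)
  also have "tsub ((t @ ?v) @ a) \<odot> sh (m + 3) = (cat a Var :: nat \<Rightarrow> 's exp)"
    using lt cat_append[of "t @ ?v" a Var] by (simp add: tsub_cat cat_sh del: cat_append)
  finally have 2: "inst ((t @ ?v) @ a) (Jstep m d) = J a0 a0 (Refl a0) (subst (ups (Suc m) (cat a Var)) d) t" .
  have \<sigma>: "sme \<Gamma> Var Var \<Gamma>" using wf wf_append by (auto intro!: sme_Var)
  define \<zeta> :: "nat \<Rightarrow> 's exp" where "\<zeta> = cat (Var 0 # rl (sb (sh 3) a)) (cat (Var 1 # sb (sh 3) a) (cat (Var 2 # sb (sh 3) a) (sh 3 \<odot> Var)))"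
  have a\<Phi>: "ele \<Gamma> a a (subst_tele Var \<Phi>)" using e(2) by simp
  note S = Jprem_stage[OF n(1,3,4,5) e(1) m_def[symmetric] h(2)[unfolded \<Psi>] \<sigma> a\<Phi> \<zeta>_def]
  have \<zeta>: "cat ?v Var \<odot> \<zeta> = cat (rl aa) (cat aa (cat aa Var))"
    using l by (simp add: \<zeta>_def cat_simps)
  have "ele \<Gamma> t t (subst_tele (tsub ?v) (subst_tele \<zeta> \<Theta>))"
    using h(4) by (simp only: tsub_cat subst_tele_subst_tele \<zeta> cat_append)
  from J_comp_length[OF _ S e(3) this]
  have "tme \<Gamma> (J a0 a0 (Refl a0) (subst (ups (Suc m) (cat a Var)) d) t)
      (inst (t @ [a0]) (subst (ups (Suc m) (cat a Var)) d)) (inst (t @ ?v) (subst (ups m \<zeta>) c))"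
    by (simp add: m_def)
  moreover have "inst (t @ ?v) (subst (ups m \<zeta>) c) = subst (cat (t @ rl aa @ aa @ aa) Var) c"
    using lt by (simp add: tsub_cat cat_inst \<zeta> del: cat_Cons_append) (simp add: \<zeta>)
  moreover have "inst (t @ [a0]) (subst (ups (Suc m) (cat a Var)) d) = inst (t @ aa) d"
    using lt cat_inst[of "t @ [a0]" "Suc m" Var "cat a Var"] by (simp add: tsub_cat)
  ultimately show "tme \<Gamma> (Jc aa aa (rl aa) d t) (inst (t @ aa) d) (subst (cat (t @ rl aa @ aa @ aa) Var) c)"
    using TmEq_trans[OF 1] 2 by simp
qed

lemma Idc_rules: "idc_ok n \<and> refl_ok n \<and> J_ok n \<and> Jcomp_ok n"
proof (induction n)
  case 0
  have e: "ele \<Gamma> a b [] \<longleftrightarrow> a = [] \<and> b = []" for \<Gamma> a b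
    by (cases a; cases b) auto
  have q: "teq \<Gamma> [] \<Phi> \<longleftrightarrow> \<Phi> = [] \<and> wfc \<Gamma>" for \<Gamma> \<Phi>
    by (cases \<Phi>) auto
  have d: "diagc 0 = Var" by (simp add: diagc_def)
  have i: "idt [] = []" by (simp add: idt_def)
  \<comment> \<open>Over the empty context the generic path is empty, and elimination is mere
    substitution of the parameters.\<close>
  have "tme \<Gamma> (subst (cat t Var) d) (subst (cat t' Var) d') (subst (cat t Var) c)"
    if "tme (\<Theta> @ \<Gamma>) d d' c" "ele \<Gamma> t t' \<Theta>" for \<Gamma> \<Theta> d d' c t t'
    using that ele_tele_ty[of \<Theta> \<Gamma> t t'] sme_tme tme_wf by blast
  then show ?case
    by (auto simp: idc_ok_def refl_ok_def J_ok_def Jcomp_ok_def Jprem_def e q d i tsub_cat)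
next
  case (Suc n)
  then show ?case using idc_step refl_step J_step Jcomp_step by blast
qed

end

section \<open>Componentwise elimination\<close>

text \<open>Elimination into a telescope. Both \<open>transport\<close> and \<open>ap\<close> are
  instances, so the typing and computation of either follow from one lemma about it.\<close>

definition JJ :: "'s tup \<Rightarrow> 's tup \<Rightarrow> 's tup \<Rightarrow> 's tup \<Rightarrow> 's tup \<Rightarrow> 's tup" where
  "JJ a b p ds t = map (\<lambda>d. Jc a b p d t) ds"

lemma JJ_simps [simp]: "JJ a b p [] t = []" "JJ a b p (d # ds) t = Jc a b p d t # JJ a b p ds t"
  by (auto simp: JJ_def)

lemma length_JJ [simp]: "length (JJ a b p ds t) = length ds"
  by (simp add: JJ_def)

lemma JJ_subst:
  "length a = n \<Longrightarrow> length b = n \<Longrightarrow> length p = n \<Longrightarrow> sb \<sigma> (JJ a b p ds t) =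
     JJ (sb \<sigma> a) (sb \<sigma> b) (sb \<sigma> p) (sb (ups (n + length t) \<sigma>) ds) (sb \<sigma> t)"
  by (simp add: JJ_def Jc_subst map_map)

lemma transport_JJ: "transport a b p e = JJ a b p (seg 0 (length e)) e"
  by (simp add: transport_def JJ_def vars_seg)

lemma ap_JJ: "ap f a b p = JJ a b p (rl f) []"
  by (simp add: ap_def JJ_def map_map)

lemma sb_ups_seg: "j + m \<le> k \<Longrightarrow> sb (ups k \<sigma>) (seg j m) = seg j m"
  by (rule nth_equalityI) (auto simp: ups_def)

lemma transport_subst:
  "length a = length b \<Longrightarrow> length b = length p \<Longrightarrow>
   sb \<sigma> (transport a b p e) = transport (sb \<sigma> a) (sb \<sigma> b) (sb \<sigma> p) (sb \<sigma> e)"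
  by (simp add: transport_JJ JJ_subst[of _ "length p"] sb_ups_seg)

lemma length_ap [simp]: "length (ap f a b p) = length f"
  by (simp add: ap_JJ)

lemma idt_subst: "subst_tele \<sigma> (idt \<Phi>) = idt (subst_tele \<sigma> \<Phi>)"
  by (simp add: idt_def Let_def length_Idc Idc_subst sb_ups_seg ups_ups ups_sh')

context type_theory
begin

section \<open>The rules for identity contexts, relative to a substitution\<close>

lemma Idc_cong: "teq \<Gamma> \<Phi> \<Phi>' \<Longrightarrow> ele \<Gamma> a a' \<Phi> \<Longrightarrow> ele \<Gamma> b b' \<Phi> \<Longrightarrow> teq \<Gamma> (Idc \<Phi> a b) (Idc \<Phi>' a' b')"
  using Idc_rules[of "length \<Phi>"] unfolding idc_ok_def by blast

lemma Idc_wf: "wfc (\<Phi> @ \<Gamma>) \<Longrightarrow> ele \<Gamma> a a \<Phi> \<Longrightarrow> ele \<Gamma> b b \<Phi> \<Longrightarrow> wfc (Idc \<Phi> a b @ \<Gamma>)"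
  using Idc_cong[of \<Gamma> \<Phi> \<Phi> a a b b] teq_refl by blast

lemma rl_ele: "wfc (\<Phi> @ \<Gamma>) \<Longrightarrow> ele \<Gamma> a a' \<Phi> \<Longrightarrow> ele \<Gamma> (rl a) (rl a') (Idc \<Phi> a a)"
  using Idc_rules[of "length \<Phi>"] unfolding refl_ok_def by blast

lemma Jc_cong:
  "Jprem \<Gamma> \<Phi> \<Theta> c d d' \<Longrightarrow> ele \<Gamma> a a' \<Phi> \<Longrightarrow> ele \<Gamma> b b' \<Phi> \<Longrightarrow> ele \<Gamma> p p' (Idc \<Phi> a b) \<Longrightarrow>
   ele \<Gamma> t t' (subst_tele (cat (p @ b @ a) Var) \<Theta>) \<Longrightarrow>
   tme \<Gamma> (Jc a b p d t) (Jc a' b' p' d' t') (subst (cat (t @ p @ b @ a) Var) c)"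
  using Idc_rules[of "length \<Phi>"] unfolding J_ok_def by blast

lemma Jc_comp:
  "Jprem \<Gamma> \<Phi> \<Theta> c d d \<Longrightarrow> ele \<Gamma> a a \<Phi> \<Longrightarrow> ele \<Gamma> t t (subst_tele (cat (rl a @ a @ a) Var) \<Theta>) \<Longrightarrow>
   tme \<Gamma> (Jc a a (rl a) d t) (inst (t @ a) d) (subst (cat (t @ rl a @ a @ a) Var) c)"
  using Idc_rules[of "length \<Phi>"] unfolding Jcomp_ok_def by blast

lemma Idc_length: "ele \<Gamma> a a' \<Phi> \<Longrightarrow> ele \<Gamma> b b' \<Phi> \<Longrightarrow> length (Idc \<Phi> a b) = length \<Phi>"
  using ele_length length_Idc by metis

lemma ele_Idc_length:
  "ele \<Gamma> a a' \<Phi> \<Longrightarrow> ele \<Gamma> b b' \<Phi> \<Longrightarrow> ele \<Gamma> p p' (Idc \<Phi> a b) \<Longrightarrow> length p = length \<Phi> \<and> length p' = length \<Phi>"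
  using ele_length Idc_length by metis

lemma sme_sh_append: "wfc (\<Theta>' @ \<Theta> @ \<Gamma>) \<Longrightarrow> k = length \<Theta>' + length \<Theta> \<Longrightarrow> sme (\<Theta>' @ \<Theta> @ \<Gamma>) (sh k) (sh k) \<Gamma>"
  using sme_sh[of "\<Theta>' @ \<Theta>" \<Gamma> k] by simp

lemma sme_diagc:
  assumes "wfc (\<Phi> @ \<Gamma>)"
  shows "sme (\<Phi> @ \<Gamma>) (diagc (length \<Phi>)) (diagc (length \<Phi>)) (idt \<Phi> @ \<Gamma>)"
proof -
  let ?n = "length \<Phi>"
  have X: "ele (\<Phi> @ \<Gamma>) (seg 0 ?n) (seg 0 ?n) (subst_tele (sh ?n) \<Phi>)"
    using ele_seg[of "[]" \<Phi> \<Gamma> 0 ?n ?n] assms by simp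
  have sh: "sme (\<Phi> @ \<Gamma>) (sh ?n) (sh ?n) \<Gamma>" using sme_sh assms by blast
  from sme_idt[OF _ refl assms sh X X rl_ele[OF wf_subst[OF sh assms] X]] Idc_rules[of ?n]
  show ?thesis by (simp add: diagc_def cat_simps)
qed

lemma Jprem_subst:
  assumes J: "Jprem \<Gamma> \<Phi> \<Theta> c d d'" and \<sigma>: "sme \<Delta> \<sigma> \<sigma> \<Gamma>" and l: "length \<Phi> = n" "length \<Theta> = m"
  shows "Jprem \<Delta> (subst_tele \<sigma> \<Phi>) (subst_tele (ups (n + n + n) \<sigma>) \<Theta>)
    (subst (ups (m + (n + n + n)) \<sigma>) c) (subst (ups (m + n) \<sigma>) d) (subst (ups (m + n) \<sigma>) d')"
proof -
  have wf: "wfc (\<Phi> @ \<Gamma>)" "wfc (\<Theta> @ idt \<Phi> @ \<Gamma>)" "wfc (idt \<Phi> @ \<Gamma>)"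
    using Jprem_wf[OF J] wf_append by blast+
  have 1: "sme (idt (subst_tele \<sigma> \<Phi>) @ \<Delta>) (ups (n + n + n) \<sigma>) (ups (n + n + n) \<sigma>) (idt \<Phi> @ \<Gamma>)"
    using sme_ups'[OF \<sigma> wf(3)] l by (simp add: idt_subst)
  have 2: "sme (subst_tele \<sigma> \<Phi> @ \<Delta>) (ups n \<sigma>) (ups n \<sigma>) (\<Phi> @ \<Gamma>)"
    using sme_ups'[OF \<sigma> wf(1)] l by simp
  have d: "tme (subst_tele (diagc n) \<Theta> @ \<Phi> @ \<Gamma>) d d' (subst (ups m (diagc n)) c)"
    using J l by (simp add: Jprem_def)
  have wfd: "wfc (subst_tele (diagc n) \<Theta> @ \<Phi> @ \<Gamma>)"
    using tme_wf[OF d] .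
  have c: "diagc n \<odot> ups (n + n + n) \<sigma> = ups n \<sigma> \<odot> diagc n"
  proof -
    have "diagc n \<odot> ups (n + n + n) \<sigma> = cat (rl (seg 0 n) @ seg 0 n) Var \<odot> ups (n + n) (ups n \<sigma>)"
      by (simp add: diagc_def ups_ups)
    also have "\<dots> = cat (rl (seg 0 n)) (cat (seg 0 n) (ups n \<sigma>))"
      by (subst cat_inst) auto
    also have "\<dots> = ups n \<sigma> \<odot> diagc n"
      by (simp add: diagc_def sb_ups_seg)
    finally show ?thesis .
  qed
  have "Ty (subst_tele (ups (n + n + n) \<sigma>) \<Theta> @ idt (subst_tele \<sigma> \<Phi>) @ \<Delta>) (subst (ups (m + (n + n + n)) \<sigma>) c) \<in> T"
    using sme_tye[OF sme_ups'[OF 1 wf(2) l(2)[symmetric]]] J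
    by (simp add: Jprem_def Ty_iff ups_ups)
  moreover have "tme (subst_tele (diagc n) (subst_tele (ups (n + n + n) \<sigma>) \<Theta>) @ subst_tele \<sigma> \<Phi> @ \<Delta>)
      (subst (ups (m + n) \<sigma>) d) (subst (ups (m + n) \<sigma>) d')
      (subst (ups m (diagc n)) (subst (ups (m + (n + n + n)) \<sigma>) c))"
  proof -
    have u: "ups (m + n) \<sigma> = ups m (ups n \<sigma>)" "ups (m + (n + n + n)) \<sigma> = ups m (ups (n + n + n) \<sigma>)"
      by (simp_all add: ups_ups)
    have "m = length (subst_tele (diagc n) \<Theta>)" using l by simp
    from sme_tme[OF sme_ups'[OF 2 wfd this] d] show ?thesis
      by (simp only: subst_subst subst_tele_subst_tele u ups_comp c)
  qed
  ultimately show ?thesis using l by (simp add: Jprem_def)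
qed

text \<open>The premises stay over \<Gamma> while the arguments live over some \<Delta> mapped to it
  by \<sigma>. In this form one method can be used at the generic path, at the diagonal and at given
  arguments.\<close>

lemma Jc_stage:
  assumes J: "Jprem \<Gamma> \<Phi> \<Theta> c d d'" and \<sigma>: "sme \<Delta> \<sigma> \<sigma> \<Gamma>" and l: "length \<Phi> = n" "length \<Theta> = m"
    and e: "ele \<Delta> a a' (subst_tele \<sigma> \<Phi>)" "ele \<Delta> b b' (subst_tele \<sigma> \<Phi>)"
      "ele \<Delta> p p' (Idc (subst_tele \<sigma> \<Phi>) a b)" "ele \<Delta> t t' (subst_tele (cat (p @ b @ a) \<sigma>) \<Theta>)"
  shows "tme \<Delta> (Jc a b p (subst (ups (m + n) \<sigma>) d) t) (Jc a' b' p' (subst (ups (m + n) \<sigma>) d') t')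
    (subst (cat (t @ p @ b @ a) \<sigma>) c)"
proof -
  have la: "length a = n" "length b = n" "length p = n" "length t = m"
    using ele_length e ele_Idc_length[OF e(1-3)] l by (metis length_subst_tele)+
  have 1: "cat (p @ b @ a) Var \<odot> ups (n + n + n) \<sigma> = cat (p @ b @ a) \<sigma>"
    by (subst cat_inst) (auto simp: la)
  have 2: "cat (t @ p @ b @ a) Var \<odot> ups (m + (n + n + n)) \<sigma> = cat (t @ p @ b @ a) \<sigma>"
    by (subst cat_inst) (auto simp: la)
  have t: "ele \<Delta> t t' (subst_tele (cat (p @ b @ a) Var) (subst_tele (ups (n + n + n) \<sigma>) \<Theta>))"
    using e(4) by (simp only: subst_tele_subst_tele 1)
  from Jc_cong[OF Jprem_subst[OF J \<sigma> l] e(1-3) t] show ?thesis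
    by (simp only: subst_subst 2)
qed

lemma Jc_comp_stage:
  assumes J: "Jprem \<Gamma> \<Phi> \<Theta> c d d" and \<sigma>: "sme \<Delta> \<sigma> \<sigma> \<Gamma>" and l: "length \<Phi> = n" "length \<Theta> = m"
    and e: "ele \<Delta> a a (subst_tele \<sigma> \<Phi>)" "ele \<Delta> t t (subst_tele (cat (rl a @ a @ a) \<sigma>) \<Theta>)"
  shows "tme \<Delta> (Jc a a (rl a) (subst (ups (m + n) \<sigma>) d) t) (subst (cat (t @ a) \<sigma>) d)
    (subst (cat (t @ rl a @ a @ a) \<sigma>) c)"
proof -
  have la: "length a = n" "length t = m"
    using ele_length e l by (metis length_subst_tele)+
  have 1: "cat (rl a @ a @ a) Var \<odot> ups (n + n + n) \<sigma> = cat (rl a @ a @ a) \<sigma>"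
    by (subst cat_inst) (auto simp: la)
  have 2: "cat (t @ rl a @ a @ a) Var \<odot> ups (m + (n + n + n)) \<sigma> = cat (t @ rl a @ a @ a) \<sigma>"
    by (subst cat_inst) (auto simp: la)
  have 3: "cat (t @ a) Var \<odot> ups (m + n) \<sigma> = cat (t @ a) \<sigma>"
    by (subst cat_inst) (auto simp: la)
  have t: "ele \<Delta> t t (subst_tele (cat (rl a @ a @ a) Var) (subst_tele (ups (n + n + n) \<sigma>) \<Theta>))"
    using e(2) by (simp only: subst_tele_subst_tele 1)
  from Jc_comp[OF Jprem_subst[OF J \<sigma> l] e(1) t] show ?thesis
    by (simp only: subst_subst 2 3 tsub_cat)
qed

text \<open>The type B of the last component depends on the earlier components, which are
  eliminations themselves. The last motive is therefore B at the earlier components evaluated on the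
  generic path, and its method fits only because these compute on the diagonal. Hence typing and
  computation are proved in one induction on \<Omega>, for all stages \<sigma>.\<close>

lemma JJ_stage:
  assumes wf: "wfc (\<Omega> @ \<Theta> @ idt \<Phi> @ \<Gamma>)" and l: "length \<Phi> = n" "length \<Theta> = m"
    and ds: "ele (subst_tele (diagc n) \<Theta> @ \<Phi> @ \<Gamma>) ds ds (subst_tele (ups m (diagc n)) \<Omega>)"
  shows "sme \<Delta> \<sigma> \<sigma> \<Gamma> \<Longrightarrow> ele \<Delta> a a' (subst_tele \<sigma> \<Phi>) \<Longrightarrow> ele \<Delta> b b' (subst_tele \<sigma> \<Phi>) \<Longrightarrow>
      ele \<Delta> p p' (Idc (subst_tele \<sigma> \<Phi>) a b) \<Longrightarrow> ele \<Delta> t t' (subst_tele (cat (p @ b @ a) \<sigma>) \<Theta>) \<Longrightarrow>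
      ele \<Delta> (JJ a b p (sb (ups (m + n) \<sigma>) ds) t) (JJ a' b' p' (sb (ups (m + n) \<sigma>) ds) t')
        (subst_tele (cat (t @ p @ b @ a) \<sigma>) \<Omega>)"
    and "sme \<Delta> \<sigma> \<sigma> \<Gamma> \<Longrightarrow> ele \<Delta> a a (subst_tele \<sigma> \<Phi>) \<Longrightarrow>
      ele \<Delta> t t (subst_tele (cat (rl a @ a @ a) \<sigma>) \<Theta>) \<Longrightarrow>
      ele \<Delta> (JJ a a (rl a) (sb (ups (m + n) \<sigma>) ds) t) (sb (cat (t @ a) \<sigma>) ds)
        (subst_tele (cat (t @ rl a @ a @ a) \<sigma>) \<Omega>)"
  using wf ds
proof (induction \<Omega> arbitrary: ds \<Delta> \<sigma> a a' b b' p p' t t')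
  case Nil
  { case 1 then show ?case by (cases ds) auto }
  { case 2 then show ?case by (cases ds) auto }
next
  case (Cons B \<Omega>)
  \<comment> \<open>This c is the motive for the last component. The equation says that each
    instance of it is B at the corresponding eliminated components.\<close>
  have main: "\<exists>c. Jprem \<Gamma> \<Phi> \<Theta> c d d \<and> (\<forall>a b p t \<sigma>. length a = n \<longrightarrow> length b = n \<longrightarrow> length p = n \<longrightarrow> length t = m \<longrightarrow>
      subst (cat (t @ p @ b @ a) \<sigma>) c =
      subst (cat (JJ a b p (sb (ups (m + n) \<sigma>) ds) t) (cat (t @ p @ b @ a) \<sigma>)) B)"
    if wf: "wfc ((B # \<Omega>) @ \<Theta> @ idt \<Phi> @ \<Gamma>)"
      and ds: "ele (subst_tele (diagc n) \<Theta> @ \<Phi> @ \<Gamma>) (d # ds) (d # ds) (subst_tele (ups m (diagc n)) (B # \<Omega>))"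
    for d ds
  proof -
    let ?K = "\<Theta> @ idt \<Phi> @ \<Gamma>" and ?\<sigma> = "sh (m + n + n + n)" and ?H = "subst_tele (diagc n) \<Theta> @ \<Phi> @ \<Gamma>"
    let ?X = "seg (m + n + n) n" and ?Y = "seg (m + n) n" and ?U = "seg m n" and ?Z = "seg 0 m"
    have wf': "wfc (\<Omega> @ ?K)" "wfc ?K" "wfc (idt \<Phi> @ \<Gamma>)" "wfc (\<Phi> @ \<Gamma>)"
      using wf wf_append[of "B # \<Omega>" ?K] wf_append[of "\<Theta>" "idt \<Phi> @ \<Gamma>"]
        wf_append[of "subst_tele (diagc n) \<Theta>" "\<Phi> @ \<Gamma>"] wf_append[of "idt \<Phi>" \<Gamma>]
        wf_append[of "take (2 * n) (idt \<Phi>)" "\<Phi> @ \<Gamma>"] l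
      by (auto simp: idt_def Let_def length_Idc)
    have ds': "ele ?H ds ds (subst_tele (ups m (diagc n)) \<Omega>)"
      and d: "tme ?H d d (inst ds (subst (ups (length \<Omega>) (ups m (diagc n))) B))"
      using ds by auto
    have lds: "length ds = length \<Omega>" using ele_length[OF ds'] by simp
    have \<sigma>: "sme ?K ?\<sigma> ?\<sigma> \<Gamma>"
      using sme_sh[of "\<Theta> @ idt \<Phi>" \<Gamma> "m + n + n + n"] wf' l by simp
    have c0: "cat ?Z (sh m) = Var" by (simp add: cat_seg_sh)
    have c1: "cat ?Z (cat ?U (cat ?Y (cat ?X ?\<sigma>))) = Var" "cat ?U (cat ?Y (cat ?X ?\<sigma>)) = sh m"
      by (simp_all add: cat_seg_sh)
    let ?ds = "sb (ups (m + n) ?\<sigma>) ds"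
    let ?j = "JJ ?X ?Y ?U ?ds ?Z"
    have t: "ele ?K ?Z ?Z (subst_tele (cat (?U @ ?Y @ ?X) ?\<sigma>) \<Theta>)"
      using ele_seg[of "[]" \<Theta> "idt \<Phi> @ \<Gamma>" 0 m m] wf' l by (simp add: c1)
    have j: "ele ?K ?j ?j \<Omega>"
      using Cons.IH(1)[OF \<sigma> idt_ele[OF wf'(2) l[symmetric]] t wf'(1) ds']
      by (simp only: c1 c0 cat_append subst_tele_Var)
    let ?c = "subst (cat ?j Var) B"
    have c: "Ty ?K ?c \<in> T"
      using sme_tye[OF ele_tele_ty[OF wf'(1) j], of B B] wf Ty_iff by auto
    \<comment> \<open>The methods live over the parameters, x and \<Gamma>. Weakening them to the
      generic path and then instantiating the path restores them over \<sigma>.\<close>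
    have sub: "sb (cat (t @ p @ b @ a) \<sigma>) ?j = JJ a b p (sb (ups (m + n) \<sigma>) ds) t"
      if "length a = n" "length b = n" "length p = n" "length t = m" for a b p t \<sigma>
    proof -
      have "cat (t @ p @ b @ a) \<sigma> \<odot> ?\<sigma> = \<sigma>"
        using that cat_sh[of "t @ p @ b @ a" "m + n + n + n" \<sigma>] by (simp add: ac_simps)
      then have "ups (n + m) (cat (t @ p @ b @ a) \<sigma>) \<odot> ups (m + n) ?\<sigma> = ups (m + n) \<sigma>"
        by (simp add: ups_comp add.commute[of n m] del: cat_append)
      then show ?thesis
        using that by (simp add: JJ_subst[of _ n] sb_seg_hit sb_seg_skip)
    qed
    have H: "sme ?H (ups m (diagc n)) (ups m (diagc n)) ?K"
      using sme_ups'[OF sme_diagc[OF wf'(4)] wf'(2) l(2)[symmetric]] l(1) by simp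
    have umd: "ups m (diagc n) = (cat (seg 0 m @ rl (seg m n) @ seg m n @ seg m n) (sh (m + n)) :: nat \<Rightarrow> 's exp)"
      by (simp add: ups_cat diagc_def cat_seg_sh)
    have \<sigma>H: "sme ?H (sh (m + n)) (sh (m + n)) \<Gamma>"
      by (rule sme_sh_append[OF sme_wf(1)[OF H]]) (simp add: l)
    have X': "ele ?H (seg m n) (seg m n) (subst_tele (sh (m + n)) \<Phi>)"
      by (rule ele_seg[OF sme_wf(1)[OF H]]) (simp_all add: l)
    have Z': "ele ?H (seg 0 m) (seg 0 m) (subst_tele (cat (rl (seg m n) @ seg m n @ seg m n) (sh (m + n))) \<Theta>)"
    proof -
      have "ele ?H (seg 0 m) (seg 0 m) (subst_tele (sh m) (subst_tele (diagc n) \<Theta>))"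
        by (rule ele_seg[of "[]", simplified append_Nil, OF sme_wf(1)[OF H]]) (simp_all add: l)
      moreover have "sh m \<odot> diagc n = (cat (rl (seg m n) @ seg m n @ seg m n) (sh (m + n)) :: nat \<Rightarrow> 's exp)"
        by (simp add: diagc_def cat_seg_sh)
      ultimately show ?thesis by (simp only: subst_tele_subst_tele)
    qed
    have "sb (cat (seg 0 m @ seg m n) (sh (m + n))) ds = ds"
      by (simp add: cat_seg_sh)
    \<comment> \<open>The computation rule for the earlier components at the generic diagonal: there
      they reduce to the methods \<open>ds\<close>, over which d is typed.\<close>
    with Cons.IH(2)[OF \<sigma>H X' Z' wf'(1) ds'] sub[of "seg m n" "seg m n" "rl (seg m n)" "seg 0 m" "sh (m + n)"]
    have "ele ?H (sb (ups m (diagc n)) ?j) ds (subst_tele (ups m (diagc n)) \<Omega>)"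
      by (simp only: umd length_seg length_map)
    then have "ele ?H ds (sb (ups m (diagc n)) ?j) (subst_tele (ups m (diagc n)) \<Omega>)"
      using ele_sym wf_subst[OF H wf'(1)] by blast
    from sme_tye[OF sme_cat[OF H wf'(1) this], of B B]
    have "tye ?H (subst (cat ds (ups m (diagc n))) B) (subst (ups m (diagc n)) ?c)"
      using wf Ty_iff by auto
    with d lds have "tme ?H d d (subst (ups m (diagc n)) ?c)"
      using TmEq_conv by (simp add: tsub_cat cat_inst)
    with c l have "Jprem \<Gamma> \<Phi> \<Theta> ?c d d" by (simp add: Jprem_def)
    moreover have "subst (cat (t @ p @ b @ a) \<sigma>) ?c =
      subst (cat (JJ a b p (sb (ups (m + n) \<sigma>) ds) t) (cat (t @ p @ b @ a) \<sigma>)) B"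
      if "length a = n" "length b = n" "length p = n" "length t = m" for a b p t \<sigma>
      by (simp only: subst_subst scomp_cat sub[OF that] scomp_Var)
    ultimately show ?thesis by blast
  qed
  { case 1
    then obtain d ds0 where ds: "ds = d # ds0" by (cases ds) auto
    from main[of d ds0] 1(6,7) ds obtain c where c: "Jprem \<Gamma> \<Phi> \<Theta> c d d"
      "\<And>a b p t \<sigma>. length a = n \<Longrightarrow> length b = n \<Longrightarrow> length p = n \<Longrightarrow> length t = m \<Longrightarrow>
      subst (cat (t @ p @ b @ a) \<sigma>) c =
      subst (cat (JJ a b p (sb (ups (m + n) \<sigma>) ds0) t) (cat (t @ p @ b @ a) \<sigma>)) B" by blast
    have la: "length a = n" "length b = n" "length p = n" "length t = m"
      using ele_length 1 ele_Idc_length[OF 1(2-4)] l by (metis length_subst_tele)+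
    have lds: "length ds0 = length \<Omega>" using 1(7) ele_length unfolding ds by fastforce
    have "ele \<Delta> (JJ a b p (sb (ups (m + n) \<sigma>) ds0) t) (JJ a' b' p' (sb (ups (m + n) \<sigma>) ds0) t')
        (subst_tele (cat (t @ p @ b @ a) \<sigma>) \<Omega>)"
      using 1(6,7) ds by (intro Cons.IH(1)[OF 1(1-5)]) auto
    moreover have "tme \<Delta> (Jc a b p (subst (ups (m + n) \<sigma>) d) t) (Jc a' b' p' (subst (ups (m + n) \<sigma>) d) t')
        (inst (JJ a b p (sb (ups (m + n) \<sigma>) ds0) t) (subst (ups (length \<Omega>) (cat (t @ p @ b @ a) \<sigma>)) B))"
      using Jc_stage[OF c(1) 1(1) l 1(2-5)] c(2)[OF la] lds by (simp add: tsub_cat cat_inst del: cat_append)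
    ultimately show ?case by (simp add: ds del: cat_append)
  }
  { case 2
    then obtain d ds0 where ds: "ds = d # ds0" by (cases ds) auto
    from main[of d ds0] 2(4,5) ds obtain c where c: "Jprem \<Gamma> \<Phi> \<Theta> c d d"
      "\<And>a b p t \<sigma>. length a = n \<Longrightarrow> length b = n \<Longrightarrow> length p = n \<Longrightarrow> length t = m \<Longrightarrow>
      subst (cat (t @ p @ b @ a) \<sigma>) c =
      subst (cat (JJ a b p (sb (ups (m + n) \<sigma>) ds0) t) (cat (t @ p @ b @ a) \<sigma>)) B" by blast
    have la: "length a = n" "length (rl a) = n" "length t = m"
      using ele_length[OF 2(2)] ele_length[OF 2(3)] l by simp_all
    have lds: "length ds0 = length \<Omega>" using 2(5) ele_length unfolding ds by fastforce
    have "ele \<Delta> (JJ a a (rl a) (sb (ups (m + n) \<sigma>) ds0) t) (sb (cat (t @ a) \<sigma>) ds0)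
        (subst_tele (cat (t @ rl a @ a @ a) \<sigma>) \<Omega>)"
      using 2(4,5) ds by (intro Cons.IH(2)[OF 2(1-3)]) auto
    moreover have "tme \<Delta> (Jc a a (rl a) (subst (ups (m + n) \<sigma>) d) t) (subst (cat (t @ a) \<sigma>) d)
        (inst (JJ a a (rl a) (sb (ups (m + n) \<sigma>) ds0) t) (subst (ups (length \<Omega>) (cat (t @ rl a @ a @ a) \<sigma>)) B))"
      using Jc_comp_stage[OF c(1) 2(1) l 2(2,3)] c(2)[OF la(1,1,2,3)] lds
      by (simp add: tsub_cat cat_inst del: cat_append)
    ultimately show ?case by (simp add: ds del: cat_append)
  }
qed


section \<open>Closed contexts, and transport in a telescope\<close>

lemma sme_Nil: "wfc \<Gamma> \<Longrightarrow> sme \<Gamma> \<sigma> \<tau> []"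
  by (simp add: sme_def)

lemma closed_wf: "wfc \<Phi> \<Longrightarrow> wfc \<Gamma> \<Longrightarrow> wfc (\<Phi> @ \<Gamma>)"
  using wf_subst[OF sme_Nil[of \<Gamma> Var Var], of \<Phi>] by simp

lemma ele_weaken: "ele [] s t \<Phi> \<Longrightarrow> wfc \<Gamma> \<Longrightarrow> ele \<Gamma> s t \<Phi>"
  using ele_subst[OF _ sme_Nil[of \<Gamma> Var Var], of s t \<Phi>] by simp

lemma tme_scoped: "tme \<Gamma> a b A \<Longrightarrow> \<forall>i < length \<Gamma>. \<sigma> i = \<tau> i \<Longrightarrow> subst \<sigma> a = subst \<tau> a"
  using scoped_subst_cong Tm_scoped TmEq_Tm by blast

lemma ele_scoped: "ele \<Gamma> s t \<Theta> \<Longrightarrow> \<forall>i < length \<Gamma>. \<sigma> i = \<tau> i \<Longrightarrow> sb \<sigma> s = sb \<tau> s"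
proof (induction \<Theta> arbitrary: s t)
  case Nil
  then show ?case by (cases s; cases t) auto
next
  case (Cons A \<Theta>)
  then obtain a s' b t' where [simp]: "s = a # s'" "t = b # t'"
    by (cases s; cases t) auto
  then show ?case using Cons.prems Cons.IH[of s' t'] tme_scoped[of \<Gamma> a b "inst s' A" \<sigma> \<tau>] by simp
qed

lemma sme_closed_cat: "wfc \<Phi> \<Longrightarrow> wfc \<Gamma> \<Longrightarrow> ele \<Gamma> x x' \<Phi> \<Longrightarrow> sme \<Gamma> (cat x \<sigma>) (cat x' \<tau>) \<Phi>"
  using sme_cat[OF sme_Nil[of \<Gamma> \<sigma> \<tau>], of \<Phi> x x'] by (simp add: subst_tele_closed)

text \<open>The parameter lies in \<Omega>(x) and the motive is \<Omega>(y). Both become \<Omega> on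
  the diagonal, so the generic element of \<Omega> serves as the method.\<close>

lemma transport_aux:
  assumes wf: "wfc (\<Omega> @ \<Phi> @ \<Gamma>)" and l: "length \<Phi> = n" "length \<Omega> = m"
  shows "wfc (subst_tele (cat (seg (m + n) n) (sh (m + n + n + n))) \<Omega> @ subst_tele (sh (n + n)) \<Omega> @ idt \<Phi> @ \<Gamma>)"
    "ele (subst_tele (diagc n) (subst_tele (sh (n + n)) \<Omega>) @ \<Phi> @ \<Gamma>) (seg 0 m) (seg 0 m)
      (subst_tele (ups m (diagc n)) (subst_tele (cat (seg (m + n) n) (sh (m + n + n + n))) \<Omega>))"
proof -
  let ?\<Theta> = "subst_tele (sh (n + n)) \<Omega>"
  have wf\<Phi>: "wfc (\<Phi> @ \<Gamma>)" using wf wf_append by blast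
  have idt: "wfc (idt \<Phi> @ \<Gamma>)" using idt_wf[OF _ l(1) wf\<Phi>] Idc_rules by blast
  have "sme (idt \<Phi> @ \<Gamma>) (sh (n + n)) (sh (n + n)) (\<Phi> @ \<Gamma>)"
    using sme_sh[of "Idc (subst_tele (sh (n + n)) \<Phi>) (seg n n) (seg 0 n) @ subst_tele (sh n) \<Phi>" "\<Phi> @ \<Gamma>" "n + n"]
      idt l by (simp add: idt_def Let_def length_Idc)
  from wf_subst[OF this wf] have wf\<Theta>: "wfc (?\<Theta> @ idt \<Phi> @ \<Gamma>)" .
  have m: "m = length ?\<Theta>" using l by simp
  have s: "sme (?\<Theta> @ idt \<Phi> @ \<Gamma>) (sh (m + n + n + n)) (sh (m + n + n + n)) \<Gamma>"
    by (rule sme_sh_append[OF wf\<Theta>]) (simp add: l)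
  have "sme (?\<Theta> @ idt \<Phi> @ \<Gamma>) (cat (seg (m + n) n) (sh (m + n + n + n)))
      (cat (seg (m + n) n) (sh (m + n + n + n))) (\<Phi> @ \<Gamma>)"
    by (rule sme_cat[OF s wf\<Phi> idt_ele(2)[OF wf\<Theta> l(1)[symmetric] m]])
  from wf_subst[OF this wf]
  show "wfc (subst_tele (cat (seg (m + n) n) (sh (m + n + n + n))) \<Omega> @ ?\<Theta> @ idt \<Phi> @ \<Gamma>)" .
  have 1: "diagc n \<odot> sh (n + n) = (Var :: nat \<Rightarrow> 's exp)"
    by (simp add: diagc_def cat_simps)
  have 2: "ups m (diagc n) \<odot> cat (seg (m + n) n) (sh (m + n + n + n)) = (sh m :: nat \<Rightarrow> 's exp)"
    by (simp add: diagc_def cat_simps ups_cat)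
  have "ele (\<Omega> @ \<Phi> @ \<Gamma>) (seg 0 m) (seg 0 m) (subst_tele (sh m) \<Omega>)"
    using ele_seg[of "[]" \<Omega> "\<Phi> @ \<Gamma>" 0 m m] wf l by simp
  then show "ele (subst_tele (diagc n) ?\<Theta> @ \<Phi> @ \<Gamma>) (seg 0 m) (seg 0 m)
      (subst_tele (ups m (diagc n)) (subst_tele (cat (seg (m + n) n) (sh (m + n + n + n))) \<Omega>))"
    by (simp only: subst_tele_subst_tele 1 2 subst_tele_Var)
qed

lemma transport_ele:
  assumes wf: "wfc (\<Omega> @ \<Phi> @ \<Gamma>)"
    and e: "ele \<Gamma> a a' \<Phi>" "ele \<Gamma> b b' \<Phi>" "ele \<Gamma> p p' (Idc \<Phi> a b)" "ele \<Gamma> e e' (subst_tele (cat a Var) \<Omega>)"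
  shows "ele \<Gamma> (transport a b p e) (transport a' b' p' e') (subst_tele (cat b Var) \<Omega>)"
proof -
  let ?n = "length \<Phi>" and ?m = "length \<Omega>"
  have la: "length a = ?n" "length b = ?n" "length p = ?n" "length e = ?m" "length e' = ?m"
    using ele_length[OF e(1)] ele_length[OF e(2)] ele_length[OF e(4)] ele_Idc_length[OF e(1-3)] by simp_all
  have id: "sme \<Gamma> Var Var \<Gamma>" using wf wf_append sme_Var by metis
  have 1: "cat (p @ b @ a) Var \<odot> sh (?n + ?n) = cat a Var"
    "cat (e @ p @ b @ a) Var \<odot> cat (seg (?m + ?n) ?n) (sh (?m + ?n + ?n + ?n)) = cat b Var"
    using la by (simp_all add: cat_simps)
  have t: "ele \<Gamma> e e' (subst_tele (cat (p @ b @ a) Var) (subst_tele (sh (?n + ?n)) \<Omega>))"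
    using e(4) by (simp only: subst_tele_subst_tele 1)
  have "ele \<Gamma> (JJ a b p (sb (ups (?m + ?n) Var) (seg 0 ?m)) e) (JJ a' b' p' (sb (ups (?m + ?n) Var) (seg 0 ?m)) e')
      (subst_tele (cat (e @ p @ b @ a) Var) (subst_tele (cat (seg (?m + ?n) ?n) (sh (?m + ?n + ?n + ?n))) \<Omega>))"
    by (rule JJ_stage(1)[OF transport_aux(1)[OF wf refl refl] refl _ transport_aux(2)[OF wf refl refl] id])
      (use e t in simp_all)
  then show ?thesis
    by (simp only: subst_tele_subst_tele 1 ups_Var sb_Var transport_JJ la)
qed

lemma transport_comp:
  assumes wf: "wfc (\<Omega> @ \<Phi> @ \<Gamma>)"
    and e: "ele \<Gamma> a a \<Phi>" "ele \<Gamma> e e (subst_tele (cat a Var) \<Omega>)"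
  shows "ele \<Gamma> (transport a a (rl a) e) e (subst_tele (cat a Var) \<Omega>)"
proof -
  let ?n = "length \<Phi>" and ?m = "length \<Omega>"
  have la: "length a = ?n" "length e = ?m"
    using ele_length[OF e(1)] ele_length[OF e(2)] by simp_all
  have id: "sme \<Gamma> Var Var \<Gamma>" using wf wf_append sme_Var by metis
  have 1: "cat (rl a @ a @ a) Var \<odot> sh (?n + ?n) = cat a Var"
    "cat (e @ rl a @ a @ a) Var \<odot> cat (seg (?m + ?n) ?n) (sh (?m + ?n + ?n + ?n)) = cat a Var"
    "sb (cat (e @ a) Var) (seg 0 ?m) = e"
    using la by (simp_all add: cat_simps)
  have t: "ele \<Gamma> e e (subst_tele (cat (rl a @ a @ a) Var) (subst_tele (sh (?n + ?n)) \<Omega>))"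
    using e(2) by (simp only: subst_tele_subst_tele 1)
  have "ele \<Gamma> (JJ a a (rl a) (sb (ups (?m + ?n) Var) (seg 0 ?m)) e) (sb (cat (e @ a) Var) (seg 0 ?m))
      (subst_tele (cat (e @ rl a @ a @ a) Var) (subst_tele (cat (seg (?m + ?n) ?n) (sh (?m + ?n + ?n + ?n))) \<Omega>))"
    by (rule JJ_stage(2)[OF transport_aux(1)[OF wf refl refl] refl _ transport_aux(2)[OF wf refl refl] id])
      (use e t in simp_all)
  then show ?thesis
    by (simp only: subst_tele_subst_tele 1 ups_Var sb_Var transport_JJ la)
qed

text \<open>Families over the generic path of a closed context, and their sections, are represented as
  functions of the path $(x,y,u)$ and of a tuple \<open>t\<close> of parameters that commute with substitution.
  This keeps de Bruijn indices out of the homotopies constructed below.\<close>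

definition pt :: "'s ctx \<Rightarrow> 's ctx \<Rightarrow> 's tup \<Rightarrow> 's tup \<Rightarrow> 's tup \<Rightarrow> bool" where
  "pt \<Phi> \<Gamma> x y u \<longleftrightarrow> wfc \<Gamma> \<and> ele \<Gamma> x x \<Phi> \<and> ele \<Gamma> y y \<Phi> \<and> ele \<Gamma> u u (Idc \<Phi> x y)"

definition fam :: "'s ctx \<Rightarrow> ('s tup \<Rightarrow> 's tup \<Rightarrow> 's tup \<Rightarrow> 's ctx) \<Rightarrow> bool" where
  "fam \<Phi> \<Theta> \<longleftrightarrow> (\<forall>\<Gamma> x y u. pt \<Phi> \<Gamma> x y u \<longrightarrow> wfc (\<Theta> x y u @ \<Gamma>) \<and>
     (\<forall>\<sigma>. subst_tele \<sigma> (\<Theta> x y u) = \<Theta> (sb \<sigma> x) (sb \<sigma> y) (sb \<sigma> u)))"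

definition fam2 :: "'s ctx \<Rightarrow> ('s tup \<Rightarrow> 's tup \<Rightarrow> 's tup \<Rightarrow> 's ctx) \<Rightarrow>
    ('s tup \<Rightarrow> 's tup \<Rightarrow> 's tup \<Rightarrow> 's tup \<Rightarrow> 's ctx) \<Rightarrow> bool" where
  "fam2 \<Phi> \<Theta> \<Omega> \<longleftrightarrow> (\<forall>\<Gamma> x y u t. pt \<Phi> \<Gamma> x y u \<longrightarrow> ele \<Gamma> t t (\<Theta> x y u) \<longrightarrow> wfc (\<Omega> x y u t @ \<Gamma>) \<and>
     (\<forall>\<sigma>. subst_tele \<sigma> (\<Omega> x y u t) = \<Omega> (sb \<sigma> x) (sb \<sigma> y) (sb \<sigma> u) (sb \<sigma> t)))"

definition sec :: "'s ctx \<Rightarrow> ('s tup \<Rightarrow> 's tup \<Rightarrow> 's tup \<Rightarrow> 's ctx) \<Rightarrow>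
    ('s tup \<Rightarrow> 's tup \<Rightarrow> 's tup \<Rightarrow> 's tup \<Rightarrow> 's ctx) \<Rightarrow> ('s tup \<Rightarrow> 's tup \<Rightarrow> 's tup \<Rightarrow> 's tup \<Rightarrow> 's tup) \<Rightarrow> bool" where
  "sec \<Phi> \<Theta> \<Omega> F \<longleftrightarrow> (\<forall>\<Gamma> x y u t. pt \<Phi> \<Gamma> x y u \<longrightarrow> ele \<Gamma> t t (\<Theta> x y u) \<longrightarrow>
     ele \<Gamma> (F x y u t) (F x y u t) (\<Omega> x y u t) \<and>
     (\<forall>\<sigma>. sb \<sigma> (F x y u t) = F (sb \<sigma> x) (sb \<sigma> y) (sb \<sigma> u) (sb \<sigma> t)))"

section \<open>Elimination for families that commute with substitution\<close>

lemma pt_rl: "wfc \<Phi> \<Longrightarrow> wfc \<Gamma> \<Longrightarrow> ele \<Gamma> x x \<Phi> \<Longrightarrow> pt \<Phi> \<Gamma> x x (rl x)"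
  using rl_ele closed_wf unfolding pt_def by blast

lemma pt_length: "pt \<Phi> \<Gamma> x y u \<Longrightarrow> length x = length \<Phi> \<and> length y = length \<Phi> \<and> length u = length \<Phi>"
  using ele_length[of \<Gamma> x x \<Phi>] ele_length[of \<Gamma> y y \<Phi>] ele_Idc_length[of \<Gamma> x x \<Phi> y y u u]
  by (simp add: pt_def)

text \<open>Elimination is performed once, with the families evaluated at the generic path. Because
  they commute with substitution, that one instance determines them at every path.\<close>

lemma elim:
  assumes \<Phi>: "wfc \<Phi>" and \<Theta>: "fam \<Phi> \<Theta>" and \<Omega>: "fam2 \<Phi> \<Theta> \<Omega>"
    and D: "\<And>\<Gamma> x t. wfc \<Gamma> \<Longrightarrow> ele \<Gamma> x x \<Phi> \<Longrightarrow> ele \<Gamma> t t (\<Theta> x x (rl x)) \<Longrightarrow>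
      ele \<Gamma> (D x t) (D x t) (\<Omega> x x (rl x) t) \<and> (\<forall>\<sigma>. sb \<sigma> (D x t) = D (sb \<sigma> x) (sb \<sigma> t))"
  obtains K where "sec \<Phi> \<Theta> \<Omega> K"
    "\<And>\<Gamma> x t. wfc \<Gamma> \<Longrightarrow> ele \<Gamma> x x \<Phi> \<Longrightarrow> ele \<Gamma> t t (\<Theta> x x (rl x)) \<Longrightarrow>
      ele \<Gamma> (K x x (rl x) t) (D x t) (\<Omega> x x (rl x) t)"
proof -
  define n where "n = length \<Phi>"
  have G: "wfc (idt \<Phi>)" using idt_wf[OF _ refl, of \<Phi> "[]"] Idc_rules[of "length \<Phi>"] \<Phi> by simp
  let ?X = "seg (n + n) n" and ?Y = "seg n n" and ?U = "seg 0 n"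
  define \<Theta>g where "\<Theta>g = \<Theta> ?X ?Y ?U"
  define m where "m = length \<Theta>g"
  have "pt \<Phi> (idt \<Phi>) ?X ?Y ?U"
    using idt_ele[of "[]" \<Phi> "[]" n 0] G \<Phi> by (simp add: pt_def n_def subst_tele_closed)
  then have wf\<Theta>: "wfc (\<Theta>g @ idt \<Phi>)" and nat\<Theta>: "subst_tele \<sigma> \<Theta>g = \<Theta> (sb \<sigma> ?X) (sb \<sigma> ?Y) (sb \<sigma> ?U)" for \<sigma>
    using \<Theta> unfolding fam_def \<Theta>g_def by blast+
  let ?X' = "seg (m + n + n) n" and ?Y' = "seg (m + n) n" and ?U' = "seg m n" and ?Z = "seg 0 m"
  define \<Omega>g where "\<Omega>g = \<Omega> ?X' ?Y' ?U' ?Z"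
  have p: "pt \<Phi> (\<Theta>g @ idt \<Phi>) ?X' ?Y' ?U'"
    using idt_ele[of \<Theta>g \<Phi> "[]" n m] wf\<Theta> \<Phi> by (simp add: pt_def n_def m_def subst_tele_closed)
  have "ele (\<Theta>g @ idt \<Phi>) ?Z ?Z (\<Theta> ?X' ?Y' ?U')"
    using ele_seg[of "[]" \<Theta>g "idt \<Phi>" 0 m m] wf\<Theta> by (simp add: m_def nat\<Theta> ac_simps)
  with p have wf\<Omega>: "wfc (\<Omega>g @ \<Theta>g @ idt \<Phi>)"
    and nat\<Omega>: "subst_tele \<sigma> \<Omega>g = \<Omega> (sb \<sigma> ?X') (sb \<sigma> ?Y') (sb \<sigma> ?U') (sb \<sigma> ?Z)" for \<sigma>
    using \<Omega> unfolding fam2_def \<Omega>g_def by blast+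
  let ?H = "subst_tele (diagc n) \<Theta>g @ \<Phi>"
  have H: "wfc ?H"
    using wf_subst[OF sme_diagc[of \<Phi> "[]"], of \<Theta>g] \<Phi> wf\<Theta> by (simp add: n_def)
  have x: "ele ?H (seg m n) (seg m n) \<Phi>"
    using ele_seg[of "subst_tele (diagc n) \<Theta>g" \<Phi> "[]" m n "m + n"] H \<Phi>
    by (simp add: n_def m_def subst_tele_closed)
  have sd: "sh m \<odot> diagc n = (cat (rl (seg m n)) (cat (seg m n) (sh m)) :: nat \<Rightarrow> 's exp)"
    by (simp add: diagc_def)
  have \<Theta>d: "subst_tele (sh m) (subst_tele (diagc n) \<Theta>g) = \<Theta> (seg m n) (seg m n) (rl (seg m n))"
    unfolding subst_tele_subst_tele sd
    unfolding nat\<Theta> by (simp add: sb_seg_hit sb_seg_skip)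
  have t: "ele ?H ?Z ?Z (\<Theta> (seg m n) (seg m n) (rl (seg m n)))"
    using ele_seg[of "[]" "subst_tele (diagc n) \<Theta>g" "\<Phi>" 0 m m] H \<Theta>d by (simp add: m_def)
  define ds where "ds = D (seg m n) ?Z"
  have ds: "ele ?H ds ds (\<Omega> (seg m n) (seg m n) (rl (seg m n)) ?Z)"
    and natD: "sb \<sigma> ds = D (sb \<sigma> (seg m n)) (sb \<sigma> ?Z)" for \<sigma>
    using D[OF H x t] unfolding ds_def by blast+
  have "subst_tele (ups m (diagc n)) \<Omega>g = \<Omega> (seg m n) (seg m n) (rl (seg m n)) ?Z"
    by (simp add: nat\<Omega> ups_cat diagc_def cat_simps)
  with ds have ds': "ele (subst_tele (diagc n) \<Theta>g @ \<Phi> @ []) ds ds (subst_tele (ups m (diagc n)) \<Omega>g)"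
    by simp
  have wf\<Omega>': "wfc (\<Omega>g @ \<Theta>g @ idt \<Phi> @ [])" using wf\<Omega> by simp
  note J = JJ_stage[OF wf\<Omega>' n_def[symmetric] m_def[symmetric] ds']
  define K where "K = (\<lambda>x y u t. JJ x y u ds t)"
  \<comment> \<open>The method D at generic arguments has no variables besides x and the parameters,
    so the same \<open>ds\<close> works over every context and K commutes with substitution.\<close>
  have ds_inv: "sb (ups (n + m) \<sigma>) ds = ds" for \<sigma>
    using natD[of "ups (n + m) \<sigma>"] by (simp add: sb_ups_seg ds_def)
  have K: "sec \<Phi> \<Theta> \<Omega> K"
    unfolding sec_def
  proof (intro allI impI conjI)
    fix \<Gamma> x y u t \<sigma> assume p: "pt \<Phi> \<Gamma> x y u" and t: "ele \<Gamma> t t (\<Theta> x y u)"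
    have l: "length x = n" "length y = n" "length u = n" using pt_length[OF p] by (simp_all add: n_def)
    have \<Theta>': "subst_tele (cat (u @ y @ x) Var) \<Theta>g = \<Theta> x y u"
      using l by (simp add: nat\<Theta> cat_simps)
    then have lt: "length t = m" using ele_length[OF t] by (metis length_subst_tele m_def)
    have \<Omega>': "subst_tele (cat (t @ u @ y @ x) Var) \<Omega>g = \<Omega> x y u t"
      using l lt by (simp add: nat\<Omega> cat_simps)
    have \<Gamma>: "sme \<Gamma> Var Var []" using p by (simp add: pt_def sme_def)
    from J(1)[OF this, of x x y y u u t t] show "ele \<Gamma> (K x y u t) (K x y u t) (\<Omega> x y u t)"
      using p t \<Theta>' \<Omega>' by (simp add: pt_def K_def del: cat_append)
    show "sb \<sigma> (K x y u t) = K (sb \<sigma> x) (sb \<sigma> y) (sb \<sigma> u) (sb \<sigma> t)"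
      using l lt by (simp add: K_def JJ_subst[of _ n] ds_inv)
  qed
  have "ele \<Gamma> (K x x (rl x) t) (D x t) (\<Omega> x x (rl x) t)"
    if \<Gamma>: "wfc \<Gamma>" and x: "ele \<Gamma> x x \<Phi>" and t: "ele \<Gamma> t t (\<Theta> x x (rl x))" for \<Gamma> x t
  proof -
    have l: "length x = n" using ele_length[OF x] by (simp add: n_def)
    have \<Theta>': "subst_tele (cat (rl x @ x @ x) Var) \<Theta>g = \<Theta> x x (rl x)"
      using l by (simp add: nat\<Theta> cat_simps)
    then have lt: "length t = m" using ele_length[OF t] by (metis length_subst_tele m_def)
    have \<Omega>': "subst_tele (cat (t @ rl x @ x @ x) Var) \<Omega>g = \<Omega> x x (rl x) t"
      using l lt by (simp add: nat\<Omega> cat_simps)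
    have D': "sb (cat (t @ x) Var) ds = D x t"
      using l lt by (simp add: natD cat_simps)
    from J(2)[OF sme_Nil[OF \<Gamma>], of x Var t] show ?thesis
      using x t \<Theta>' \<Omega>' D' by (simp add: K_def del: cat_append)
  qed
  with K show thesis by (rule that)
qed

text \<open>Sections are determined up to homotopy by their values on the diagonal. Agreement there
  is definitional, so by conversion reflexivity at F is a path from F to G, which is the method
  needed.\<close>

lemma elim_hom:
  assumes \<Phi>: "wfc \<Phi>" and \<Theta>: "fam \<Phi> \<Theta>" and \<Omega>: "fam2 \<Phi> \<Theta> \<Omega>" and F: "sec \<Phi> \<Theta> \<Omega> F" and G: "sec \<Phi> \<Theta> \<Omega> G"
    and FG: "\<And>\<Gamma> x t. wfc \<Gamma> \<Longrightarrow> ele \<Gamma> x x \<Phi> \<Longrightarrow> ele \<Gamma> t t (\<Theta> x x (rl x)) \<Longrightarrow>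
      ele \<Gamma> (F x x (rl x) t) (G x x (rl x) t) (\<Omega> x x (rl x) t)"
  obtains H where "sec \<Phi> \<Theta> (\<lambda>x y u t. Idc (\<Omega> x y u t) (F x y u t) (G x y u t)) H"
    "\<And>\<Gamma> x t. wfc \<Gamma> \<Longrightarrow> ele \<Gamma> x x \<Phi> \<Longrightarrow> ele \<Gamma> t t (\<Theta> x x (rl x)) \<Longrightarrow>
      ele \<Gamma> (H x x (rl x) t) (rl (F x x (rl x) t)) (Idc (\<Omega> x x (rl x) t) (F x x (rl x) t) (G x x (rl x) t))"
proof (rule elim[OF \<Phi> \<Theta>, of "\<lambda>x y u t. Idc (\<Omega> x y u t) (F x y u t) (G x y u t)" "\<lambda>x t. rl (F x x (rl x) t)"])
  show "fam2 \<Phi> \<Theta> (\<lambda>x y u t. Idc (\<Omega> x y u t) (F x y u t) (G x y u t))"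
    unfolding fam2_def
  proof (intro allI impI conjI)
    fix \<Gamma> x y u t \<sigma> assume p: "pt \<Phi> \<Gamma> x y u" "ele \<Gamma> t t (\<Theta> x y u)"
    then have w: "wfc (\<Omega> x y u t @ \<Gamma>)"
      "subst_tele \<sigma> (\<Omega> x y u t) = \<Omega> (sb \<sigma> x) (sb \<sigma> y) (sb \<sigma> u) (sb \<sigma> t)"
      using \<Omega> unfolding fam2_def by blast+
    have f: "ele \<Gamma> (F x y u t) (F x y u t) (\<Omega> x y u t)"
      "sb \<sigma> (F x y u t) = F (sb \<sigma> x) (sb \<sigma> y) (sb \<sigma> u) (sb \<sigma> t)"
      using p F unfolding sec_def by blast+
    have g: "ele \<Gamma> (G x y u t) (G x y u t) (\<Omega> x y u t)"
      "sb \<sigma> (G x y u t) = G (sb \<sigma> x) (sb \<sigma> y) (sb \<sigma> u) (sb \<sigma> t)"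
      using p G unfolding sec_def by blast+
    show "wfc (Idc (\<Omega> x y u t) (F x y u t) (G x y u t) @ \<Gamma>)"
      by (rule Idc_wf[OF w(1) f(1) g(1)])
    show "subst_tele \<sigma> (Idc (\<Omega> x y u t) (F x y u t) (G x y u t)) =
      Idc (\<Omega> (sb \<sigma> x) (sb \<sigma> y) (sb \<sigma> u) (sb \<sigma> t)) (F (sb \<sigma> x) (sb \<sigma> y) (sb \<sigma> u) (sb \<sigma> t))
        (G (sb \<sigma> x) (sb \<sigma> y) (sb \<sigma> u) (sb \<sigma> t))"
      using ele_length[OF f(1)] ele_length[OF g(1)] by (simp add: Idc_subst w f g)
  qed
next
  fix \<Gamma> x t assume h: "wfc \<Gamma>" "ele \<Gamma> x x \<Phi>" "ele \<Gamma> t t (\<Theta> x x (rl x))"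
  have p: "pt \<Phi> \<Gamma> x x (rl x)" using pt_rl[OF \<Phi> h(1,2)] .
  then have w: "wfc (\<Omega> x x (rl x) t @ \<Gamma>)" using h \<Omega> unfolding fam2_def by blast
  have f: "ele \<Gamma> (F x x (rl x) t) (F x x (rl x) t) (\<Omega> x x (rl x) t)"
    and nat: "\<forall>\<sigma>. sb \<sigma> (F x x (rl x) t) = F (sb \<sigma> x) (sb \<sigma> x) (sb \<sigma> (rl x)) (sb \<sigma> t)"
    using p h F unfolding sec_def by blast+
  have "ele \<Gamma> (rl (F x x (rl x) t)) (rl (F x x (rl x) t)) (Idc (\<Omega> x x (rl x) t) (F x x (rl x) t) (G x x (rl x) t))"
    using ele_conv[OF Idc_cong[OF _ f FG[OF h]] rl_ele[OF w f]] w teq_refl by blast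
  with nat show "ele \<Gamma> (rl (F x x (rl x) t)) (rl (F x x (rl x) t))
      (Idc (\<Omega> x x (rl x) t) (F x x (rl x) t) (G x x (rl x) t)) \<and>
      (\<forall>\<sigma>. sb \<sigma> (rl (F x x (rl x) t)) = rl (F (sb \<sigma> x) (sb \<sigma> x) (rl (sb \<sigma> x)) (sb \<sigma> t)))"
    by simp
qed (use that in blast)

definition hty :: "'s ctx \<Rightarrow> 's tup \<Rightarrow> 's tup \<Rightarrow> bool" where
  "hty \<Omega> p q \<longleftrightarrow> (\<exists>h. ele [] h h (Idc \<Omega> p q))"

text \<open>The form used for the laws below: a law between closed paths is generalised to variable
  paths, and only its definitional validity at reflexivity remains to be checked.\<close>

lemma hty_elim:
  assumes "wfc \<Phi>" "fam \<Phi> \<Theta>" "fam2 \<Phi> \<Theta> \<Omega>" "sec \<Phi> \<Theta> \<Omega> F" "sec \<Phi> \<Theta> \<Omega> G"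
    and "\<And>\<Gamma> x t. wfc \<Gamma> \<Longrightarrow> ele \<Gamma> x x \<Phi> \<Longrightarrow> ele \<Gamma> t t (\<Theta> x x (rl x)) \<Longrightarrow>
      ele \<Gamma> (F x x (rl x) t) (G x x (rl x) t) (\<Omega> x x (rl x) t)"
    and "ele [] x x \<Phi>" "ele [] y y \<Phi>" "ele [] u u (Idc \<Phi> x y)" "ele [] t t (\<Theta> x y u)"
  shows "hty (\<Omega> x y u t) (F x y u t) (G x y u t)"
proof -
  have p: "pt \<Phi> [] x y u" using assms(7-9) by (simp add: pt_def)
  obtain H where "sec \<Phi> \<Theta> (\<lambda>x y u t. Idc (\<Omega> x y u t) (F x y u t) (G x y u t)) H"
    by (rule elim_hom[OF assms(1-5)]) (use assms(6) in blast)+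
  with p assms(10) show ?thesis unfolding hty_def sec_def by blast
qed

end

section \<open>Groupoid laws up to homotopy\<close>

text \<open>This is \<open>tup_comp\<close> written with \<open>cat\<close>. Points are morphisms
  out of the empty context, so it serves both as composition and as evaluation.\<close>

definition app :: "'s tup \<Rightarrow> 's tup \<Rightarrow> 's tup" where
  "app f x = sb (cat x Var) f"

lemma tup_comp_app: "tup_comp f x = app f x"
  by (simp add: tup_comp_def app_def tsub_cat)

lemma length_app [simp]: "length (app f x) = length f"
  by (simp add: app_def)

abbreviation nilf :: "'s tup \<Rightarrow> 's tup \<Rightarrow> 's tup \<Rightarrow> 's ctx" where
  "nilf \<equiv> \<lambda>x y u. []"

context type_theory
begin

lemma closed_ele_seg: "wfc \<Phi> \<Longrightarrow> wfc \<Gamma> \<Longrightarrow> ele (\<Phi> @ \<Gamma>) (seg 0 (length \<Phi>)) (seg 0 (length \<Phi>)) \<Phi>"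
  using ele_seg[of "[]" \<Phi> \<Gamma> 0 "length \<Phi>" "length \<Phi>"] closed_wf by (simp add: subst_tele_closed)

lemma Idc_closed_wf: "wfc \<Phi> \<Longrightarrow> wfc \<Gamma> \<Longrightarrow> ele \<Gamma> a a \<Phi> \<Longrightarrow> ele \<Gamma> b b \<Phi> \<Longrightarrow> wfc (Idc \<Phi> a b @ \<Gamma>)"
  using Idc_wf closed_wf by blast

lemma Idc_closed_subst: "wfc \<Phi> \<Longrightarrow> length a = length \<Phi> \<Longrightarrow> length b = length \<Phi> \<Longrightarrow>
    subst_tele \<sigma> (Idc \<Phi> a b) = Idc \<Phi> (sb \<sigma> a) (sb \<sigma> b)"
  by (simp add: Idc_subst subst_tele_closed)

text \<open>Composition of paths is transport in the family y |-> \<open>Idc \<Phi> a y\<close>.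
  Here that family is written with indices and evaluated.\<close>

lemma based_fam:
  assumes "wfc \<Phi>" "wfc \<Gamma>" "ele \<Gamma> a a \<Phi>"
  shows "wfc (Idc \<Phi> (sb (sh (length \<Phi>)) a) (seg 0 (length \<Phi>)) @ \<Phi> @ \<Gamma>)"
    "length b = length \<Phi> \<Longrightarrow>
      subst_tele (cat b Var) (Idc \<Phi> (sb (sh (length \<Phi>)) a) (seg 0 (length \<Phi>))) = Idc \<Phi> a b"
proof -
  have l: "length a = length \<Phi>" using assms(3) ele_length by blast
  have w: "wfc (\<Phi> @ \<Gamma>)" using closed_wf assms by blast
  have "ele (\<Phi> @ \<Gamma>) (sb (sh (length \<Phi>)) a) (sb (sh (length \<Phi>)) a) \<Phi>"
    using ele_subst[OF assms(3) sme_sh[OF w refl]] assms(1) by (simp add: subst_tele_closed)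
  then show "wfc (Idc \<Phi> (sb (sh (length \<Phi>)) a) (seg 0 (length \<Phi>)) @ \<Phi> @ \<Gamma>)"
    using Idc_closed_wf[OF assms(1) w] closed_ele_seg[OF assms(1,2)] by blast
  show "subst_tele (cat b Var) (Idc \<Phi> (sb (sh (length \<Phi>)) a) (seg 0 (length \<Phi>))) = Idc \<Phi> a b"
    if "length b = length \<Phi>"
    using that l assms(1) by (simp add: Idc_closed_subst cat_simps)
qed

lemma trs_ele:
  assumes "wfc \<Phi>" "wfc \<Gamma>" "ele \<Gamma> a a \<Phi>" "ele \<Gamma> b b' \<Phi>" "ele \<Gamma> c c' \<Phi>"
    "ele \<Gamma> p p' (Idc \<Phi> a b)" "ele \<Gamma> q q' (Idc \<Phi> b c)"
  shows "ele \<Gamma> (transport b c q p) (transport b' c' q' p') (Idc \<Phi> a c)"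
proof -
  have l: "length b = length \<Phi>" "length c = length \<Phi>"
    using ele_length[OF assms(4)] ele_length[OF assms(5)] by simp_all
  note B = based_fam[OF assms(1-3)]
  from transport_ele[OF B(1) assms(4,5,7), of p p'] assms(6) show ?thesis
    by (simp add: B(2) l)
qed

lemma trs_rl:
  assumes "wfc \<Phi>" "wfc \<Gamma>" "ele \<Gamma> a a \<Phi>" "ele \<Gamma> b b \<Phi>" "ele \<Gamma> p p (Idc \<Phi> a b)"
  shows "ele \<Gamma> (transport b b (rl b) p) p (Idc \<Phi> a b)"
proof -
  have l: "length b = length \<Phi>" using ele_length[OF assms(4)] by simp
  note B = based_fam[OF assms(1-3)]
  from transport_comp[OF B(1) assms(4), of p] assms(5) show ?thesis
    by (simp add: B(2) l)
qed

lemma ele_transC: "wfc \<Phi> \<Longrightarrow> ele [] s t \<Phi> \<Longrightarrow> ele [] t u \<Phi> \<Longrightarrow> ele [] s u \<Phi>"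
  using ele_trans[of \<Phi> "[]"] by simp

lemma ele_symC: "wfc \<Phi> \<Longrightarrow> ele [] s t \<Phi> \<Longrightarrow> ele [] t s \<Phi>"
  using ele_sym[of \<Phi> "[]"] by simp

lemma ele_refl2C: "wfc \<Phi> \<Longrightarrow> ele [] s t \<Phi> \<Longrightarrow> ele [] t t \<Phi>"
  using ele_refl2[of \<Phi> "[]"] by simp

lemma Idc_wfC: "wfc \<Phi> \<Longrightarrow> ele [] a a \<Phi> \<Longrightarrow> ele [] b b \<Phi> \<Longrightarrow> wfc (Idc \<Phi> a b)"
  using Idc_closed_wf[of \<Phi> "[]"] by simp

lemma Idc_congC: "wfc \<Phi> \<Longrightarrow> ele [] a a' \<Phi> \<Longrightarrow> ele [] b b' \<Phi> \<Longrightarrow> teq [] (Idc \<Phi> a b) (Idc \<Phi> a' b')"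
  using Idc_cong[of "[]" \<Phi> \<Phi>] teq_refl[of "[]" \<Phi>] by simp

lemma hty_refl: "wfc \<Omega> \<Longrightarrow> ele [] p q \<Omega> \<Longrightarrow> hty \<Omega> p q"
  using ele_conv[OF Idc_congC[OF _ ele_refl1] rl_ele[of \<Omega> "[]" p p]] ele_refl1
  unfolding hty_def by fastforce

lemma hty_conv: "teq [] \<Omega> \<Omega>' \<Longrightarrow> ele [] p p' \<Omega> \<Longrightarrow> ele [] q q' \<Omega> \<Longrightarrow> hty \<Omega> p q \<Longrightarrow> hty \<Omega>' p' q'"
  using ele_conv[OF Idc_cong] unfolding hty_def by blast

text \<open>Homotopies are paths in \<Omega>, so they are composed by the same transport as paths in
  \<Phi>.\<close>

lemma hty_trans: "wfc \<Omega> \<Longrightarrow> ele [] p p \<Omega> \<Longrightarrow> ele [] q q \<Omega> \<Longrightarrow> ele [] r r \<Omega> \<Longrightarrow> hty \<Omega> p q \<Longrightarrow> hty \<Omega> q r \<Longrightarrow> hty \<Omega> p r"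
  using trs_ele[of \<Omega> "[]" p q q r r] unfolding hty_def by fastforce

lemma ele_Nil [simp]: "ele \<Gamma> s t [] \<longleftrightarrow> s = [] \<and> t = []"
  by (cases s; cases t) auto

lemma nil_fam: "fam \<Phi> nilf"
  by (simp add: fam_def pt_def)

lemma fam_Idc:
  assumes "wfc \<Phi>" "wfc \<Omega>" "sec \<Phi> \<Theta> (\<lambda>x y u t. \<Omega>) F" "sec \<Phi> \<Theta> (\<lambda>x y u t. \<Omega>) G"
  shows "fam2 \<Phi> \<Theta> (\<lambda>x y u t. Idc \<Omega> (F x y u t) (G x y u t))"
  unfolding fam2_def
proof (intro allI impI conjI)
  fix \<Gamma> x y u t \<sigma> assume p: "pt \<Phi> \<Gamma> x y u" "ele \<Gamma> t t (\<Theta> x y u)"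
  have f: "ele \<Gamma> (F x y u t) (F x y u t) \<Omega>"
    "sb \<sigma> (F x y u t) = F (sb \<sigma> x) (sb \<sigma> y) (sb \<sigma> u) (sb \<sigma> t)"
    using p assms(3) unfolding sec_def by blast+
  have g: "ele \<Gamma> (G x y u t) (G x y u t) \<Omega>"
    "sb \<sigma> (G x y u t) = G (sb \<sigma> x) (sb \<sigma> y) (sb \<sigma> u) (sb \<sigma> t)"
    using p assms(4) unfolding sec_def by blast+
  show "wfc (Idc \<Omega> (F x y u t) (G x y u t) @ \<Gamma>)"
    using Idc_closed_wf assms(2) p(1) f(1) g(1) unfolding pt_def by blast
  show "subst_tele \<sigma> (Idc \<Omega> (F x y u t) (G x y u t)) =
      Idc \<Omega> (F (sb \<sigma> x) (sb \<sigma> y) (sb \<sigma> u) (sb \<sigma> t)) (G (sb \<sigma> x) (sb \<sigma> y) (sb \<sigma> u) (sb \<sigma> t))"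
    using ele_length[OF f(1)] ele_length[OF g(1)] assms(2) by (simp add: Idc_closed_subst f g)
qed

text \<open>Generators for sections. Together with the closure rules for reflexivity, composition,
  \<open>app\<close> and \<open>ap\<close>, they type the compound terms below and show them natural
  at the same time.\<close>

lemma sec_x: "sec \<Phi> \<Theta> (\<lambda>x y u t. \<Phi>) (\<lambda>x y u t. x)"
  and sec_y: "sec \<Phi> \<Theta> (\<lambda>x y u t. \<Phi>) (\<lambda>x y u t. y)"
  and sec_u: "sec \<Phi> \<Theta> (\<lambda>x y u t. Idc \<Phi> x y) (\<lambda>x y u t. u)"
  and sec_t: "sec \<Phi> \<Theta> (\<lambda>x y u t. \<Theta> x y u) (\<lambda>x y u t. t)"
  by (simp_all add: sec_def pt_def)

lemma sec_const: "ele [] a a \<Omega> \<Longrightarrow> sec \<Phi> \<Theta> (\<lambda>x y u t. \<Omega>) (\<lambda>x y u t. a)"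
  using ele_weaken ele_closed by (simp add: sec_def pt_def)

lemma sec_rl:
  assumes "wfc \<Omega>" "sec \<Phi> \<Theta> (\<lambda>x y u t. \<Omega>) F"
  shows "sec \<Phi> \<Theta> (\<lambda>x y u t. Idc \<Omega> (F x y u t) (F x y u t)) (\<lambda>x y u t. rl (F x y u t))"
  using assms rl_ele closed_wf unfolding sec_def pt_def by (metis sb_rl)

lemma sec_trs:
  assumes "wfc \<Omega>" "sec \<Phi> \<Theta> (\<lambda>x y u t. \<Omega>) A" "sec \<Phi> \<Theta> (\<lambda>x y u t. \<Omega>) B" "sec \<Phi> \<Theta> (\<lambda>x y u t. \<Omega>) C"
    "sec \<Phi> \<Theta> (\<lambda>x y u t. Idc \<Omega> (A x y u t) (B x y u t)) P"
    "sec \<Phi> \<Theta> (\<lambda>x y u t. Idc \<Omega> (B x y u t) (C x y u t)) Q"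
  shows "sec \<Phi> \<Theta> (\<lambda>x y u t. Idc \<Omega> (A x y u t) (C x y u t))
    (\<lambda>x y u t. transport (B x y u t) (C x y u t) (Q x y u t) (P x y u t))"
  unfolding sec_def
proof (intro allI impI conjI)
  fix \<Gamma> x y u t \<sigma> assume p: "pt \<Phi> \<Gamma> x y u" "ele \<Gamma> t t (\<Theta> x y u)"
  have a: "ele \<Gamma> (A x y u t) (A x y u t) \<Omega>" using p assms(2) unfolding sec_def by blast
  have b: "ele \<Gamma> (B x y u t) (B x y u t) \<Omega>"
    "sb \<sigma> (B x y u t) = B (sb \<sigma> x) (sb \<sigma> y) (sb \<sigma> u) (sb \<sigma> t)"
    using p assms(3) unfolding sec_def by blast+
  have c: "ele \<Gamma> (C x y u t) (C x y u t) \<Omega>"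
    "sb \<sigma> (C x y u t) = C (sb \<sigma> x) (sb \<sigma> y) (sb \<sigma> u) (sb \<sigma> t)"
    using p assms(4) unfolding sec_def by blast+
  have pp: "ele \<Gamma> (P x y u t) (P x y u t) (Idc \<Omega> (A x y u t) (B x y u t))"
    "sb \<sigma> (P x y u t) = P (sb \<sigma> x) (sb \<sigma> y) (sb \<sigma> u) (sb \<sigma> t)"
    using p assms(5) unfolding sec_def by blast+
  have q: "ele \<Gamma> (Q x y u t) (Q x y u t) (Idc \<Omega> (B x y u t) (C x y u t))"
    "sb \<sigma> (Q x y u t) = Q (sb \<sigma> x) (sb \<sigma> y) (sb \<sigma> u) (sb \<sigma> t)"
    using p assms(6) unfolding sec_def by blast+
  show "ele \<Gamma> (transport (B x y u t) (C x y u t) (Q x y u t) (P x y u t))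
      (transport (B x y u t) (C x y u t) (Q x y u t) (P x y u t)) (Idc \<Omega> (A x y u t) (C x y u t))"
    using trs_ele[OF assms(1) _ a b(1) c(1) pp(1) q(1)] p(1) by (simp add: pt_def)
  show "sb \<sigma> (transport (B x y u t) (C x y u t) (Q x y u t) (P x y u t)) =
    transport (B (sb \<sigma> x) (sb \<sigma> y) (sb \<sigma> u) (sb \<sigma> t)) (C (sb \<sigma> x) (sb \<sigma> y) (sb \<sigma> u) (sb \<sigma> t))
      (Q (sb \<sigma> x) (sb \<sigma> y) (sb \<sigma> u) (sb \<sigma> t)) (P (sb \<sigma> x) (sb \<sigma> y) (sb \<sigma> u) (sb \<sigma> t))"
    using ele_length[OF b(1)] ele_length[OF c(1)] ele_Idc_length[OF b(1) c(1) q(1)]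
    by (simp add: transport_subst b c pp q)
qed

text \<open>Eliminating the homotopy, with reflexivity at F as method, gives a path between the
  values of F. Naturality is what allows F to be regarded as a section.\<close>

lemma hty_map:
  assumes "wfc \<Xi>" "wfc \<Omega>"
    and F: "\<And>\<Gamma> p. wfc \<Gamma> \<Longrightarrow> ele \<Gamma> p p \<Xi> \<Longrightarrow> ele \<Gamma> (F p) (F p) \<Omega> \<and> (\<forall>\<sigma>. sb \<sigma> (F p) = F (sb \<sigma> p))"
    and p: "ele [] p p \<Xi>" "ele [] q q \<Xi>" "hty \<Xi> p q"
  shows "hty \<Omega> (F p) (F q)"
proof -
  have s: "sec \<Xi> nilf (\<lambda>x y u t. \<Omega>) (\<lambda>x y u t. F x)" "sec \<Xi> nilf (\<lambda>x y u t. \<Omega>) (\<lambda>x y u t. F y)"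
    using F unfolding sec_def pt_def by blast+
  obtain K where K: "sec \<Xi> nilf (\<lambda>x y u t. Idc \<Omega> (F x) (F y)) K"
  proof (rule elim[OF assms(1) nil_fam fam_Idc[OF assms(1,2) s], of "\<lambda>x t. rl (F x)"])
    fix \<Gamma> x t assume "wfc \<Gamma>" "ele \<Gamma> x x \<Xi>"
    then show "ele \<Gamma> (rl (F x)) (rl (F x)) (Idc \<Omega> (F x) (F x)) \<and> (\<forall>\<sigma>. sb \<sigma> (rl (F x)) = rl (F (sb \<sigma> x)))"
      using F rl_ele closed_wf[OF assms(2)] by simp
  qed blast
  from p(3) obtain h where "ele [] h h (Idc \<Xi> p q)" unfolding hty_def by blast
  with p K have "ele [] (K p q h []) (K p q h []) (Idc \<Omega> (F p) (F q))"
    unfolding sec_def pt_def by simp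
  then show ?thesis unfolding hty_def by blast
qed

lemma inv_ex:
  assumes "wfc \<Phi>"
  obtains I where "sec \<Phi> nilf (\<lambda>x y u t. Idc \<Phi> y x) I"
    "\<And>\<Gamma> x. wfc \<Gamma> \<Longrightarrow> ele \<Gamma> x x \<Phi> \<Longrightarrow> ele \<Gamma> (I x x (rl x) []) (rl x) (Idc \<Phi> x x)"
proof (rule elim[OF assms nil_fam fam_Idc[OF assms assms sec_y sec_x], of "\<lambda>x t. rl x"])
  show "ele \<Gamma> (rl x) (rl x) (Idc \<Phi> x x) \<and> (\<forall>\<sigma>. sb \<sigma> (rl x) = rl (sb \<sigma> x))"
    if "wfc \<Gamma>" "ele \<Gamma> x x \<Phi>" for \<Gamma> x
    using that rl_ele closed_wf[OF assms] by simp
qed (use that in simp)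

lemma hty_sym:
  assumes "wfc \<Omega>" "ele [] p p \<Omega>" "ele [] q q \<Omega>" "hty \<Omega> p q"
  shows "hty \<Omega> q p"
proof -
  obtain I where I: "sec \<Omega> nilf (\<lambda>x y u t. Idc \<Omega> y x) I" using inv_ex[OF assms(1)] by metis
  from assms(4) obtain h where "ele [] h h (Idc \<Omega> p q)" unfolding hty_def by blast
  with assms I have "ele [] (I p q h []) (I p q h []) (Idc \<Omega> q p)"
    unfolding sec_def pt_def by simp
  then show ?thesis unfolding hty_def by blast
qed

text \<open>The other unit law, \<open>trs_rl\<close>, is an instance of computation. Here the
  variable path sits in the eliminated position, so the law holds only up to homotopy.\<close>

lemma trs_unit:
  assumes "wfc \<Phi>" "ele [] a a \<Phi>" "ele [] b b \<Phi>" "ele [] p p (Idc \<Phi> a b)"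
  shows "hty (Idc \<Phi> a b) (transport a b p (rl a)) p"
proof (rule hty_elim[OF assms(1) nil_fam, of "\<lambda>x y u t. Idc \<Phi> x y" "\<lambda>x y u t. transport x y u (rl x)"
    "\<lambda>x y u t. u" a b p "[]"])
  show "sec \<Phi> nilf (\<lambda>x y u t. Idc \<Phi> x y) (\<lambda>x y u t. transport x y u (rl x))"
    by (intro sec_trs[where A = "\<lambda>x y u t. x"] sec_rl sec_x sec_y sec_u assms)
  show "fam2 \<Phi> nilf (\<lambda>x y u t. Idc \<Phi> x y)"
    by (intro fam_Idc sec_x sec_y assms)
  show "ele \<Gamma> (transport x x (rl x) (rl x)) (rl x) (Idc \<Phi> x x)"
    if "wfc \<Gamma>" "ele \<Gamma> x x \<Phi>" for \<Gamma> x
    using trs_rl[OF assms(1) that(1) that(2,2) rl_ele[OF closed_wf[OF assms(1) that(1)] that(2)]] .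
qed (use assms sec_u in auto)

text \<open>Elimination is on the last path s, from x to y. The path q has to end at the varying
  point x, so it becomes the parameter; p is unaffected and stays constant.\<close>

lemma trs_assoc:
  assumes "wfc \<Phi>" "ele [] a a \<Phi>" "ele [] b b \<Phi>" "ele [] c c \<Phi>" "ele [] d d \<Phi>"
    and p: "ele [] p p (Idc \<Phi> a b)" and q: "ele [] q q (Idc \<Phi> b c)" and s: "ele [] s s (Idc \<Phi> c d)"
  shows "hty (Idc \<Phi> a d) (transport c d s (transport b c q p)) (transport b d (transport c d s q) p)"
proof (rule hty_elim[OF assms(1), of "\<lambda>x y u. Idc \<Phi> b x" "\<lambda>x y u t. Idc \<Phi> a y"
    "\<lambda>x y u t. transport x y u (transport b x t p)" "\<lambda>x y u t. transport b y (transport x y u t) p" c d s q])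
  note sc = sec_const[OF assms(2)] sec_const[OF assms(3)] sec_const[OF p] sec_x sec_y sec_u
  let ?\<Theta> = "\<lambda>x y u. Idc \<Phi> b x"
  have t: "sec \<Phi> ?\<Theta> (\<lambda>x y u t. Idc \<Phi> b x) (\<lambda>x y u t. t)" using sec_t[of \<Phi> ?\<Theta>] .
  have pc: "sec \<Phi> ?\<Theta> (\<lambda>x y u t. Idc \<Phi> a b) (\<lambda>x y u t. p)" by (rule sec_const[OF p])
  show "sec \<Phi> ?\<Theta> (\<lambda>x y u t. Idc \<Phi> a y) (\<lambda>x y u t. transport x y u (transport b x t p))"
    by (rule sec_trs[OF assms(1) sc(1) sec_x sec_y sec_trs[OF assms(1) sc(1,2) sec_x pc t] sec_u])
  show "sec \<Phi> ?\<Theta> (\<lambda>x y u t. Idc \<Phi> a y) (\<lambda>x y u t. transport b y (transport x y u t) p)"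
    by (rule sec_trs[OF assms(1) sc(1,2) sec_y pc sec_trs[OF assms(1) sc(2) sec_x sec_y t sec_u]])
  show "fam \<Phi> ?\<Theta>"
    using fam_Idc[OF assms(1,1) sec_const[OF assms(3)] sec_x, of nilf] by (simp add: fam_def fam2_def)
  show "fam2 \<Phi> ?\<Theta> (\<lambda>x y u t. Idc \<Phi> a y)"
    by (rule fam_Idc[OF assms(1,1) sc(1) sec_y])
  show "ele \<Gamma> (transport x x (rl x) (transport b x t p)) (transport b x (transport x x (rl x) t) p) (Idc \<Phi> a x)"
    if \<Gamma>: "wfc \<Gamma>" and x: "ele \<Gamma> x x \<Phi>" and t: "ele \<Gamma> t t (Idc \<Phi> b x)" for \<Gamma> x t
  proof -
    note w = ele_weaken[OF assms(2) \<Gamma>] ele_weaken[OF assms(3) \<Gamma>] ele_weaken[OF p \<Gamma>]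
    have 1: "ele \<Gamma> (transport b x t p) (transport b x t p) (Idc \<Phi> a x)"
      by (rule trs_ele[OF assms(1) \<Gamma> w(1,2) x w(3) t])
    \<comment> \<open>For s reflexivity both sides reduce definitionally to the composite of p with
      the parameter.\<close>
    have 2: "ele \<Gamma> (transport x x (rl x) (transport b x t p)) (transport b x t p) (Idc \<Phi> a x)"
      by (rule trs_rl[OF assms(1) \<Gamma> w(1) x 1])
    have 3: "ele \<Gamma> (transport b x (transport x x (rl x) t) p) (transport b x t p) (Idc \<Phi> a x)"
      by (rule trs_ele[OF assms(1) \<Gamma> w(1,2) x w(3) trs_rl[OF assms(1) \<Gamma> w(2) x t]])
    have wf: "wfc (Idc \<Phi> a x @ \<Gamma>)" by (rule Idc_closed_wf[OF assms(1) \<Gamma> w(1) x])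
    show ?thesis by (rule ele_trans[OF wf 2 ele_sym[OF wf 3]])
  qed
qed (use assms in auto)

text \<open>The inverse also comes from elimination, and all that is known about its value is that
  it computes at reflexivity. That suffices, since both laws are checked there only.\<close>

lemma trs_inv:
  assumes "wfc \<Phi>" "ele [] a a \<Phi>" "ele [] b b \<Phi>" "ele [] p p (Idc \<Phi> a b)"
  obtains q where "ele [] q q (Idc \<Phi> b a)" "hty (Idc \<Phi> a a) (transport b a q p) (rl a)"
    "hty (Idc \<Phi> b b) (transport a b p q) (rl b)"
proof -
  obtain I where I: "sec \<Phi> nilf (\<lambda>x y u t. Idc \<Phi> y x) I"
    "\<And>\<Gamma> x. wfc \<Gamma> \<Longrightarrow> ele \<Gamma> x x \<Phi> \<Longrightarrow> ele \<Gamma> (I x x (rl x) []) (rl x) (Idc \<Phi> x x)"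
    using inv_ex[OF assms(1)] by metis
  have I0: "sec \<Phi> nilf (\<lambda>x y u t. Idc \<Phi> y x) (\<lambda>x y u t. I x y u [])"
    using I(1) by (auto simp: sec_def)
  have diag: "ele \<Gamma> (transport x x (I x x (rl x) []) (rl x)) (rl x) (Idc \<Phi> x x)"
    "ele \<Gamma> (transport x x (rl x) (I x x (rl x) [])) (rl x) (Idc \<Phi> x x)"
    if \<Gamma>: "wfc \<Gamma>" and x: "ele \<Gamma> x x \<Phi>" for \<Gamma> x
  proof -
    have r: "ele \<Gamma> (rl x) (rl x) (Idc \<Phi> x x)" using rl_ele[OF closed_wf[OF assms(1) \<Gamma>] x] .
    have wf: "wfc (Idc \<Phi> x x @ \<Gamma>)" by (rule Idc_closed_wf[OF assms(1) \<Gamma> x x])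
    note rr = trs_rl[OF assms(1) \<Gamma> x x r]
    show "ele \<Gamma> (transport x x (I x x (rl x) []) (rl x)) (rl x) (Idc \<Phi> x x)"
      by (rule ele_trans[OF wf trs_ele[OF assms(1) \<Gamma> x x x r I(2)[OF \<Gamma> x]] rr])
    show "ele \<Gamma> (transport x x (rl x) (I x x (rl x) [])) (rl x) (Idc \<Phi> x x)"
      by (rule ele_trans[OF wf trs_ele[OF assms(1) \<Gamma> x x x I(2)[OF \<Gamma> x] r] rr])
  qed
  have 1: "hty (Idc \<Phi> a a) (transport b a (I a b p []) p) (rl a)"
    by (rule hty_elim[OF assms(1) nil_fam fam_Idc[OF assms(1,1) sec_x sec_x]
          sec_trs[OF assms(1) sec_x sec_y sec_x sec_u I0] sec_rl[OF assms(1) sec_x] diag(1) assms(2-4), of "[]"]) simp_all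
  have 2: "hty (Idc \<Phi> b b) (transport a b p (I a b p [])) (rl b)"
    by (rule hty_elim[OF assms(1) nil_fam fam_Idc[OF assms(1,1) sec_y sec_y]
          sec_trs[OF assms(1) sec_y sec_x sec_y I0 sec_u] sec_rl[OF assms(1) sec_y] diag(2) assms(2-4), of "[]"]) simp_all
  have "ele [] (I a b p []) (I a b p []) (Idc \<Phi> b a)"
    using I(1) assms unfolding sec_def pt_def by simp
  with 1 2 show thesis using that by blast
qed

text \<open>One factor is changed at a time, because \<open>hty_map\<close> treats operations in a
  single variable.\<close>

lemma trs_hty:
  assumes \<Phi>: "wfc \<Phi>" and a: "ele [] a a \<Phi>" and b: "ele [] b b \<Phi>" and c: "ele [] c c \<Phi>"
    and p: "ele [] p p (Idc \<Phi> a b)" "ele [] p' p' (Idc \<Phi> a b)" "hty (Idc \<Phi> a b) p p'"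
    and q: "ele [] q q (Idc \<Phi> b c)" "ele [] q' q' (Idc \<Phi> b c)" "hty (Idc \<Phi> b c) q q'"
  shows "hty (Idc \<Phi> a c) (transport b c q p) (transport b c q' p')"
proof -
  note wf = Idc_wfC[OF \<Phi> a b] Idc_wfC[OF \<Phi> b c] Idc_wfC[OF \<Phi> a c]
  have l: "length b = length \<Phi>" "length c = length \<Phi>" using ele_length[OF b] ele_length[OF c] by simp_all
  have nil: "wfc []" by simp
  have 1: "hty (Idc \<Phi> a c) (transport b c q p) (transport b c q p')"
  proof (rule hty_map[OF wf(1,3) _ p])
    fix \<Gamma> r assume \<Gamma>: "wfc \<Gamma>" and r: "ele \<Gamma> r r (Idc \<Phi> a b)"
    have "ele \<Gamma> (transport b c q r) (transport b c q r) (Idc \<Phi> a c)"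
      by (rule trs_ele[OF \<Phi> \<Gamma> ele_weaken[OF a \<Gamma>] ele_weaken[OF b \<Gamma>] ele_weaken[OF c \<Gamma>] r ele_weaken[OF q(1) \<Gamma>]])
    then show "ele \<Gamma> (transport b c q r) (transport b c q r) (Idc \<Phi> a c) \<and>
       (\<forall>\<sigma>. sb \<sigma> (transport b c q r) = transport b c q (sb \<sigma> r))"
      using ele_closed[OF b] ele_closed[OF c] ele_closed[OF q(1)] ele_Idc_length[OF b c q(1)] l
      by (simp add: transport_subst)
  qed
  have 2: "hty (Idc \<Phi> a c) (transport b c q p') (transport b c q' p')"
  proof (rule hty_map[OF wf(2,3) _ q, of "\<lambda>q. transport b c q p'"])
    fix \<Gamma> r assume \<Gamma>: "wfc \<Gamma>" and r: "ele \<Gamma> r r (Idc \<Phi> b c)"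
    have "ele \<Gamma> (transport b c r p') (transport b c r p') (Idc \<Phi> a c)"
      by (rule trs_ele[OF \<Phi> \<Gamma> ele_weaken[OF a \<Gamma>] ele_weaken[OF b \<Gamma>] ele_weaken[OF c \<Gamma>] ele_weaken[OF p(2) \<Gamma>] r])
    then show "ele \<Gamma> (transport b c r p') (transport b c r p') (Idc \<Phi> a c) \<and>
       (\<forall>\<sigma>. sb \<sigma> (transport b c r p') = transport b c (sb \<sigma> r) p')"
      using ele_closed[OF b] ele_closed[OF c] ele_closed[OF p(2)]
        ele_Idc_length[OF ele_weaken[OF b \<Gamma>] ele_weaken[OF c \<Gamma>] r] l
      by (simp add: transport_subst)
  qed
  show ?thesis
    by (rule hty_trans[OF wf(3) _ _ _ 1 2]) (rule trs_ele[OF \<Phi> nil a b c]; fact)+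
qed

section \<open>Functoriality up to homotopy\<close>


lemma app_ele_dep:
  assumes "wfc \<Phi>" "wfc \<Gamma>" "ele \<Phi> f f' \<Omega>" "ele \<Gamma> x x' \<Phi>"
  shows "ele \<Gamma> (app f x) (app f' x') (subst_tele (cat x Var) \<Omega>)"
  using ele_subst[OF assms(3) sme_closed_cat[OF assms(1,2,4)]] by (simp add: app_def)

lemma app_ele:
  assumes "wfc \<Phi>" "wfc \<Psi>" "wfc \<Gamma>" "ele \<Phi> f f' \<Psi>" "ele \<Gamma> x x' \<Phi>"
  shows "ele \<Gamma> (app f x) (app f' x') \<Psi>"
  using app_ele_dep[OF assms(1,3,4,5)] assms(2) by (simp add: subst_tele_closed)

text \<open>The tuple f refers only to the variables of \<Phi>, all of which x replaces, so \<sigma>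
  reaches it only through x.\<close>

lemma app_subst:
  assumes "ele \<Phi> f f' \<Omega>" "length x = length \<Phi>"
  shows "sb \<sigma> (app f x) = app f (sb \<sigma> x)"
proof -
  have "sb (cat (sb \<sigma> x) \<sigma>) f = sb (cat (sb \<sigma> x) Var) f"
    using assms(2) by (intro ele_scoped[OF assms(1)]) (auto simp: cat_def)
  then show ?thesis by (simp add: app_def)
qed

lemma app_vars:
  assumes "ele \<Phi> f f' \<Omega>"
  shows "app f (seg 0 (length \<Phi>)) = f"
proof -
  have "sb (cat (seg 0 (length \<Phi>)) Var) f = sb Var f"
    by (intro ele_scoped[OF assms(1)]) (auto simp: cat_def)
  then show ?thesis by (simp add: app_def)
qed

lemma app_app:
  assumes "ele \<Psi> g g' \<Omega>" "length f = length \<Psi>"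
  shows "app g (app f x) = app (app g f) x"
proof -
  have "sb (cat (app f x) Var) g = sb (cat (sb (cat x Var) f) (cat x Var)) g"
    using assms(2) by (intro ele_scoped[OF assms(1)]) (auto simp: cat_def app_def)
  then show ?thesis by (simp add: app_def)
qed

text \<open>The premises for \<open>ap\<close> as elimination without parameters: the motive
  consists of the paths from f(x) to f(y), and on the diagonal it becomes the type of reflexivity at
  f.\<close>

lemma ap_aux:
  assumes \<Phi>: "wfc \<Phi>" and \<Psi>: "wfc \<Psi>" and f: "ele \<Phi> f f \<Psi>" and n: "length \<Phi> = n"
  shows "wfc (Idc \<Psi> (app f (seg (n + n) n)) (app f (seg n n)) @ [] @ idt \<Phi> @ [])"
    "ele (subst_tele (diagc n) [] @ \<Phi> @ []) (rl f) (rl f)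
      (subst_tele (ups 0 (diagc n)) (Idc \<Psi> (app f (seg (n + n) n)) (app f (seg n n))))"
proof -
  have G: "wfc (idt \<Phi>)" using idt_wf[OF _ refl, of \<Phi> "[]"] Idc_rules[of "length \<Phi>"] \<Phi> by simp
  have x: "ele (idt \<Phi>) (seg (n + n) n) (seg (n + n) n) \<Phi>" "ele (idt \<Phi>) (seg n n) (seg n n) \<Phi>"
    using idt_ele[of "[]" \<Phi> "[]" n 0] G \<Phi> n by (simp_all add: subst_tele_closed)
  show "wfc (Idc \<Psi> (app f (seg (n + n) n)) (app f (seg n n)) @ [] @ idt \<Phi> @ [])"
    using Idc_closed_wf[OF \<Psi> G app_ele[OF \<Phi> \<Psi> G f x(1)] app_ele[OF \<Phi> \<Psi> G f x(2)]] by simp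
  have "subst_tele (diagc n) (Idc \<Psi> (app f (seg (n + n) n)) (app f (seg n n))) = Idc \<Psi> f f"
    using ele_length[OF f] n app_vars[OF f] \<Psi>
    by (simp add: Idc_closed_subst app_subst[OF f]) (simp add: diagc_def cat_simps)
  then show "ele (subst_tele (diagc n) [] @ \<Phi> @ []) (rl f) (rl f)
      (subst_tele (ups 0 (diagc n)) (Idc \<Psi> (app f (seg (n + n) n)) (app f (seg n n))))"
    using rl_ele[OF closed_wf[OF \<Psi> \<Phi>] f] by simp
qed

lemma ap_ele:
  assumes \<Phi>: "wfc \<Phi>" and \<Psi>: "wfc \<Psi>" and f: "ele \<Phi> f f \<Psi>" and \<Gamma>: "wfc \<Gamma>"
    and e: "ele \<Gamma> x x' \<Phi>" "ele \<Gamma> y y' \<Phi>" "ele \<Gamma> u u' (Idc \<Phi> x y)"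
  shows "ele \<Gamma> (ap f x y u) (ap f x' y' u') (Idc \<Psi> (app f x) (app f y))"
proof -
  define n where "n = length \<Phi>"
  have l: "length x = n" "length y = n" "length u = n"
    using ele_length[OF e(1)] ele_length[OF e(2)] ele_Idc_length[OF e] by (simp_all add: n_def)
  note A = ap_aux[OF \<Phi> \<Psi> f n_def[symmetric]]
  have "subst_tele (cat ([] @ u @ y @ x) Var) (Idc \<Psi> (app f (seg (n + n) n)) (app f (seg n n))) = Idc \<Psi> (app f x) (app f y)"
    using ele_length[OF f] l \<Psi>
    by (simp add: Idc_closed_subst app_subst[OF f] n_def[symmetric] cat_simps)
  with JJ_stage(1)[OF A(1) n_def[symmetric] _ A(2) sme_Nil[OF \<Gamma>, of Var Var], of x x' y y' u u' "[]" "[]"] e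
  show ?thesis by (simp add: ap_JJ)
qed

lemma ap_rl:
  assumes \<Phi>: "wfc \<Phi>" and \<Psi>: "wfc \<Psi>" and f: "ele \<Phi> f f \<Psi>" and \<Gamma>: "wfc \<Gamma>" and x: "ele \<Gamma> x x \<Phi>"
  shows "ele \<Gamma> (ap f x x (rl x)) (rl (app f x)) (Idc \<Psi> (app f x) (app f x))"
proof -
  define n where "n = length \<Phi>"
  have l: "length x = n" using ele_length[OF x] by (simp_all add: n_def)
  note A = ap_aux[OF \<Phi> \<Psi> f n_def[symmetric]]
  have "subst_tele (cat ([] @ rl x @ x @ x) Var) (Idc \<Psi> (app f (seg (n + n) n)) (app f (seg n n))) = Idc \<Psi> (app f x) (app f x)"
    using ele_length[OF f] l \<Psi>
    by (simp add: Idc_closed_subst app_subst[OF f] n_def[symmetric] cat_simps)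
  with JJ_stage(2)[OF A(1) n_def[symmetric] _ A(2) sme_Nil[OF \<Gamma>, of Var Var], of x "[]"] x
  show ?thesis by (simp add: ap_JJ app_def)
qed

lemma ap_subst:
  assumes f: "ele \<Phi> f f \<Psi>" and l: "length x = length \<Phi>" "length y = length \<Phi>" "length u = length \<Phi>"
  shows "sb \<sigma> (ap f x y u) = ap f (sb \<sigma> x) (sb \<sigma> y) (sb \<sigma> u)"
proof -
  have "sb (ups (length \<Phi>) \<sigma>) f = sb Var f"
    by (rule ele_scoped[OF f]) (simp add: ups_def)
  then show ?thesis using l by (simp add: ap_JJ JJ_subst[of _ "length \<Phi>"])
qed

lemma sec_app_dep:
  assumes "wfc \<Phi>" "ele \<Phi> f f \<Omega>" "wfc (\<Omega> @ \<Phi>)" "sec \<Xi> \<Theta> (\<lambda>x y u t. \<Phi>) A"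
  shows "sec \<Xi> \<Theta> (\<lambda>x y u t. subst_tele (cat (A x y u t) Var) \<Omega>) (\<lambda>x y u t. app f (A x y u t))"
  unfolding sec_def
proof (intro allI impI conjI)
  fix \<Gamma> x y u t \<sigma> assume p: "pt \<Xi> \<Gamma> x y u" "ele \<Gamma> t t (\<Theta> x y u)"
  have a: "ele \<Gamma> (A x y u t) (A x y u t) \<Phi>"
    "sb \<sigma> (A x y u t) = A (sb \<sigma> x) (sb \<sigma> y) (sb \<sigma> u) (sb \<sigma> t)"
    using p assms(4) unfolding sec_def by blast+
  show "ele \<Gamma> (app f (A x y u t)) (app f (A x y u t)) (subst_tele (cat (A x y u t) Var) \<Omega>)"
    using app_ele_dep[OF assms(1) _ assms(2) a(1)] p(1) by (simp add: pt_def)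
  show "sb \<sigma> (app f (A x y u t)) = app f (A (sb \<sigma> x) (sb \<sigma> y) (sb \<sigma> u) (sb \<sigma> t))"
    using app_subst[OF assms(2)] ele_length[OF a(1)] a(2) by simp
qed

lemma sec_app:
  assumes "wfc \<Phi>" "wfc \<Psi>" "ele \<Phi> f f \<Psi>" "sec \<Xi> \<Theta> (\<lambda>x y u t. \<Phi>) A"
  shows "sec \<Xi> \<Theta> (\<lambda>x y u t. \<Psi>) (\<lambda>x y u t. app f (A x y u t))"
  using sec_app_dep[OF assms(1,3) closed_wf[OF assms(2,1)] assms(4)] assms(2) by (simp add: subst_tele_closed)

lemma sec_ap:
  assumes "wfc \<Phi>" "wfc \<Psi>" "ele \<Phi> f f \<Psi>" "sec \<Xi> \<Theta> (\<lambda>x y u t. \<Phi>) A" "sec \<Xi> \<Theta> (\<lambda>x y u t. \<Phi>) B"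
    "sec \<Xi> \<Theta> (\<lambda>x y u t. Idc \<Phi> (A x y u t) (B x y u t)) P"
  shows "sec \<Xi> \<Theta> (\<lambda>x y u t. Idc \<Psi> (app f (A x y u t)) (app f (B x y u t)))
    (\<lambda>x y u t. ap f (A x y u t) (B x y u t) (P x y u t))"
  unfolding sec_def
proof (intro allI impI conjI)
  fix \<Gamma> x y u t \<sigma> assume p: "pt \<Xi> \<Gamma> x y u" "ele \<Gamma> t t (\<Theta> x y u)"
  have a: "ele \<Gamma> (A x y u t) (A x y u t) \<Phi>"
    "sb \<sigma> (A x y u t) = A (sb \<sigma> x) (sb \<sigma> y) (sb \<sigma> u) (sb \<sigma> t)"
    using p assms(4) unfolding sec_def by blast+
  have b: "ele \<Gamma> (B x y u t) (B x y u t) \<Phi>"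
    "sb \<sigma> (B x y u t) = B (sb \<sigma> x) (sb \<sigma> y) (sb \<sigma> u) (sb \<sigma> t)"
    using p assms(5) unfolding sec_def by blast+
  have c: "ele \<Gamma> (P x y u t) (P x y u t) (Idc \<Phi> (A x y u t) (B x y u t))"
    "sb \<sigma> (P x y u t) = P (sb \<sigma> x) (sb \<sigma> y) (sb \<sigma> u) (sb \<sigma> t)"
    using p assms(6) unfolding sec_def by blast+
  show "ele \<Gamma> (ap f (A x y u t) (B x y u t) (P x y u t)) (ap f (A x y u t) (B x y u t) (P x y u t))
      (Idc \<Psi> (app f (A x y u t)) (app f (B x y u t)))"
    using ap_ele[OF assms(1-3) _ a(1) b(1) c(1)] p(1) by (simp add: pt_def)
  show "sb \<sigma> (ap f (A x y u t) (B x y u t) (P x y u t)) =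
    ap f (A (sb \<sigma> x) (sb \<sigma> y) (sb \<sigma> u) (sb \<sigma> t)) (B (sb \<sigma> x) (sb \<sigma> y) (sb \<sigma> u) (sb \<sigma> t))
      (P (sb \<sigma> x) (sb \<sigma> y) (sb \<sigma> u) (sb \<sigma> t))"
    using ap_subst[OF assms(3)] ele_length[OF a(1)] ele_length[OF b(1)] ele_Idc_length[OF a(1) b(1) c(1)] a(2) b(2) c(2)
    by simp
qed

lemma ap_hty:
  assumes \<Phi>: "wfc \<Phi>" and \<Psi>: "wfc \<Psi>" and f: "ele \<Phi> f f \<Psi>" and a: "ele [] a a \<Phi>" and b: "ele [] b b \<Phi>"
    and p: "ele [] p p (Idc \<Phi> a b)" "ele [] p' p' (Idc \<Phi> a b)" "hty (Idc \<Phi> a b) p p'"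
  shows "hty (Idc \<Psi> (app f a) (app f b)) (ap f a b p) (ap f a b p')"
proof (rule hty_map[OF Idc_wfC[OF \<Phi> a b] _ _ p])
  have nil: "wfc []" by simp
  show "wfc (Idc \<Psi> (app f a) (app f b))"
    by (rule Idc_wfC[OF \<Psi> app_ele[OF \<Phi> \<Psi> nil f a] app_ele[OF \<Phi> \<Psi> nil f b]])
  fix \<Gamma> r assume \<Gamma>: "wfc \<Gamma>" and r: "ele \<Gamma> r r (Idc \<Phi> a b)"
  note w = ele_weaken[OF a \<Gamma>] ele_weaken[OF b \<Gamma>]
  show "ele \<Gamma> (ap f a b r) (ap f a b r) (Idc \<Psi> (app f a) (app f b)) \<and> (\<forall>\<sigma>. sb \<sigma> (ap f a b r) = ap f a b (sb \<sigma> r))"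
    using ap_ele[OF \<Phi> \<Psi> f \<Gamma> w r] ap_subst[OF f] ele_length[OF a] ele_length[OF b] ele_Idc_length[OF w r]
      ele_closed[OF a] ele_closed[OF b] by simp
qed

lemma fam_based: "wfc \<Phi> \<Longrightarrow> ele [] a a \<Phi> \<Longrightarrow> fam \<Phi> (\<lambda>x y u. Idc \<Phi> a x)"
  using fam_Idc[OF _ _ sec_const sec_x, of \<Phi> a nilf] by (simp add: fam_def fam2_def)

text \<open>As for associativity, elimination is on q, and p, which ends at the varying point, is
  the parameter. For q reflexivity both sides reduce to \<open>ap\<close> of the parameter.\<close>

lemma ap_trs:
  assumes \<Phi>: "wfc \<Phi>" and \<Psi>: "wfc \<Psi>" and f: "ele \<Phi> f f \<Psi>" and a: "ele [] a a \<Phi>" and b: "ele [] b b \<Phi>"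
    and c: "ele [] c c \<Phi>" and p: "ele [] p p (Idc \<Phi> a b)" and q: "ele [] q q (Idc \<Phi> b c)"
  shows "hty (Idc \<Psi> (app f a) (app f c)) (ap f a c (transport b c q p))
    (transport (app f b) (app f c) (ap f b c q) (ap f a b p))"
proof (rule hty_elim[OF \<Phi> fam_based[OF \<Phi> a], of "\<lambda>x y u t. Idc \<Psi> (app f a) (app f y)"
    "\<lambda>x y u t. ap f a y (transport x y u t)" "\<lambda>x y u t. transport (app f x) (app f y) (ap f x y u) (ap f a x t)" b c q p])
  let ?\<Theta> = "\<lambda>x y u. Idc \<Phi> a x"
  note sa = sec_const[OF a]
  note F = sec_app[OF \<Phi> \<Psi> f]
  have t: "sec \<Phi> ?\<Theta> (\<lambda>x y u t. Idc \<Phi> a x) (\<lambda>x y u t. t)" using sec_t[of \<Phi> ?\<Theta>] .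
  show "fam2 \<Phi> ?\<Theta> (\<lambda>x y u t. Idc \<Psi> (app f a) (app f y))"
    by (rule fam_Idc[OF \<Phi> \<Psi> F[OF sa] F[OF sec_y]])
  show "sec \<Phi> ?\<Theta> (\<lambda>x y u t. Idc \<Psi> (app f a) (app f y)) (\<lambda>x y u t. ap f a y (transport x y u t))"
    by (rule sec_ap[OF \<Phi> \<Psi> f sa sec_y sec_trs[OF \<Phi> sa sec_x sec_y t sec_u]])
  show "sec \<Phi> ?\<Theta> (\<lambda>x y u t. Idc \<Psi> (app f a) (app f y))
      (\<lambda>x y u t. transport (app f x) (app f y) (ap f x y u) (ap f a x t))"
    by (rule sec_trs[OF \<Psi> F[OF sa] F[OF sec_x] F[OF sec_y] sec_ap[OF \<Phi> \<Psi> f sa sec_x t] sec_ap[OF \<Phi> \<Psi> f sec_x sec_y sec_u]])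
  show "ele \<Gamma> (ap f a x (transport x x (rl x) t)) (transport (app f x) (app f x) (ap f x x (rl x)) (ap f a x t))
      (Idc \<Psi> (app f a) (app f x))"
    if \<Gamma>: "wfc \<Gamma>" and x: "ele \<Gamma> x x \<Phi>" and t: "ele \<Gamma> t t (Idc \<Phi> a x)" for \<Gamma> x t
  proof -
    note wa = ele_weaken[OF a \<Gamma>]
    note fa = app_ele[OF \<Phi> \<Psi> \<Gamma> f wa] and fx = app_ele[OF \<Phi> \<Psi> \<Gamma> f x]
    note apt = ap_ele[OF \<Phi> \<Psi> f \<Gamma> wa x t]
    have 1: "ele \<Gamma> (ap f a x (transport x x (rl x) t)) (ap f a x t) (Idc \<Psi> (app f a) (app f x))"
      by (rule ap_ele[OF \<Phi> \<Psi> f \<Gamma> wa x trs_rl[OF \<Phi> \<Gamma> wa x t]])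
    have 2: "ele \<Gamma> (transport (app f x) (app f x) (ap f x x (rl x)) (ap f a x t))
       (transport (app f x) (app f x) (rl (app f x)) (ap f a x t)) (Idc \<Psi> (app f a) (app f x))"
      by (rule trs_ele[OF \<Psi> \<Gamma> fa fx fx apt ap_rl[OF \<Phi> \<Psi> f \<Gamma> x]])
    have 3: "ele \<Gamma> (transport (app f x) (app f x) (rl (app f x)) (ap f a x t)) (ap f a x t) (Idc \<Psi> (app f a) (app f x))"
      by (rule trs_rl[OF \<Psi> \<Gamma> fa fx apt])
    have wf: "wfc (Idc \<Psi> (app f a) (app f x) @ \<Gamma>)" by (rule Idc_closed_wf[OF \<Psi> \<Gamma> fa fx])
    show ?thesis by (rule ele_trans[OF wf 1 ele_sym[OF wf ele_trans[OF wf 2 3]]])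
  qed
qed (use assms in auto)

lemma sec_conv:
  assumes "sec \<Phi> \<Theta> \<Omega> F" "\<And>\<Gamma> x y u t. pt \<Phi> \<Gamma> x y u \<Longrightarrow> ele \<Gamma> t t (\<Theta> x y u) \<Longrightarrow> teq \<Gamma> (\<Omega> x y u t) (\<Omega>' x y u t)"
  shows "sec \<Phi> \<Theta> \<Omega>' F"
  using assms ele_conv unfolding sec_def by blast

text \<open>Since s(f(x)) = x holds definitionally, the doubly mapped path can be converted to the
  endpoints x and y. At reflexivity two computations bring it back to reflexivity.\<close>

lemma ap_retraction:
  assumes \<Phi>: "wfc \<Phi>" and \<Psi>: "wfc \<Psi>" and f: "ele \<Phi> f f \<Psi>" and s: "ele \<Psi> s s \<Phi>"
    and sf: "ele \<Phi> (app s f) (seg 0 (length \<Phi>)) \<Phi>"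
    and a: "ele [] a a \<Phi>" and b: "ele [] b b \<Phi>" and p: "ele [] p p (Idc \<Phi> a b)"
  shows "hty (Idc \<Phi> a b) (ap s (app f a) (app f b) (ap f a b p)) p"
proof (rule hty_elim[OF \<Phi> nil_fam, of "\<lambda>x y u t. Idc \<Phi> x y" "\<lambda>x y u t. ap s (app f x) (app f y) (ap f x y u)"
    "\<lambda>x y u t. u" a b p "[]"])
  have lf: "length f = length \<Psi>" using ele_length[OF f] by simp
  have r: "ele \<Gamma> (app s (app f x)) x \<Phi>" if "wfc \<Gamma>" "ele \<Gamma> x x \<Phi>" for \<Gamma> x
  proof -
    have "app (seg 0 (length \<Phi>)) x = x"
      using ele_length[OF that(2)] by (simp add: app_def sb_seg_hit)
    then show ?thesis
      using app_ele[OF \<Phi> \<Phi> that(1) sf that(2)] app_app[OF s lf, of x] by simp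
  qed
  have c: "teq \<Gamma> (Idc \<Phi> (app s (app f x)) (app s (app f y))) (Idc \<Phi> x y)"
    if "wfc \<Gamma>" "ele \<Gamma> x x \<Phi>" "ele \<Gamma> y y \<Phi>" for \<Gamma> x y
    using Idc_cong[OF _ r[OF that(1,2)] r[OF that(1,3)]] closed_wf[OF \<Phi> that(1)] teq_refl by blast
  show "fam2 \<Phi> nilf (\<lambda>x y u t. Idc \<Phi> x y)" by (rule fam_Idc[OF \<Phi> \<Phi> sec_x sec_y])
  have "sec \<Phi> nilf (\<lambda>x y u t. Idc \<Phi> (app s (app f x)) (app s (app f y))) (\<lambda>x y u t. ap s (app f x) (app f y) (ap f x y u))"
    by (rule sec_ap[OF \<Psi> \<Phi> s sec_app[OF \<Phi> \<Psi> f sec_x] sec_app[OF \<Phi> \<Psi> f sec_y] sec_ap[OF \<Phi> \<Psi> f sec_x sec_y sec_u]])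
  then show "sec \<Phi> nilf (\<lambda>x y u t. Idc \<Phi> x y) (\<lambda>x y u t. ap s (app f x) (app f y) (ap f x y u))"
    by (rule sec_conv) (use c in \<open>simp add: pt_def\<close>)
  show "ele \<Gamma> (ap s (app f x) (app f x) (ap f x x (rl x))) (rl x) (Idc \<Phi> x x)"
    if \<Gamma>: "wfc \<Gamma>" and x: "ele \<Gamma> x x \<Phi>" for \<Gamma> x
  proof -
    note fx = app_ele[OF \<Phi> \<Psi> \<Gamma> f x]
    note sfx = app_ele[OF \<Psi> \<Phi> \<Gamma> s fx]
    have 1: "ele \<Gamma> (ap s (app f x) (app f x) (ap f x x (rl x))) (ap s (app f x) (app f x) (rl (app f x)))
        (Idc \<Phi> (app s (app f x)) (app s (app f x)))"
      by (rule ap_ele[OF \<Psi> \<Phi> s \<Gamma> fx fx ap_rl[OF \<Phi> \<Psi> f \<Gamma> x]])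
    have 2: "ele \<Gamma> (ap s (app f x) (app f x) (rl (app f x))) (rl (app s (app f x))) (Idc \<Phi> (app s (app f x)) (app s (app f x)))"
      by (rule ap_rl[OF \<Psi> \<Phi> s \<Gamma> fx])
    have 3: "ele \<Gamma> (rl (app s (app f x))) (rl x) (Idc \<Phi> (app s (app f x)) (app s (app f x)))"
      by (rule rl_ele[OF closed_wf[OF \<Phi> \<Gamma>] r[OF \<Gamma> x]])
    have wf: "wfc (Idc \<Phi> (app s (app f x)) (app s (app f x)) @ \<Gamma>)" by (rule Idc_closed_wf[OF \<Phi> \<Gamma> sfx sfx])
    show ?thesis by (rule ele_conv[OF c[OF \<Gamma> x x] ele_trans[OF wf 1 ele_trans[OF wf 2 3]]])
  qed
qed (use assms sec_u in auto)

text \<open>Both sides are precomposed with a reflexivity path: this makes them agree definitionally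
  on the diagonal.\<close>

lemma ap_natural:
  assumes \<Phi>: "wfc \<Phi>" and \<Psi>: "wfc \<Psi>" and f: "ele \<Phi> f f \<Psi>" and s: "ele \<Psi> s s \<Phi>"
    and \<theta>: "ele \<Psi> \<theta> \<theta> (Idc \<Psi> (app f s) (seg 0 (length \<Psi>)))"
    and a: "ele [] a a \<Psi>" and b: "ele [] b b \<Psi>" and q: "ele [] q q (Idc \<Psi> a b)"
  shows "hty (Idc \<Psi> (app f (app s a)) b)
    (transport (app f (app s b)) b (app \<theta> b)
      (transport (app f (app s a)) (app f (app s b)) (ap f (app s a) (app s b) (ap s a b q)) (rl (app f (app s a)))))
    (transport (app f (app s a)) b (transport a b q (app \<theta> a)) (rl (app f (app s a))))"
proof (rule hty_elim[OF \<Psi> nil_fam, of "\<lambda>x y u t. Idc \<Psi> (app f (app s x)) y"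
    "\<lambda>x y u t. transport (app f (app s y)) y (app \<theta> y)
      (transport (app f (app s x)) (app f (app s y)) (ap f (app s x) (app s y) (ap s x y u)) (rl (app f (app s x))))"
    "\<lambda>x y u t. transport (app f (app s x)) y (transport x y u (app \<theta> x)) (rl (app f (app s x)))" a b q "[]"])
  have ls: "length s = length \<Phi>" "length f = length \<Psi>" using ele_length[OF s] ele_length[OF f] by simp_all
  have nil: "wfc []" by simp
  have v: "ele \<Psi> (seg 0 (length \<Psi>)) (seg 0 (length \<Psi>)) \<Psi>"
    using closed_ele_seg[OF \<Psi> nil] by simp
  have fs: "ele \<Psi> (app f s) (app f s) \<Psi>"
    by (rule app_ele[OF \<Phi> \<Psi> \<Psi> f s])
  have w: "wfc (Idc \<Psi> (app f s) (seg 0 (length \<Psi>)) @ \<Psi>)"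
    by (rule Idc_closed_wf[OF \<Psi> \<Psi> fs v])
  have \<theta>_ty: "subst_tele (cat x Var) (Idc \<Psi> (app f s) (seg 0 (length \<Psi>))) = Idc \<Psi> (app f (app s x)) x"
    if "length x = length \<Psi>" for x
    using that ls \<Psi> by (simp add: Idc_closed_subst app_subst[OF f] sb_seg_hit) (simp add: app_def)
  note S = sec_app[OF \<Psi> \<Phi> s] and FS = sec_app[OF \<Phi> \<Psi> f sec_app[OF \<Psi> \<Phi> s]]
  have sx: "sec \<Psi> nilf (\<lambda>x y u t. Idc \<Psi> (app f (app s x)) x) (\<lambda>x y u t. app \<theta> x)"
    by (rule sec_conv[OF sec_app_dep[OF \<Psi> \<theta> w sec_x]])
      (use pt_length \<theta>_ty Idc_closed_wf[OF \<Psi>] app_ele[OF \<Psi> \<Phi> _ s] app_ele[OF \<Phi> \<Psi> _ f] teq_refl in \<open>simp add: pt_def ele_length\<close>)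
  have sy: "sec \<Psi> nilf (\<lambda>x y u t. Idc \<Psi> (app f (app s y)) y) (\<lambda>x y u t. app \<theta> y)"
    by (rule sec_conv[OF sec_app_dep[OF \<Psi> \<theta> w sec_y]])
      (use pt_length \<theta>_ty Idc_closed_wf[OF \<Psi>] app_ele[OF \<Psi> \<Phi> _ s] app_ele[OF \<Phi> \<Psi> _ f] teq_refl in \<open>simp add: pt_def ele_length\<close>)
  have sap: "sec \<Psi> nilf (\<lambda>x y u t. Idc \<Psi> (app f (app s x)) (app f (app s y))) (\<lambda>x y u t. ap f (app s x) (app s y) (ap s x y u))"
    by (rule sec_ap[OF \<Phi> \<Psi> f S[OF sec_x] S[OF sec_y] sec_ap[OF \<Psi> \<Phi> s sec_x sec_y sec_u]])
  have srl: "sec \<Psi> nilf (\<lambda>x y u t. Idc \<Psi> (app f (app s x)) (app f (app s x))) (\<lambda>x y u t. rl (app f (app s x)))"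
    by (rule sec_rl[OF \<Psi> FS[OF sec_x]])
  show "fam2 \<Psi> nilf (\<lambda>x y u t. Idc \<Psi> (app f (app s x)) y)"
    by (rule fam_Idc[OF \<Psi> \<Psi> FS[OF sec_x] sec_y])
  show "sec \<Psi> nilf (\<lambda>x y u t. Idc \<Psi> (app f (app s x)) y) (\<lambda>x y u t. transport (app f (app s y)) y (app \<theta> y)
      (transport (app f (app s x)) (app f (app s y)) (ap f (app s x) (app s y) (ap s x y u)) (rl (app f (app s x)))))"
    by (rule sec_trs[OF \<Psi> FS[OF sec_x] FS[OF sec_y] sec_y sec_trs[OF \<Psi> FS[OF sec_x] FS[OF sec_x] FS[OF sec_y] srl sap] sy])
  show "sec \<Psi> nilf (\<lambda>x y u t. Idc \<Psi> (app f (app s x)) y)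
      (\<lambda>x y u t. transport (app f (app s x)) y (transport x y u (app \<theta> x)) (rl (app f (app s x))))"
    by (rule sec_trs[OF \<Psi> FS[OF sec_x] FS[OF sec_x] sec_y srl sec_trs[OF \<Psi> FS[OF sec_x] sec_x sec_y sx sec_u]])
  show "ele \<Gamma> (transport (app f (app s x)) x (app \<theta> x)
      (transport (app f (app s x)) (app f (app s x)) (ap f (app s x) (app s x) (ap s x x (rl x))) (rl (app f (app s x)))))
      (transport (app f (app s x)) x (transport x x (rl x) (app \<theta> x)) (rl (app f (app s x))))
      (Idc \<Psi> (app f (app s x)) x)"
    if \<Gamma>: "wfc \<Gamma>" and x: "ele \<Gamma> x x \<Psi>" for \<Gamma> x
  proof -
    note sx = app_ele[OF \<Psi> \<Phi> \<Gamma> s x]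
    note fx = app_ele[OF \<Phi> \<Psi> \<Gamma> f sx]
    let ?z = "app f (app s x)"
    have \<theta>x: "ele \<Gamma> (app \<theta> x) (app \<theta> x) (Idc \<Psi> ?z x)"
      using app_ele_dep[OF \<Psi> \<Gamma> \<theta> x] \<theta>_ty ele_length[OF x] by simp
    have r: "ele \<Gamma> (rl ?z) (rl ?z) (Idc \<Psi> ?z ?z)" by (rule rl_ele[OF closed_wf[OF \<Psi> \<Gamma>] fx])
    have wfz: "wfc (Idc \<Psi> ?z ?z @ \<Gamma>)" by (rule Idc_closed_wf[OF \<Psi> \<Gamma> fx fx])
    have wf: "wfc (Idc \<Psi> ?z x @ \<Gamma>)" by (rule Idc_closed_wf[OF \<Psi> \<Gamma> fx x])
    \<comment> \<open>On the diagonal both sides become \<theta>(x) composed with reflexivity, which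
      is why the extra reflexivity factor was inserted.\<close>
    have 1: "ele \<Gamma> (ap f (app s x) (app s x) (ap s x x (rl x))) (rl ?z) (Idc \<Psi> ?z ?z)"
      by (rule ele_trans[OF wfz ap_ele[OF \<Phi> \<Psi> f \<Gamma> sx sx ap_rl[OF \<Psi> \<Phi> s \<Gamma> x]] ap_rl[OF \<Phi> \<Psi> f \<Gamma> sx]])
    have 2: "ele \<Gamma> (transport ?z ?z (ap f (app s x) (app s x) (ap s x x (rl x))) (rl ?z)) (rl ?z) (Idc \<Psi> ?z ?z)"
      by (rule ele_trans[OF wfz trs_ele[OF \<Psi> \<Gamma> fx fx fx r 1] trs_rl[OF \<Psi> \<Gamma> fx fx r]])
    have 3: "ele \<Gamma> (transport ?z x (app \<theta> x) (transport ?z ?z (ap f (app s x) (app s x) (ap s x x (rl x))) (rl ?z)))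
       (transport ?z x (app \<theta> x) (rl ?z)) (Idc \<Psi> ?z x)"
      by (rule trs_ele[OF \<Psi> \<Gamma> fx fx x 2 \<theta>x])
    have 4: "ele \<Gamma> (transport ?z x (transport x x (rl x) (app \<theta> x)) (rl ?z)) (transport ?z x (app \<theta> x) (rl ?z)) (Idc \<Psi> ?z x)"
      by (rule trs_ele[OF \<Psi> \<Gamma> fx fx x r trs_rl[OF \<Psi> \<Gamma> fx x \<theta>x]])
    show ?thesis by (rule ele_trans[OF wf 3 ele_sym[OF wf 4]])
  qed
qed (use assms in auto)

section \<open>Based path induction and the classifying category\<close>


text \<open>The context (y, u) of paths starting at x. It plays the role of a contractible
  singleton, with centre (x, r(x)).\<close>

definition based :: "'s ctx \<Rightarrow> 's tup \<Rightarrow> 's ctx" where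
  "based \<Psi> x = Idc \<Psi> (sb (sh (length \<Psi>)) x) (seg 0 (length \<Psi>)) @ \<Psi>"

lemma based_wf: "wfc \<Psi> \<Longrightarrow> wfc \<Gamma> \<Longrightarrow> ele \<Gamma> x x \<Psi> \<Longrightarrow> wfc (based \<Psi> x @ \<Gamma>)"
  using based_fam(1) by (simp add: based_def)

lemma length_based: "length x = length \<Psi> \<Longrightarrow> length (based \<Psi> x) = length \<Psi> + length \<Psi>"
  by (simp add: based_def length_Idc)

lemma based_subst: "wfc \<Psi> \<Longrightarrow> length x = length \<Psi> \<Longrightarrow> subst_tele \<sigma> (based \<Psi> x) = based \<Psi> (sb \<sigma> x)"
  by (simp add: based_def subst_tele_closed Idc_closed_subst sb_ups_seg ups_sh')

lemma based_ele:
  assumes "wfc \<Psi>" "wfc \<Gamma>" "ele \<Gamma> x x \<Psi>" "ele \<Gamma> y y' \<Psi>" "ele \<Gamma> u u' (Idc \<Psi> x y)"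
  shows "ele \<Gamma> (u @ y) (u' @ y') (based \<Psi> x)"
  unfolding based_def
proof (rule ele_appendI[OF assms(4)])
  show "ele \<Gamma> u u' (subst_tele (cat y Var) (Idc \<Psi> (sb (sh (length \<Psi>)) x) (seg 0 (length \<Psi>))))"
    using based_fam(2)[OF assms(1-3)] ele_length[OF assms(4)] assms(5) by simp
qed

lemma based_generic:
  assumes "wfc \<Psi>" "ele [] c c \<Psi>"
  shows "ele (based \<Psi> c) (seg (length \<Psi>) (length \<Psi>)) (seg (length \<Psi>) (length \<Psi>)) \<Psi>"
    "ele (based \<Psi> c) (seg 0 (length \<Psi>)) (seg 0 (length \<Psi>)) (Idc \<Psi> c (seg (length \<Psi>) (length \<Psi>)))"
proof -
  let ?n = "length \<Psi>" and ?E = "based \<Psi> c"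
  have lc: "length c = ?n" using ele_length[OF assms(2)] by simp
  have nil: "wfc []" by simp
  have E: "wfc ?E" using based_wf[OF assms(1) nil assms(2)] by simp
  have "ele ?E (seg 0 (?n + ?n)) (seg 0 (?n + ?n)) ?E"
    using closed_ele_seg[OF E nil] length_based[OF lc] by simp
  then have V: "ele ?E (seg 0 ?n @ seg ?n ?n) (seg 0 ?n @ seg ?n ?n) ?E" by (simp add: seg_add)
  show "ele ?E (seg ?n ?n) (seg ?n ?n) \<Psi>"
    and "ele ?E (seg 0 ?n) (seg 0 ?n) (Idc \<Psi> c (seg ?n ?n))"
    using V based_fam(2)[OF assms(1) nil assms(2), of "seg ?n ?n"]
    unfolding based_def by (subst (asm) ele_append; simp add: length_Idc lc)+
qed

text \<open>Elimination needs both endpoints of u to vary, so x is left free here and specialised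
  only later. On the diagonal (y, u) is the centre itself, and uniqueness up to homotopy supplies
  the contraction.\<close>

lemma based_contraction:
  assumes \<Psi>: "wfc \<Psi>"
  obtains H where "sec \<Psi> nilf (\<lambda>x y u t. Idc (based \<Psi> x) (rl x @ x) (u @ y)) H"
    "\<And>\<Gamma> x. wfc \<Gamma> \<Longrightarrow> ele \<Gamma> x x \<Psi> \<Longrightarrow>
      ele \<Gamma> (H x x (rl x) []) (rl (rl x @ x)) (Idc (based \<Psi> x) (rl x @ x) (rl x @ x))"
proof (rule elim_hom[OF \<Psi> nil_fam, of "\<lambda>x y u t. based \<Psi> x" "\<lambda>x y u t. rl x @ x" "\<lambda>x y u t. u @ y"])
  show "fam2 \<Psi> nilf (\<lambda>x y u t. based \<Psi> x)"
    unfolding fam2_def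
  proof (intro allI impI conjI)
    fix \<Gamma> x y u \<sigma> assume p: "pt \<Psi> \<Gamma> x y u"
    show "wfc (based \<Psi> x @ \<Gamma>)" using p based_wf[OF \<Psi>] unfolding pt_def by blast
    show "subst_tele \<sigma> (based \<Psi> x) = based \<Psi> (sb \<sigma> x)" using based_subst[OF \<Psi>] pt_length[OF p] by blast
  qed
  show "sec \<Psi> nilf (\<lambda>x y u t. based \<Psi> x) (\<lambda>x y u t. rl x @ x)"
    unfolding sec_def
  proof (intro allI impI conjI)
    fix \<Gamma> x y u \<sigma> assume p: "pt \<Psi> \<Gamma> x y u"
    then have x: "wfc \<Gamma>" "ele \<Gamma> x x \<Psi>" by (simp_all add: pt_def)
    show "ele \<Gamma> (rl x @ x) (rl x @ x) (based \<Psi> x)"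
      by (rule based_ele[OF \<Psi> x x(2) rl_ele[OF closed_wf[OF \<Psi> x(1)] x(2)]])
  qed simp
  show "sec \<Psi> nilf (\<lambda>x y u t. based \<Psi> x) (\<lambda>x y u t. u @ y)"
    unfolding sec_def
  proof (intro allI impI conjI)
    fix \<Gamma> x y u \<sigma> assume p: "pt \<Psi> \<Gamma> x y u"
    then show "ele \<Gamma> (u @ y) (u @ y) (based \<Psi> x)"
      using based_ele[OF \<Psi>, of \<Gamma> x y y u u] by (simp add: pt_def)
  qed simp
  show "ele \<Gamma> (rl x @ x) (rl x @ x) (based \<Psi> x)" if "wfc \<Gamma>" "ele \<Gamma> x x \<Psi>" for \<Gamma> x
    using based_ele[OF \<Psi> that that(2)] rl_ele[OF closed_wf[OF \<Psi> that(1)] that(2)] by blast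
  fix H assume H1: "sec \<Psi> nilf (\<lambda>x y u t. Idc (based \<Psi> x) (rl x @ x) (u @ y)) H"
    and H2: "\<And>\<Gamma> x t. wfc \<Gamma> \<Longrightarrow> ele \<Gamma> x x \<Psi> \<Longrightarrow> ele \<Gamma> t t [] \<Longrightarrow>
      ele \<Gamma> (H x x (rl x) t) (rl (rl x @ x)) (Idc (based \<Psi> x) (rl x @ x) (rl x @ x))"
  show thesis by (rule that[OF H1 H2]) simp_all
qed

text \<open>Variables count from the most recent entry, so placing \<Gamma> before the closed
  context \<Phi> changes no index in \<Omega>.\<close>

lemma wf_weaken_tele:
  assumes \<Phi>: "wfc \<Phi>" and \<Omega>: "wfc (\<Omega> @ \<Phi>)" and \<Gamma>: "wfc \<Gamma>"
  shows "wfc (\<Omega> @ \<Phi> @ \<Gamma>)"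
proof -
  have eq: "subst_tele (cat (seg 0 (length \<Phi>)) Var) \<Omega> = \<Omega>"
    using subst_tele_scoped_cong[OF \<Omega>, of "cat (seg 0 (length \<Phi>)) Var" Var] by (simp add: cat_def)
  from wf_subst[OF sme_closed_cat[OF \<Phi> closed_wf[OF \<Phi> \<Gamma>] closed_ele_seg[OF \<Phi> \<Gamma>], of Var Var] \<Omega>]
  show ?thesis unfolding eq .
qed

text \<open>Based path induction. The parameters of the elimination rule do not provide it directly;
  it is transport along the contraction of the context of paths that start at \<open>c\<close>.\<close>

lemma based_path_induction:
  assumes \<Psi>: "wfc \<Psi>" and c: "ele [] c c \<Psi>" and \<Omega>: "wfc (\<Omega> @ based \<Psi> c)"
    and e: "ele [] e e (subst_tele (cat (rl c @ c) Var) \<Omega>)"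
  obtains j where "ele (based \<Psi> c) j j \<Omega>" "ele [] (app j (rl c @ c)) e (subst_tele (cat (rl c @ c) Var) \<Omega>)"
proof -
  let ?E = "based \<Psi> c" and ?n = "length \<Psi>" and ?r = "rl c @ c"
  let ?y = "seg ?n ?n" and ?u = "seg 0 ?n"
  obtain H where H: "sec \<Psi> nilf (\<lambda>x y u t. Idc (based \<Psi> x) (rl x @ x) (u @ y)) H"
    "\<And>\<Gamma> x. wfc \<Gamma> \<Longrightarrow> ele \<Gamma> x x \<Psi> \<Longrightarrow>
      ele \<Gamma> (H x x (rl x) []) (rl (rl x @ x)) (Idc (based \<Psi> x) (rl x @ x) (rl x @ x))"
    by (rule based_contraction[OF \<Psi>]) (rule that)
  have lc: "length c = ?n" using ele_length[OF c] by simp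
  have nil: "wfc []" by simp
  have E: "wfc ?E" using based_wf[OF \<Psi> nil c] by simp
  have lE: "length ?E = ?n + ?n" using length_based lc by simp
  have r: "ele [] ?r ?r ?E"
    using based_ele[OF \<Psi> nil c c] rl_ele[of \<Psi> "[]"] \<Psi> c by simp
  have cE: "ele ?E c c \<Psi>" by (rule ele_weaken[OF c E])
  have rE: "ele ?E ?r ?r ?E" by (rule ele_weaken[OF r E])
  note y = based_generic(1)[OF \<Psi> c] and u = based_generic(2)[OF \<Psi> c]
  note V = based_ele[OF \<Psi> E cE y u]
  \<comment> \<open>The contraction is now taken at the generic path out of c, giving a path from
    the centre to the generic point of the based context.\<close>
  have p: "pt \<Psi> ?E c ?y ?u" using E cE y u by (simp add: pt_def)
  have h: "ele ?E (H c ?y ?u []) (H c ?y ?u []) (Idc ?E ?r (?u @ ?y))"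
    and hn: "sb \<sigma> (H c ?y ?u []) = H c (sb \<sigma> ?y) (sb \<sigma> ?u) []" for \<sigma>
    using H(1) p ele_closed[OF c] unfolding sec_def by fastforce+
  note wf = wf_weaken_tele[OF E \<Omega> E]
  have "ele ?E e e (subst_tele (cat ?r Var) \<Omega>)" by (rule ele_weaken[OF e E])
  from transport_ele[OF wf rE V h this]
  have "ele ?E (transport ?r (?u @ ?y) (H c ?y ?u []) e) (transport ?r (?u @ ?y) (H c ?y ?u []) e)
     (subst_tele (cat (?u @ ?y) Var) \<Omega>)" .
  moreover have "subst_tele (cat (?u @ ?y) Var) \<Omega> = \<Omega>"
  proof -
    have "\<forall>i < length ?E. cat (?u @ ?y) Var i = Var i"
      using lE by (auto simp: cat_def nth_append simp del: cat_append)
    from subst_tele_scoped_cong[OF \<Omega> this] show ?thesis by simp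
  qed
  ultimately have j: "ele ?E (transport ?r (?u @ ?y) (H c ?y ?u []) e) (transport ?r (?u @ ?y) (H c ?y ?u []) e) \<Omega>"
    by (simp only:)
  have lh: "length (H c ?y ?u []) = ?n + ?n"
    using ele_Idc_length[OF rE V h] lE by simp
  have "app (transport ?r (?u @ ?y) (H c ?y ?u []) e) ?r = transport ?r ?r (H c c (rl c) []) e"
    using lc lh ele_closed[OF c] ele_closed[OF e]
    by (simp add: app_def transport_subst hn sb_seg_hit sb_seg_skip)
  \<comment> \<open>At the centre the contraction is reflexivity, so the transport computes to
    e.\<close>
  moreover have "ele [] (transport ?r ?r (H c c (rl c) []) e) e (subst_tele (cat ?r Var) \<Omega>)"
  proof -
    have wf0: "wfc (\<Omega> @ ?E @ [])" using \<Omega> by simp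
    have w: "wfc (subst_tele (cat ?r Var) \<Omega>)"
      using wf_subst[OF sme_closed_cat[OF E nil r, of Var Var] \<Omega>] by simp
    show ?thesis
      by (rule ele_transC[OF w transport_ele[OF wf0 r r H(2)[OF nil c] e] transport_comp[OF wf0 r e]])
  qed
  ultimately show thesis using that[OF j] by simp
qed

section \<open>Arrows of the classifying category through representatives\<close>

lemma ctx_eq_iff: "ctx_eq T \<Gamma> \<Delta> \<longleftrightarrow> teq [] \<Gamma> \<Delta>"
proof (induction \<Gamma> arbitrary: \<Delta>)
  case Nil
  then show ?case by (cases \<Delta>) auto
next
  case (Cons A \<Gamma>)
  then show ?case by (cases \<Delta>) auto
qed

abbreviation "CC \<equiv> classifying_category T"

lemma ctx_class_eq: "wfc \<Gamma> \<Longrightarrow> wfc \<Gamma>' \<Longrightarrow> ctx_class T \<Gamma> = ctx_class T \<Gamma>' \<longleftrightarrow> teq [] \<Gamma> \<Gamma>'"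
proof
  assume wf: "wfc \<Gamma>" "wfc \<Gamma>'" and "ctx_class T \<Gamma> = ctx_class T \<Gamma>'"
  moreover have "teq [] \<Gamma>' \<Gamma>'" using wf teq_refl by simp
  ultimately show "teq [] \<Gamma> \<Gamma>'" unfolding ctx_class_def ctx_eq_iff by blast
qed (auto simp: ctx_class_def ctx_eq_iff intro: teq_trans teq_sym)

lemma ele_ctx_conv:
  assumes "teq [] \<Gamma> \<Gamma>'" "teq [] \<Delta> \<Delta>'" "ele \<Gamma> s t \<Delta>"
  shows "ele \<Gamma>' s t \<Delta>'"
proof -
  have s: "sme \<Gamma>' Var Var \<Gamma>" "wfc \<Gamma>'" using teq_sme[OF assms(1)] by simp_all
  have "teq \<Gamma>' \<Delta> \<Delta>'" using teq_subst[OF assms(2) sme_Nil[OF s(2), of Var Var]] by simp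
  moreover have "ele \<Gamma>' s t \<Delta>" using ele_subst[OF assms(3) s(1)] by simp
  ultimately show ?thesis by (rule ele_conv)
qed

lemma tup_class_eq:
  assumes "teq [] \<Gamma> \<Gamma>'" "teq [] \<Delta> \<Delta>'" "ele \<Gamma> f f' \<Delta>"
  shows "tup_class T \<Gamma> \<Delta> f = tup_class T \<Gamma>' \<Delta>' f'"
proof -
  have wf: "wfc (\<Delta> @ \<Gamma>)" using closed_wf teq_wf[OF assms(1)] teq_wf[OF assms(2)] by simp
  have "ele \<Gamma> f t \<Delta> \<longleftrightarrow> ele \<Gamma> f' t \<Delta>" for t
    using ele_trans[OF wf] ele_sym[OF wf] assms(3) by blast
  moreover have "ele \<Gamma> f' t \<Delta> \<longleftrightarrow> ele \<Gamma>' f' t \<Delta>'" for t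
    using ele_ctx_conv assms(1,2) teq_sym by blast
  ultimately show ?thesis by (auto simp: tup_class_def)
qed

lemma carrow_eq:
  assumes "wfc \<Gamma>" "wfc \<Delta>" "ele \<Gamma> f f \<Delta>" "ele \<Gamma> g g \<Delta>"
  shows "carrow T \<Gamma> \<Delta> f = carrow T \<Gamma> \<Delta> g \<longleftrightarrow> ele \<Gamma> f g \<Delta>"
proof
  assume "carrow T \<Gamma> \<Delta> f = carrow T \<Gamma> \<Delta> g"
  then show "ele \<Gamma> f g \<Delta>" using assms(4) by (auto simp: carrow_def tup_class_def)
next
  assume "ele \<Gamma> f g \<Delta>"
  moreover have "teq [] \<Gamma> \<Gamma>" "teq [] \<Delta> \<Delta>" using assms teq_refl by simp_all
  ultimately show "carrow T \<Gamma> \<Delta> f = carrow T \<Gamma> \<Delta> g"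
    using tup_class_eq by (simp add: carrow_def)
qed

lemma carrow_Ar: "wfc \<Gamma> \<Longrightarrow> wfc \<Delta> \<Longrightarrow> ele \<Gamma> f f \<Delta> \<Longrightarrow> carrow T \<Gamma> \<Delta> f \<in> Ar CC"
  by (auto simp: classifying_category_def elem_iff)

lemma carrow_Dom_Cod [simp]: "Dom CC (carrow T \<Gamma> \<Delta> f) = ctx_class T \<Gamma>" "Cod CC (carrow T \<Gamma> \<Delta> f) = ctx_class T \<Delta>"
  by (auto simp: classifying_category_def carrow_def)

text \<open>Endpoints of an arrow are only classes of contexts. Context conversion provides a
  representing tuple over any chosen representatives of them.\<close>

lemma cc_arr:
  assumes "X \<in> Ar CC" "Dom CC X = ctx_class T \<Gamma>" "Cod CC X = ctx_class T \<Delta>" "wfc \<Gamma>" "wfc \<Delta>"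
  obtains f where "ele \<Gamma> f f \<Delta>" "X = carrow T \<Gamma> \<Delta> f"
proof -
  from assms(1) obtain \<Gamma>0 \<Delta>0 f where X: "X = carrow T \<Gamma>0 \<Delta>0 f" "wfc \<Gamma>0" "wfc \<Delta>0" "ele \<Gamma>0 f f \<Delta>0"
    by (auto simp: classifying_category_def elem_iff)
  with assms have e: "teq [] \<Gamma>0 \<Gamma>" "teq [] \<Delta>0 \<Delta>" using ctx_class_eq by auto
  have "ele \<Gamma> f f \<Delta>" using ele_ctx_conv[OF e X(4)] .
  moreover have "X = carrow T \<Gamma> \<Delta> f"
    using X assms(2,3) tup_class_eq[OF e X(4)] by (auto simp: carrow_def classifying_category_def)
  ultimately show thesis by (rule that)
qed

lemma UN_eq_const: "A \<noteq> {} \<Longrightarrow> (\<And>x. x \<in> A \<Longrightarrow> F x = c) \<Longrightarrow> (\<Union>x\<in>A. F x) = c"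
  by auto

text \<open>The union in the definition of composition ranges over a nonempty set of
  representatives, and all of its members coincide.\<close>

lemma cc_cmp:
  assumes wf: "wfc \<Gamma>" "wfc \<Delta>" "wfc \<Theta>" and f: "ele \<Gamma> f f \<Delta>" and g: "ele \<Delta> g g \<Theta>"
  shows "Cmp CC (carrow T \<Delta> \<Theta> g) (carrow T \<Gamma> \<Delta> f) = carrow T \<Gamma> \<Theta> (app g f)"
proof -
  have r: "teq [] \<Gamma> \<Gamma>" "teq [] \<Theta> \<Theta>" using wf teq_refl by simp_all
  have "tup_class T \<Gamma>' \<Theta>' (app g' f') = tup_class T \<Gamma> \<Theta> (app g f)"
    if "\<Gamma>' \<in> ctx_class T \<Gamma>" "\<Theta>' \<in> ctx_class T \<Theta>" "f' \<in> tup_class T \<Gamma> \<Delta> f" "g' \<in> tup_class T \<Delta> \<Theta> g"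
    for \<Gamma>' \<Theta>' f' g'
  proof -
    have "ele \<Gamma> (app g f) (app g' f') \<Theta>"
      using app_ele[OF wf(2,3,1)] that by (auto simp: tup_class_def)
    then show ?thesis using tup_class_eq[of \<Gamma> \<Gamma>' \<Theta> \<Theta>'] that by (auto simp: ctx_class_def ctx_eq_iff)
  qed
  moreover have "ctx_class T \<Gamma> \<noteq> {}" "ctx_class T \<Theta> \<noteq> {}" "tup_class T \<Gamma> \<Delta> f \<noteq> {}" "tup_class T \<Delta> \<Theta> g \<noteq> {}"
    using r f g by (auto simp: ctx_class_def ctx_eq_iff tup_class_def)
  ultimately show ?thesis
    by (simp add: classifying_category_def carrow_def tup_comp_app)
qed

section \<open>Lifting problems against display maps\<close>

lemma display_maps_eq: "display_maps T = {carrow T (A # \<Gamma>) \<Gamma> (seg 1 (length \<Gamma>)) | \<Gamma> A. wfc (A # \<Gamma>)}"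
  by (simp add: display_maps_def seg_def)

lemma seg_1_ele: "wfc (A # \<Gamma>) \<Longrightarrow> n = length \<Gamma> \<Longrightarrow> ele (A # \<Gamma>) (seg 1 n) (seg 1 n) \<Gamma>"
  using ele_seg[of "[A]" \<Gamma> "[]" 1 n "1 + n"] wf_ctx.simps(2)[of T A \<Gamma>] by (simp add: subst_tele_closed)

lemma app_seg_1: "length s = n \<Longrightarrow> app (seg (Suc 0) n) (a # s) = s"
  by (simp add: app_def cat_peel sb_seg_hit)

text \<open>A dependent projection is a composite of display maps, so the section of \<Omega> is
  built one type at a time. The equality over f already obtained for the earlier components is what
  makes the next square commute.\<close>

lemma class_A_lift:
  assumes A: "carrow T \<Phi> \<Psi> f \<in> class_A T" and wf: "wfc \<Phi>" "wfc \<Psi>" and f: "ele \<Phi> f f \<Psi>"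
  shows "wfc (\<Omega> @ \<Psi>) \<Longrightarrow> ele \<Phi> e e (subst_tele (cat f Var) \<Omega>) \<Longrightarrow>
    \<exists>s. ele \<Psi> s s \<Omega> \<and> ele \<Phi> (app s f) e (subst_tele (cat f Var) \<Omega>)"
proof (induction \<Omega> arbitrary: e)
  case Nil
  then show ?case by (simp add: app_def)
next
  case (Cons B \<Omega>)
  let ?K = "\<Omega> @ \<Psi>" and ?n = "length \<Psi>" and ?\<rho> = "cat f Var"
  from Cons.prems(2) obtain e0 e' where e: "e = e0 # e'" by (cases e) auto
  have wfK: "wfc ?K" "wfc (B # ?K)" using Cons.prems(1) by auto
  have e': "ele \<Phi> e' e' (subst_tele ?\<rho> \<Omega>)"
    and e0: "tme \<Phi> e0 e0 (inst e' (subst (ups (length \<Omega>) ?\<rho>) B))"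
    using Cons.prems(2) by (auto simp: e)
  have le: "length e' = length \<Omega>" using ele_length[OF e'] by simp
  from Cons.IH[OF wfK(1) e'] obtain s where s: "ele \<Psi> s s \<Omega>" "ele \<Phi> (app s f) e' (subst_tele ?\<rho> \<Omega>)" by blast
  have ls: "length s = length \<Omega>" using ele_length[OF s(1)] by simp
  have lf: "length f = ?n" using ele_length[OF f] by simp
  have "cat (e' @ f) Var = cat e' ?\<rho>" by simp
  with e0 le have e0': "tme \<Phi> e0 e0 (inst (e' @ f) B)" by (simp add: tsub_cat cat_inst)
  have ef: "ele \<Phi> (e' @ f) (e' @ f) ?K" by (rule ele_appendI[OF f e'])
  have h: "ele \<Phi> (e0 # e' @ f) (e0 # e' @ f) (B # ?K)" using e0' ef by simp
  have v: "ele \<Psi> (seg 0 ?n) (seg 0 ?n) \<Psi>" using closed_ele_seg[OF wf(2), of "[]"] by simp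
  have sv: "subst_tele (cat (seg 0 ?n) Var) \<Omega> = \<Omega>"
    using subst_tele_scoped_cong[OF wfK(1), of "cat (seg 0 ?n) Var" Var] by (simp add: cat_def)
  \<comment> \<open>The bottom of the square is the section found so far paired with the identity of
    \<Psi>; its top is the given element over f.\<close>
  have k: "ele \<Psi> (s @ seg 0 ?n) (s @ seg 0 ?n) ?K"
    by (rule ele_appendI[OF v]) (simp add: sv s(1))
  define p where "p = carrow T (B # ?K) ?K (seg 1 (length ?K))"
  have "p \<in> display_maps T"
    unfolding p_def display_maps_eq using wfK(2) by blast
  then have lift: "lifts CC (carrow T \<Phi> \<Psi> f) p" using A by (simp add: class_A_def)
  have s1: "ele (B # ?K) (seg 1 (length ?K)) (seg 1 (length ?K)) ?K" by (rule seg_1_ele[OF wfK(2) refl])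
  have ph: "Cmp CC p (carrow T \<Phi> (B # ?K) (e0 # e' @ f)) = carrow T \<Phi> ?K (e' @ f)"
    unfolding p_def using cc_cmp[OF wf(1) wfK(2,1) h s1] le lf by (simp add: app_seg_1)
  have "app (s @ seg 0 ?n) f = app s f @ f" using lf by (simp add: app_def sb_seg_hit)
  then have "Cmp CC (carrow T \<Psi> ?K (s @ seg 0 ?n)) (carrow T \<Phi> \<Psi> f) = carrow T \<Phi> ?K (app s f @ f)"
    using cc_cmp[OF wf wfK(1) f k] by simp
  also have "\<dots> = carrow T \<Phi> ?K (e' @ f)"
  proof -
    have 1: "ele \<Phi> (app s f @ f) (e' @ f) ?K" by (rule ele_appendI[OF f s(2)])
    show ?thesis using carrow_eq[OF wf(1) wfK(1) ele_refl1[OF 1] ef] 1 by simp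
  qed
  finally have sq: "Cmp CC p (carrow T \<Phi> (B # ?K) (e0 # e' @ f)) =
      Cmp CC (carrow T \<Psi> ?K (s @ seg 0 ?n)) (carrow T \<Phi> \<Psi> f)" using ph by simp
  obtain J where J: "J \<in> Ar CC" "Dom CC J = ctx_class T \<Psi>" "Cod CC J = ctx_class T (B # ?K)"
    "Cmp CC J (carrow T \<Phi> \<Psi> f) = carrow T \<Phi> (B # ?K) (e0 # e' @ f)"
    "Cmp CC p J = carrow T \<Psi> ?K (s @ seg 0 ?n)"
    using lift[unfolded lifts_def, rule_format, of "carrow T \<Phi> (B # ?K) (e0 # e' @ f)" "carrow T \<Psi> ?K (s @ seg 0 ?n)"]
      carrow_Ar[OF wf(1) wfK(2) h] carrow_Ar[OF wf(2) wfK(1) k] sq unfolding p_def by auto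
  from cc_arr[OF J(1-3) wf(2) wfK(2)] obtain j where j: "ele \<Psi> j j (B # ?K)" "J = carrow T \<Psi> (B # ?K) j" by blast
  then obtain j0 jr where jj: "j = j0 # jr" by (cases j) auto
  have jr: "ele \<Psi> jr jr ?K" and j0: "tme \<Psi> j0 j0 (inst jr B)" using j(1) by (auto simp: jj)
  have ljr: "length jr = length ?K" using ele_length[OF jr] by simp
  have "ele \<Phi> (app j f) (e0 # e' @ f) (B # ?K)"
    using J(4) carrow_eq[OF wf(1) wfK(2) app_ele[OF wf(2) wfK(2) wf(1) j(1) f] h]
      cc_cmp[OF wf wfK(2) f j(1)] j(2) by simp
  then have j0f: "tme \<Phi> (subst ?\<rho> j0) e0 (inst (app jr f) B)" and jrf: "ele \<Phi> (app jr f) (e' @ f) ?K"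
    by (auto simp: jj app_def)
  have "ele \<Psi> (app (seg 1 (length ?K)) j) (s @ seg 0 ?n) ?K"
    using J(5) carrow_eq[OF wf(2) wfK(1) app_ele[OF wfK(2,1) wf(2) s1 j(1)] k]
      cc_cmp[OF wf(2) wfK(2,1) j(1) s1] j(2) by (simp add: p_def)
  \<comment> \<open>The tail of the lift is definitionally the section already chosen. Hence only
    its head j0 is kept, and its type is converted accordingly.\<close>
  then have jrs: "ele \<Psi> jr (s @ seg 0 ?n) ?K" using ljr by (simp add: jj app_seg_1)
  have B: "tye ?K B B" using wfK(2) Ty_iff by simp
  have "tye \<Psi> (inst jr B) (inst (s @ seg 0 ?n) B)"
    using sme_tye[OF sme_closed_cat[OF wfK(1) wf(2) jrs, of Var Var] B] by (simp add: tsub_cat)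
  moreover have "inst (s @ seg 0 ?n) B = inst s B"
    by (rule scoped_subst_cong[OF Ty_scoped]) (use wfK(2) ls in \<open>auto simp: tsub_cat cat_def\<close>)
  ultimately have "tme \<Psi> j0 j0 (inst s B)" using TmEq_conv[OF j0] by simp
  then have 1: "ele \<Psi> (j0 # s) (j0 # s) (B # \<Omega>)" using s(1) by simp
  have 2: "tye \<Phi> (inst (app jr f) B) (inst (app s f) (subst (ups (length \<Omega>) ?\<rho>) B))"
  proof -
    have K: "wfc (?K @ \<Phi>)" by (rule closed_wf[OF wfK(1) wf(1)])
    have "ele \<Phi> (app jr f) (app s f @ f) ?K"
      by (rule ele_trans[OF K jrf ele_sym[OF K]]) (rule ele_appendI[OF f s(2)])
    from sme_tye[OF sme_closed_cat[OF wfK(1) wf(1) this, of Var Var] B]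
    show ?thesis using ls by (simp add: tsub_cat cat_inst)
  qed
  have "tme \<Phi> (subst ?\<rho> j0) e0 (inst (app s f) (subst (ups (length \<Omega>) ?\<rho>) B))"
    by (rule TmEq_conv[OF j0f 2])
  then have "ele \<Phi> (app (j0 # s) f) e (subst_tele ?\<rho> (B # \<Omega>))"
    using s(2) by (simp add: e app_def)
  with 1 show ?case by blast
qed

text \<open>A diagonal filler against a display map is an element of the displayed type, pulled back
  along the bottom map, with prescribed value at the centre. That is based path induction for a
  single type.\<close>

lemma based_point_class_A:
  assumes \<Psi>: "wfc \<Psi>" and c: "ele [] c c \<Psi>"
  shows "carrow T [] (based \<Psi> c) (rl c @ c) \<in> class_A T"
proof -
  let ?E = "based \<Psi> c" and ?r = "rl c @ c"
  have nil: "wfc []" by simp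
  have E: "wfc ?E" using based_wf[OF \<Psi> nil c] by simp
  have r: "ele [] ?r ?r ?E"
    using based_ele[OF \<Psi> nil c c] rl_ele[of \<Psi> "[]"] \<Psi> c by simp
  have "lifts CC (carrow T [] ?E ?r) (carrow T (A # \<Gamma>) \<Gamma> (seg 1 (length \<Gamma>)))" if wfA: "wfc (A # \<Gamma>)" for A \<Gamma>
    unfolding lifts_def
  proof (intro ballI impI, elim conjE)
    fix X Y
    let ?p = "carrow T (A # \<Gamma>) \<Gamma> (seg 1 (length \<Gamma>))"
    assume X: "X \<in> Ar CC" "Dom CC X = Dom CC (carrow T [] ?E ?r)" "Cod CC X = Dom CC ?p"
      and Y: "Y \<in> Ar CC" "Dom CC Y = Cod CC (carrow T [] ?E ?r)" "Cod CC Y = Cod CC ?p"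
      and sq: "Cmp CC ?p X = Cmp CC Y (carrow T [] ?E ?r)"
    have wf\<Gamma>: "wfc \<Gamma>" using wfA by simp
    note s1 = seg_1_ele[OF wfA refl]
    from cc_arr[OF X(1) _ _ nil wfA] X obtain h where h: "ele [] h h (A # \<Gamma>)" "X = carrow T [] (A # \<Gamma>) h" by auto
    then obtain e0 e where he: "h = e0 # e" by (cases h) auto
    from cc_arr[OF Y(1) _ _ E wf\<Gamma>] Y obtain k where k: "ele ?E k k \<Gamma>" "Y = carrow T ?E \<Gamma> k" by auto
    have e: "ele [] e e \<Gamma>" and e0: "tme [] e0 e0 (inst e A)" using h(1) by (auto simp: he)
    have le: "length e = length \<Gamma>" using ele_length[OF e] by simp
    have lk: "length k = length \<Gamma>" using ele_length[OF k(1)] by simp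
    have kr: "ele [] (app k ?r) (app k ?r) \<Gamma>" by (rule app_ele[OF E wf\<Gamma> nil k(1) r])
    have ek: "ele [] e (app k ?r) \<Gamma>"
      using sq cc_cmp[OF nil wfA wf\<Gamma> h(1) s1] cc_cmp[OF nil E wf\<Gamma> r k(1)] carrow_eq[OF nil wf\<Gamma> e kr] le
      by (simp add: h(2) k(2) he app_seg_1)
    have A: "tye \<Gamma> A A" using wfA Ty_iff by simp
    \<comment> \<open>The family A pulled back along the bottom of the square.\<close>
    let ?B = "subst (cat k Var) A"
    have "tye ?E ?B ?B" using sme_tye[OF sme_closed_cat[OF wf\<Gamma> E k(1), of Var Var] A] .
    then have w: "wfc ([?B] @ ?E)" using E Ty_iff by simp
    have eqB: "inst [] (subst (cat ?r Var) ?B) = inst (app k ?r) A"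
    proof -
      have "subst (cat ?r Var \<odot> cat k Var) A = subst (cat (app k ?r) Var) A"
        by (rule scoped_subst_cong[OF Ty_scoped[of \<Gamma> A]])
          (use wfA lk in \<open>auto simp: cat_def scomp_def app_def simp del: cat_append\<close>)
      then show ?thesis by (simp add: tsub_cat)
    qed
    have "tye [] (inst e A) (inst (app k ?r) A)"
      using sme_tye[OF sme_closed_cat[OF wf\<Gamma> nil ek, of Var Var] A] by (simp add: tsub_cat)
    from TmEq_conv[OF e0 this] have "ele [] [e0] [e0] (subst_tele (cat ?r Var) [?B])"
      using eqB by (simp del: subst_subst)
    from based_path_induction[OF \<Psi> c w this] obtain j where j: "ele ?E j j [?B]" "ele [] (app j ?r) [e0] (subst_tele (cat ?r Var) [?B])"
      by blast
    then obtain j0 where jj: "j = [j0]" by (cases j) auto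
    have j0: "tme ?E j0 j0 (inst k A)" using j(1) by (simp add: jj tsub_cat)
    have jk: "ele ?E (j0 # k) (j0 # k) (A # \<Gamma>)" using j0 k(1) by simp
    have "tme [] (subst (cat ?r Var) j0) e0 (inst (app k ?r) A)"
      using j(2) eqB by (simp add: jj app_def del: subst_subst)
    then have "ele [] (app (j0 # k) ?r) (e0 # e) (A # \<Gamma>)"
      using ele_symC[OF wf\<Gamma> ek] by (simp add: app_def)
    then have 1: "Cmp CC (carrow T ?E (A # \<Gamma>) (j0 # k)) (carrow T [] ?E ?r) = X"
      using cc_cmp[OF nil E wfA r jk] carrow_eq[OF nil wfA app_ele[OF E wfA nil jk r] h(1)]
      by (simp add: h(2) he)
    have 2: "Cmp CC ?p (carrow T ?E (A # \<Gamma>) (j0 # k)) = Y"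
      using cc_cmp[OF E wfA wf\<Gamma> jk s1] lk by (simp add: k(2) app_seg_1)
    show "\<exists>j\<in>Ar CC. Dom CC j = Cod CC (carrow T [] ?E ?r) \<and> Cod CC j = Dom CC ?p \<and>
        Cmp CC j (carrow T [] ?E ?r) = X \<and> Cmp CC ?p j = Y"
      using 1 2 carrow_Ar[OF E wfA jk] by (intro bexI[of _ "carrow T ?E (A # \<Gamma>) (j0 # k)"]) auto
  qed
  then show ?thesis
    using carrow_Ar[OF nil E r] by (auto simp: class_A_def display_maps_eq)
qed

section \<open>The fundamental groupoid functor\<close>


abbreviation "Gpd \<equiv> fund_groupoid T"

text \<open>All reasoning about the fundamental groupoid is carried out on such representatives; the
  class-level operations are evaluated on them once.\<close>

definition arr :: "'s ctx \<Rightarrow> 's tup \<Rightarrow> 's tup \<Rightarrow> 's tup \<Rightarrow> 's garrow" where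
  "arr \<Phi> a b p = (pt_class T \<Phi> a, pt_class T \<Phi> b, path_class T \<Phi> a b p)"

definition path :: "'s ctx \<Rightarrow> 's tup \<Rightarrow> 's tup \<Rightarrow> 's tup \<Rightarrow> bool" where
  "path \<Phi> a b p \<longleftrightarrow> ele [] a a \<Phi> \<and> ele [] b b \<Phi> \<and> ele [] p p (Idc \<Phi> a b)"

lemma mem_pt_class: "a' \<in> pt_class T \<Phi> a \<longleftrightarrow> ele [] a a' \<Phi>"
  by (simp add: pt_class_def tup_class_def)

lemma mem_path_class: "q \<in> path_class T \<Phi> a b p \<longleftrightarrow> ele [] q q (Idc \<Phi> a b) \<and> hty (Idc \<Phi> a b) p q"
  by (simp add: path_class_def homotopic_def hty_def elem_iff)

lemma pt_class_eq:
  assumes "wfc \<Phi>" "ele [] b b \<Phi>"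
  shows "pt_class T \<Phi> a = pt_class T \<Phi> b \<longleftrightarrow> ele [] a b \<Phi>"
proof
  assume "pt_class T \<Phi> a = pt_class T \<Phi> b"
  then show "ele [] a b \<Phi>" using assms(2) mem_pt_class by blast
next
  assume ab: "ele [] a b \<Phi>"
  have "ele [] a x \<Phi> \<longleftrightarrow> ele [] b x \<Phi>" for x
    using ele_transC[OF assms(1) ab] ele_transC[OF assms(1) ele_symC[OF assms(1) ab]] by blast
  then show "pt_class T \<Phi> a = pt_class T \<Phi> b"
    by (simp add: set_eq_iff mem_pt_class)
qed

text \<open>The endpoints may change up to definitional equality, which changes the identity context
  up to conversion, and the path may change up to homotopy.\<close>

lemma path_class_eq:
  assumes \<Phi>: "wfc \<Phi>" and a: "ele [] a a' \<Phi>" and b: "ele [] b b' \<Phi>"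
    and p: "ele [] p p (Idc \<Phi> a b)" and p': "ele [] p' p' (Idc \<Phi> a' b')" and h: "hty (Idc \<Phi> a b) p p'"
  shows "path_class T \<Phi> a b p = path_class T \<Phi> a' b' p'"
proof -
  have w: "wfc (Idc \<Phi> a b)" by (rule Idc_wfC[OF \<Phi> ele_refl1[OF a] ele_refl1[OF b]])
  have t: "teq [] (Idc \<Phi> a b) (Idc \<Phi> a' b')" by (rule Idc_congC[OF \<Phi> a b])
  note t' = teq_sym[OF t]
  have p0: "ele [] p' p' (Idc \<Phi> a b)" by (rule ele_conv[OF t' p'])
  have "hty (Idc \<Phi> a b) p q \<longleftrightarrow> hty (Idc \<Phi> a' b') p' q" if q: "ele [] q q (Idc \<Phi> a b)" for q
  proof
    assume "hty (Idc \<Phi> a b) p q"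
    from hty_trans[OF w p0 p q hty_sym[OF w p p0 h] this]
    show "hty (Idc \<Phi> a' b') p' q" by (rule hty_conv[OF t p0 q])
  next
    assume "hty (Idc \<Phi> a' b') p' q"
    from hty_conv[OF t' p' ele_conv[OF t q] this] have "hty (Idc \<Phi> a b) p' q" .
    then show "hty (Idc \<Phi> a b) p q" by (rule hty_trans[OF w p p0 q h])
  qed
  then show ?thesis using ele_conv[OF t] ele_conv[OF t'] by (auto simp: set_eq_iff mem_path_class)
qed

lemma arr_eqI:
  assumes "wfc \<Phi>" "ele [] a a' \<Phi>" "ele [] b b' \<Phi>" "path \<Phi> a b p" "path \<Phi> a' b' p'" "hty (Idc \<Phi> a b) p p'"
  shows "arr \<Phi> a b p = arr \<Phi> a' b' p'"
  using assms path_class_eq pt_class_eq by (simp add: arr_def path_def)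

lemma arr_conv:
  assumes "wfc \<Phi>" "ele [] a a' \<Phi>" "ele [] b b' \<Phi>" "path \<Phi> a b p"
  shows "path \<Phi> a' b' p" "arr \<Phi> a b p = arr \<Phi> a' b' p"
proof -
  show 1: "path \<Phi> a' b' p"
    using assms ele_refl2C ele_conv[OF Idc_congC] by (simp add: path_def)
  show "arr \<Phi> a b p = arr \<Phi> a' b' p"
    using arr_eqI[OF assms 1] hty_refl Idc_wfC assms(1,4) by (simp add: path_def)
qed

lemma Ob_Gpd: "X \<in> Ob (Gpd \<Phi>) \<longleftrightarrow> (\<exists>a. ele [] a a \<Phi> \<and> X = pt_class T \<Phi> a)"
  by (auto simp: fund_groupoid_def elem_iff)

lemma Ar_Gpd: "A \<in> Ar (Gpd \<Phi>) \<longleftrightarrow> (\<exists>a b p. path \<Phi> a b p \<and> A = arr \<Phi> a b p)"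
  by (auto simp: fund_groupoid_def elem_iff arr_def path_def)

lemma arr_Ar: "path \<Phi> a b p \<Longrightarrow> arr \<Phi> a b p \<in> Ar (Gpd \<Phi>)"
  using Ar_Gpd by blast

lemma Dom_Cod_arr [simp]: "Dom (Gpd \<Phi>) (arr \<Phi> a b p) = pt_class T \<Phi> a" "Cod (Gpd \<Phi>) (arr \<Phi> a b p) = pt_class T \<Phi> b"
  by (simp_all add: fund_groupoid_def arr_def)

lemma path_rl: "wfc \<Phi> \<Longrightarrow> ele [] a a \<Phi> \<Longrightarrow> path \<Phi> a a (rl a)"
  using rl_ele[of \<Phi> "[]"] by (simp add: path_def)

lemma path_trs: "wfc \<Phi> \<Longrightarrow> path \<Phi> a b p \<Longrightarrow> path \<Phi> b c q \<Longrightarrow> path \<Phi> a c (transport b c q p)"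
  using trs_ele[of \<Phi> "[]" a b b c c p p q q] by (simp add: path_def)

lemma Idn_arr:
  assumes \<Phi>: "wfc \<Phi>" and a: "ele [] a a \<Phi>"
  shows "Idn (Gpd \<Phi>) (pt_class T \<Phi> a) = arr \<Phi> a a (rl a)"
proof -
  have nil: "wfc (\<Phi> @ [])" using \<Phi> by simp
  have main: "path_class T \<Phi> a' a' (rl a') = path_class T \<Phi> a a (rl a)" if "a' \<in> pt_class T \<Phi> a" for a'
  proof -
    have a': "ele [] a a' \<Phi>" using that mem_pt_class by simp
    have "ele [] (rl a) (rl a) (Idc \<Phi> a a)" "ele [] (rl a') (rl a') (Idc \<Phi> a' a')"
      using path_rl[OF \<Phi> a] path_rl[OF \<Phi> ele_refl2C[OF \<Phi> a']] by (simp_all add: path_def)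
    from path_class_eq[OF \<Phi> a' a' this hty_refl[OF Idc_wfC[OF \<Phi> a a] rl_ele[OF nil a']]]
    show ?thesis by (rule sym)
  qed
  have ne: "a \<in> pt_class T \<Phi> a" using a mem_pt_class by simp
  have "(\<Union>a'\<in>pt_class T \<Phi> a. path_class T \<Phi> a' a' (rl a')) = path_class T \<Phi> a a (rl a)"
    by (intro UN_eq_const main; (assumption | (use ne in blast)))
  then show ?thesis by (simp add: fund_groupoid_def arr_def)
qed

text \<open>Composition is a union over representatives of endpoints and paths. Congruence of
  transport accounts for the endpoints and \<open>trs_hty\<close> for the paths, so all members of
  the union agree.\<close>

lemma Cmp_arr:
  assumes \<Phi>: "wfc \<Phi>" and p: "path \<Phi> a b p" and q: "path \<Phi> b c q"
  shows "Cmp (Gpd \<Phi>) (arr \<Phi> b c q) (arr \<Phi> a b p) = arr \<Phi> a c (transport b c q p)"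
proof -
  have nil: "wfc []" by simp
  have a: "ele [] a a \<Phi>" and b: "ele [] b b \<Phi>" and c: "ele [] c c \<Phi>"
    and p0: "ele [] p p (Idc \<Phi> a b)" and q0: "ele [] q q (Idc \<Phi> b c)"
    using p q by (simp_all add: path_def)
  have main: "path_class T \<Phi> a' c' (transport b' c' q' p') = path_class T \<Phi> a c (transport b c q p)"
    if "a' \<in> pt_class T \<Phi> a" "b' \<in> pt_class T \<Phi> b" "c' \<in> pt_class T \<Phi> c"
      "p' \<in> path_class T \<Phi> a b p" "q' \<in> path_class T \<Phi> b c q" for a' b' c' p' q'
  proof -
    have a': "ele [] a a' \<Phi>" and b': "ele [] b b' \<Phi>" and c': "ele [] c c' \<Phi>"
      and p': "ele [] p' p' (Idc \<Phi> a b)" "hty (Idc \<Phi> a b) p p'"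
      and q': "ele [] q' q' (Idc \<Phi> b c)" "hty (Idc \<Phi> b c) q q'"
      using that by (simp_all add: mem_pt_class mem_path_class)
    have w: "wfc (Idc \<Phi> a c)" by (rule Idc_wfC[OF \<Phi> a c])
    have pp: "path \<Phi> a' b' p'" "path \<Phi> b' c' q'"
      using arr_conv(1)[OF \<Phi> a' b'] arr_conv(1)[OF \<Phi> b' c'] p' q' a b c by (simp_all add: path_def)
    have e: "ele [] (transport b c q' p') (transport b' c' q' p') (Idc \<Phi> a c)"
      by (rule trs_ele[OF \<Phi> nil a b' c' p'(1) q'(1)])
    have t: "ele [] (transport b c q p) (transport b c q p) (Idc \<Phi> a c)"
      by (rule trs_ele[OF \<Phi> nil a b c p0 q0])
    have "hty (Idc \<Phi> a c) (transport b c q p) (transport b' c' q' p')"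
      by (rule hty_trans[OF w t ele_refl1[OF e] ele_refl2C[OF w e]
          trs_hty[OF \<Phi> a b c p0 p' q0 q'] hty_refl[OF w e]])
    then show ?thesis
      using path_class_eq[OF \<Phi> a' c' t, symmetric] path_trs[OF \<Phi> pp] by (simp add: path_def)
  qed
  have ne: "a \<in> pt_class T \<Phi> a" "b \<in> pt_class T \<Phi> b" "c \<in> pt_class T \<Phi> c" using a b c by (simp_all add: mem_pt_class)
  have ne': "p \<in> path_class T \<Phi> a b p" "q \<in> path_class T \<Phi> b c q"
    using hty_refl[OF Idc_wfC[OF \<Phi> a b] p0] hty_refl[OF Idc_wfC[OF \<Phi> b c] q0] p0 q0
    by (simp_all add: mem_path_class)
  have "(\<Union>a'\<in>pt_class T \<Phi> a. \<Union>b'\<in>pt_class T \<Phi> b. \<Union>c'\<in>pt_class T \<Phi> c.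
      \<Union>p'\<in>path_class T \<Phi> a b p. \<Union>q'\<in>path_class T \<Phi> b c q. path_class T \<Phi> a' c' (transport b' c' q' p')) =
      path_class T \<Phi> a c (transport b c q p)"
    by (intro UN_eq_const main; (assumption | (use ne ne' in blast)))
  then show ?thesis by (simp add: fund_groupoid_def arr_def)
qed

text \<open>The middle objects agree only as classes, so the second path is converted to start at
  the representative where the first one ends.\<close>

lemma composable:
  assumes \<Phi>: "wfc \<Phi>" and "A \<in> Ar (Gpd \<Phi>)" "B \<in> Ar (Gpd \<Phi>)" "Cod (Gpd \<Phi>) A = Dom (Gpd \<Phi>) B"
  obtains a b c p q where "path \<Phi> a b p" "path \<Phi> b c q" "A = arr \<Phi> a b p" "B = arr \<Phi> b c q"
proof -
  from assms(2,3) obtain a b p b' c q where A: "path \<Phi> a b p" "A = arr \<Phi> a b p"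
    and B: "path \<Phi> b' c q" "B = arr \<Phi> b' c q" by (auto simp: Ar_Gpd)
  have b: "ele [] b' b \<Phi>"
    using assms(4) A B pt_class_eq[OF \<Phi>] by (simp add: path_def eq_commute)
  have c: "ele [] c c \<Phi>" using B by (simp add: path_def)
  from arr_conv[OF \<Phi> b c B(1)] A B that show thesis by metis
qed

lemma Gpd_groupoid:
  assumes \<Phi>: "wfc \<Phi>"
  shows "groupoid (Gpd \<Phi>)"
proof -
  let ?G = "Gpd \<Phi>"
  have Idn: "Idn ?G X \<in> Ar ?G \<and> Dom ?G (Idn ?G X) = X \<and> Cod ?G (Idn ?G X) = X" if "X \<in> Ob ?G" for X
  proof -
    from that obtain a where a: "ele [] a a \<Phi>" "X = pt_class T \<Phi> a" by (auto simp: Ob_Gpd)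
    then show ?thesis using Idn_arr[OF \<Phi> a(1)] arr_Ar[OF path_rl[OF \<Phi> a(1)]] by simp
  qed
  have unit: "Cmp ?G A (Idn ?G (Dom ?G A)) = A \<and> Cmp ?G (Idn ?G (Cod ?G A)) A = A" if "A \<in> Ar ?G" for A
  proof -
    from that obtain a b p where A: "path \<Phi> a b p" "A = arr \<Phi> a b p" by (auto simp: Ar_Gpd)
    have e: "ele [] a a \<Phi>" "ele [] b b \<Phi>" "ele [] p p (Idc \<Phi> a b)" using A by (simp_all add: path_def)
    note r = path_rl[OF \<Phi> e(1)] path_rl[OF \<Phi> e(2)]
    have w: "wfc (Idc \<Phi> a b)" by (rule Idc_wfC[OF \<Phi> e(1,2)])
    have nil: "wfc []" by simp
    have "arr \<Phi> a b (transport a b p (rl a)) = arr \<Phi> a b p"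
      by (rule arr_eqI[OF \<Phi> e(1,2) path_trs[OF \<Phi> r(1) A(1)] A(1) trs_unit[OF \<Phi> e]])
    moreover have "arr \<Phi> a b (transport b b (rl b) p) = arr \<Phi> a b p"
      by (rule arr_eqI[OF \<Phi> e(1,2) path_trs[OF \<Phi> A(1) r(2)] A(1) hty_refl[OF w trs_rl[OF \<Phi> nil e]]])
    ultimately show ?thesis
      using Cmp_arr[OF \<Phi> r(1) A(1)] Cmp_arr[OF \<Phi> A(1) r(2)] by (simp add: A(2) Idn_arr[OF \<Phi>] e)
  qed
  have comp: "Cmp ?G B A \<in> Ar ?G \<and> Dom ?G (Cmp ?G B A) = Dom ?G A \<and> Cod ?G (Cmp ?G B A) = Cod ?G B"
    if h: "A \<in> Ar ?G" "B \<in> Ar ?G" "Cod ?G A = Dom ?G B" for A B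
  proof -
    from composable[OF \<Phi> h] obtain a b c p q where A: "path \<Phi> a b p" "path \<Phi> b c q" "A = arr \<Phi> a b p" "B = arr \<Phi> b c q" .
    then show ?thesis using Cmp_arr[OF \<Phi> A(1,2)] arr_Ar[OF path_trs[OF \<Phi> A(1,2)]] by simp
  qed
  have assoc: "Cmp ?G C (Cmp ?G B A) = Cmp ?G (Cmp ?G C B) A"
    if h: "A \<in> Ar ?G" "B \<in> Ar ?G" "C \<in> Ar ?G" "Cod ?G A = Dom ?G B" "Cod ?G B = Dom ?G C" for A B C
  proof -
    from composable[OF \<Phi> h(1,2,4)] obtain a b c p q
      where A: "path \<Phi> a b p" "path \<Phi> b c q" "A = arr \<Phi> a b p" "B = arr \<Phi> b c q" .
    from h(3) obtain c' d s where C: "path \<Phi> c' d s" "C = arr \<Phi> c' d s" by (auto simp: Ar_Gpd)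
    have c': "ele [] c' c \<Phi>"
      using h(5) A C pt_class_eq[OF \<Phi>] by (simp add: path_def eq_commute)
    have d: "ele [] d d \<Phi>" using C by (simp add: path_def)
    note C' = arr_conv[OF \<Phi> c' d C(1)]
    have e: "ele [] a a \<Phi>" "ele [] b b \<Phi>" "ele [] c c \<Phi>" "ele [] p p (Idc \<Phi> a b)" "ele [] q q (Idc \<Phi> b c)"
      "ele [] s s (Idc \<Phi> c d)" using A C' by (simp_all add: path_def)
    note t1 = path_trs[OF \<Phi> A(1,2)] and t2 = path_trs[OF \<Phi> A(2) C'(1)]
    have "arr \<Phi> a d (transport c d s (transport b c q p)) = arr \<Phi> a d (transport b d (transport c d s q) p)"
      by (rule arr_eqI[OF \<Phi> e(1) d path_trs[OF \<Phi> t1 C'(1)] path_trs[OF \<Phi> A(1) t2] trs_assoc[OF \<Phi> e(1,2,3) d e(4-6)]])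
    then show ?thesis
      by (simp add: A(3,4) C(2) C'(2) Cmp_arr[OF \<Phi> A(1,2)] Cmp_arr[OF \<Phi> A(2) C'(1)]
          Cmp_arr[OF \<Phi> t1 C'(1)] Cmp_arr[OF \<Phi> A(1) t2])
  qed
  have dc: "Dom ?G A \<in> Ob ?G \<and> Cod ?G A \<in> Ob ?G" if "A \<in> Ar ?G" for A
  proof -
    from that obtain a b p where "path \<Phi> a b p" "A = arr \<Phi> a b p" by (auto simp: Ar_Gpd)
    then show ?thesis by (auto simp: path_def Ob_Gpd)
  qed
  have "category ?G"
    unfolding category_def
  proof (intro conjI ballI impI)
    fix A B C assume h: "A \<in> Ar ?G" "B \<in> Ar ?G" "C \<in> Ar ?G" "Cod ?G A = Dom ?G B" "Cod ?G B = Dom ?G C"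
    show "Cmp ?G C (Cmp ?G B A) = Cmp ?G (Cmp ?G C B) A" by (rule assoc[OF h])
  next
    fix A B assume h: "A \<in> Ar ?G" "B \<in> Ar ?G" "Cod ?G A = Dom ?G B"
    show "Cmp ?G B A \<in> Ar ?G" "Dom ?G (Cmp ?G B A) = Dom ?G A" "Cod ?G (Cmp ?G B A) = Cod ?G B"
      using comp[OF h] by simp_all
  next
    fix A assume h: "A \<in> Ar ?G"
    show "Cmp ?G A (Idn ?G (Dom ?G A)) = A" "Cmp ?G (Idn ?G (Cod ?G A)) A = A"
      "Dom ?G A \<in> Ob ?G" "Cod ?G A \<in> Ob ?G"
      using unit[OF h] dc[OF h] by simp_all
  next
    fix X assume h: "X \<in> Ob ?G"
    show "Idn ?G X \<in> Ar ?G" "Dom ?G (Idn ?G X) = X" "Cod ?G (Idn ?G X) = X"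
      using Idn[OF h] by simp_all
  qed
  moreover have "is_iso ?G A" if "A \<in> Ar ?G" for A
  proof -
    from that obtain a b p where A: "path \<Phi> a b p" "A = arr \<Phi> a b p" by (auto simp: Ar_Gpd)
    have e: "ele [] a a \<Phi>" "ele [] b b \<Phi>" "ele [] p p (Idc \<Phi> a b)" using A by (simp_all add: path_def)
    from trs_inv[OF \<Phi> e] obtain q where q: "ele [] q q (Idc \<Phi> b a)"
      "hty (Idc \<Phi> a a) (transport b a q p) (rl a)" "hty (Idc \<Phi> b b) (transport a b p q) (rl b)" .
    have q': "path \<Phi> b a q" using e q by (simp add: path_def)
    note r = path_rl[OF \<Phi> e(1)] path_rl[OF \<Phi> e(2)]
    have "arr \<Phi> a a (transport b a q p) = arr \<Phi> a a (rl a)"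
      by (rule arr_eqI[OF \<Phi> e(1,1) path_trs[OF \<Phi> A(1) q'] r(1) q(2)])
    moreover have "arr \<Phi> b b (transport a b p q) = arr \<Phi> b b (rl b)"
      by (rule arr_eqI[OF \<Phi> e(2,2) path_trs[OF \<Phi> q' A(1)] r(2) q(3)])
    ultimately show ?thesis
      unfolding is_iso_def using that q'
      by (intro conjI bexI[of _ "arr \<Phi> b a q"])
        (simp_all add: A(2) Cmp_arr[OF \<Phi> A(1) q'] Cmp_arr[OF \<Phi> q' A(1)] Idn_arr[OF \<Phi>] e arr_Ar[OF q'])
  qed
  ultimately show ?thesis by (simp add: groupoid_def)
qed

section \<open>The action of a context morphism on points and paths\<close>

lemma fund_ob_pt:
  assumes wf: "wfc \<Phi>" "wfc \<Psi>" and f: "ele \<Phi> f f \<Psi>" and a: "ele [] a a \<Phi>"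
  shows "fund_ob T \<Psi> f (pt_class T \<Phi> a) = pt_class T \<Psi> (app f a)"
proof -
  have nil: "wfc []" by simp
  have main: "pt_class T \<Psi> (app f a') = pt_class T \<Psi> (app f a)" if "a' \<in> pt_class T \<Phi> a" for a'
  proof -
    have "ele [] a' a \<Phi>" using that ele_symC[OF wf(1)] by (simp add: mem_pt_class)
    with pt_class_eq[OF wf(2) app_ele[OF wf nil f a]] app_ele[OF wf nil f] show ?thesis by blast
  qed
  have ne: "a \<in> pt_class T \<Phi> a" using a by (simp add: mem_pt_class)
  show ?thesis unfolding fund_ob_def tup_comp_app
    by (intro UN_eq_const main; (assumption | (use ne in blast)))
qed

lemma path_ap: "wfc \<Phi> \<Longrightarrow> wfc \<Psi> \<Longrightarrow> ele \<Phi> f f \<Psi> \<Longrightarrow> path \<Phi> a b p \<Longrightarrow> path \<Psi> (app f a) (app f b) (ap f a b p)"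
  using ap_ele[of \<Phi> \<Psi> f "[]" a a b b p p] app_ele[of \<Phi> \<Psi> "[]" f f] by (simp add: path_def)

lemma fund_ar_arr:
  assumes wf: "wfc \<Phi>" "wfc \<Psi>" and f: "ele \<Phi> f f \<Psi>" and p: "path \<Phi> a b p"
  shows "fund_ar T \<Psi> f (arr \<Phi> a b p) = arr \<Psi> (app f a) (app f b) (ap f a b p)"
proof -
  have nil: "wfc []" by simp
  have a: "ele [] a a \<Phi>" and b: "ele [] b b \<Phi>" and p0: "ele [] p p (Idc \<Phi> a b)"
    using p by (simp_all add: path_def)
  have main: "path_class T \<Psi> (app f a') (app f b') (ap f a' b' p') = path_class T \<Psi> (app f a) (app f b) (ap f a b p)"
    if "a' \<in> pt_class T \<Phi> a" "b' \<in> pt_class T \<Phi> b" "p' \<in> path_class T \<Phi> a b p" for a' b' p'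
  proof -
    have a': "ele [] a a' \<Phi>" and b': "ele [] b b' \<Phi>" and p': "ele [] p' p' (Idc \<Phi> a b)" "hty (Idc \<Phi> a b) p p'"
      using that by (simp_all add: mem_pt_class mem_path_class)
    have pp: "path \<Phi> a b p'" "path \<Phi> a' b' p'"
      using arr_conv(1)[OF wf(1) a' b'] p' a b by (simp_all add: path_def)
    have w: "wfc (Idc \<Psi> (app f a) (app f b))"
      using Idc_wfC[OF wf(2) app_ele[OF wf nil f a] app_ele[OF wf nil f b]] .
    have e: "ele [] (ap f a b p') (ap f a' b' p') (Idc \<Psi> (app f a) (app f b))"
      by (rule ap_ele[OF wf f nil a' b' p'(1)])
    have t: "ele [] (ap f a b p) (ap f a b p) (Idc \<Psi> (app f a) (app f b))"
      by (rule ap_ele[OF wf f nil a b p0])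
    have "hty (Idc \<Psi> (app f a) (app f b)) (ap f a b p) (ap f a' b' p')"
      by (rule hty_trans[OF w t ele_refl1[OF e] ele_refl2C[OF w e] ap_hty[OF wf f a b p0 p'] hty_refl[OF w e]])
    then show ?thesis
      using path_class_eq[OF wf(2) app_ele[OF wf nil f a'] app_ele[OF wf nil f b'] t, symmetric] path_ap[OF wf f pp(2)]
      by (simp add: path_def)
  qed
  have ne: "a \<in> pt_class T \<Phi> a" "b \<in> pt_class T \<Phi> b" "p \<in> path_class T \<Phi> a b p"
    using a b hty_refl[OF Idc_wfC[OF wf(1) a b] p0] p0 by (simp_all add: mem_pt_class mem_path_class)
  have "(\<Union>a'\<in>pt_class T \<Phi> a. \<Union>b'\<in>pt_class T \<Phi> b. \<Union>p'\<in>path_class T \<Phi> a b p.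
      path_class T \<Psi> (app f a') (app f b') (ap f a' b' p')) = path_class T \<Psi> (app f a) (app f b) (ap f a b p)"
    by (intro UN_eq_const main; (assumption | (use ne in blast)))
  then show ?thesis
    using fund_ob_pt[OF wf f a] fund_ob_pt[OF wf f b] by (simp add: fund_ar_def arr_def tup_comp_app)
qed

lemma fund_functor:
  assumes wf: "wfc \<Phi>" "wfc \<Psi>" and f: "ele \<Phi> f f \<Psi>"
  shows "is_functor (Gpd \<Phi>) (Gpd \<Psi>) (fund_ob T \<Psi> f) (fund_ar T \<Psi> f)"
  unfolding is_functor_def
proof (intro conjI ballI impI)
  have nil: "wfc []" by simp
  show "category (Gpd \<Phi>)" "category (Gpd \<Psi>)" using Gpd_groupoid wf by (simp_all add: groupoid_def)
  { fix X assume "X \<in> Ob (Gpd \<Phi>)"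
    then obtain a where a: "ele [] a a \<Phi>" "X = pt_class T \<Phi> a" by (auto simp: Ob_Gpd)
    have fa: "ele [] (app f a) (app f a) \<Psi>" by (rule app_ele[OF wf nil f a(1)])
    then show "fund_ob T \<Psi> f X \<in> Ob (Gpd \<Psi>)" using fund_ob_pt[OF wf f a(1)] by (auto simp: a(2) Ob_Gpd)
    have "ele [] (ap f a a (rl a)) (rl (app f a)) (Idc \<Psi> (app f a) (app f a))" by (rule ap_rl[OF wf f nil a(1)])
    then have "arr \<Psi> (app f a) (app f a) (ap f a a (rl a)) = arr \<Psi> (app f a) (app f a) (rl (app f a))"
      using arr_eqI[OF wf(2) fa fa path_ap[OF wf f path_rl[OF wf(1) a(1)]] path_rl[OF wf(2) fa]]
        hty_refl[OF Idc_wfC[OF wf(2) fa fa]] by blast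
    then show "fund_ar T \<Psi> f (Idn (Gpd \<Phi>) X) = Idn (Gpd \<Psi>) (fund_ob T \<Psi> f X)"
      by (simp add: a(2) Idn_arr[OF wf(1) a(1)] fund_ob_pt[OF wf f a(1)] Idn_arr[OF wf(2) fa]
          fund_ar_arr[OF wf f path_rl[OF wf(1) a(1)]]) }
  { fix A assume "A \<in> Ar (Gpd \<Phi>)"
    then obtain a b p where A: "path \<Phi> a b p" "A = arr \<Phi> a b p" by (auto simp: Ar_Gpd)
    then have e: "ele [] a a \<Phi>" "ele [] b b \<Phi>" by (simp_all add: path_def)
    note F = fund_ar_arr[OF wf f A(1)]
    show "fund_ar T \<Psi> f A \<in> Ar (Gpd \<Psi>)" using arr_Ar[OF path_ap[OF wf f A(1)]] by (simp add: A(2) F)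
    show "Dom (Gpd \<Psi>) (fund_ar T \<Psi> f A) = fund_ob T \<Psi> f (Dom (Gpd \<Phi>) A)"
      "Cod (Gpd \<Psi>) (fund_ar T \<Psi> f A) = fund_ob T \<Psi> f (Cod (Gpd \<Phi>) A)"
      by (simp_all add: A(2) F fund_ob_pt[OF wf f] e) }
  { fix A B assume h: "A \<in> Ar (Gpd \<Phi>)" "B \<in> Ar (Gpd \<Phi>)" "Cod (Gpd \<Phi>) A = Dom (Gpd \<Phi>) B"
    from composable[OF wf(1) h] obtain a b c p q
      where A: "path \<Phi> a b p" "path \<Phi> b c q" "A = arr \<Phi> a b p" "B = arr \<Phi> b c q" .
    then have e: "ele [] a a \<Phi>" "ele [] b b \<Phi>" "ele [] c c \<Phi>" "ele [] p p (Idc \<Phi> a b)" "ele [] q q (Idc \<Phi> b c)"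
      by (simp_all add: path_def)
    note pp = path_ap[OF wf f A(1)] path_ap[OF wf f A(2)] path_trs[OF wf(1) A(1,2)]
    have "arr \<Psi> (app f a) (app f c) (ap f a c (transport b c q p)) =
        arr \<Psi> (app f a) (app f c) (transport (app f b) (app f c) (ap f b c q) (ap f a b p))"
      by (rule arr_eqI[OF wf(2) app_ele[OF wf nil f e(1)] app_ele[OF wf nil f e(3)] path_ap[OF wf f pp(3)]
            path_trs[OF wf(2) pp(1,2)] ap_trs[OF wf f e]])
    then show "fund_ar T \<Psi> f (Cmp (Gpd \<Phi>) B A) = Cmp (Gpd \<Psi>) (fund_ar T \<Psi> f B) (fund_ar T \<Psi> f A)"
      by (simp add: A(3,4) Cmp_arr[OF wf(1) A(1,2)] fund_ar_arr[OF wf f A(1)] fund_ar_arr[OF wf f A(2)]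
          fund_ar_arr[OF wf f pp(3)] Cmp_arr[OF wf(2) pp(1,2)]) }
qed

section \<open>Equivalence for maps in the first class\<close>

lemma class_A_retraction:
  assumes A: "carrow T \<Phi> \<Psi> f \<in> class_A T" and wf: "wfc \<Phi>" "wfc \<Psi>" and f: "ele \<Phi> f f \<Psi>"
  obtains s \<theta> where "ele \<Psi> s s \<Phi>" "ele \<Phi> (app s f) (seg 0 (length \<Phi>)) \<Phi>"
    "ele \<Psi> \<theta> \<theta> (Idc \<Psi> (app f s) (seg 0 (length \<Psi>)))"
proof -
  have nil: "wfc []" by simp
  have v: "ele \<Phi> (seg 0 (length \<Phi>)) (seg 0 (length \<Phi>)) \<Phi>" "ele \<Psi> (seg 0 (length \<Psi>)) (seg 0 (length \<Psi>)) \<Psi>"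
    using closed_ele_seg[OF wf(1) nil] closed_ele_seg[OF wf(2) nil] by simp_all
  \<comment> \<open>As \<Phi> is closed it is a constant family over \<Psi>, and the identity of
    \<Phi> is its element to be extended along f.\<close>
  obtain s where s: "ele \<Psi> s s \<Phi>" "ele \<Phi> (app s f) (seg 0 (length \<Phi>)) \<Phi>"
    using class_A_lift[OF A wf f closed_wf[OF wf(1,2)], of "seg 0 (length \<Phi>)"] v wf(1) by (auto simp: subst_tele_closed)
  have lf: "length f = length \<Psi>" and ls: "length s = length \<Phi>" using ele_length[OF f] ele_length[OF s(1)] by simp_all
  have fs: "ele \<Psi> (app f s) (app f s) \<Psi>" by (rule app_ele[OF wf wf(2) f s(1)])
  have w: "wfc (Idc \<Psi> (app f s) (seg 0 (length \<Psi>)) @ \<Psi>)" by (rule Idc_closed_wf[OF wf(2,2) fs v(2)])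
  have "subst_tele (cat f Var) (Idc \<Psi> (app f s) (seg 0 (length \<Psi>))) = Idc \<Psi> (app f (app s f)) f"
    using lf ls wf(2) by (simp add: Idc_closed_subst app_subst[OF f] sb_seg_hit) (simp add: app_def)
  \<comment> \<open>By the retraction equation f(s(f(x))) = f(x) definitionally, so reflexivity at f
    has the type required for the second lift.\<close>
  moreover have "ele \<Phi> f (app f (app s f)) \<Psi>"
    using app_ele[OF wf wf(1) f s(2)] app_vars[OF f] ele_sym[OF closed_wf[OF wf(2,1)]] by simp
  then have "teq \<Phi> (Idc \<Psi> f f) (Idc \<Psi> (app f (app s f)) f)"
    using Idc_cong f closed_wf[OF wf(2,1)] teq_refl by blast
  then have "ele \<Phi> (rl f) (rl f) (Idc \<Psi> (app f (app s f)) f)"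
    by (rule ele_conv[OF _ rl_ele[OF closed_wf[OF wf(2,1)] f]])
  ultimately obtain \<theta> where "ele \<Psi> \<theta> \<theta> (Idc \<Psi> (app f s) (seg 0 (length \<Psi>)))"
    using class_A_lift[OF A wf f w, of "rl f"] by auto
  with s show thesis by (rule that)
qed

lemma class_A_equivalence:
  assumes A: "carrow T \<Phi> \<Psi> f \<in> class_A T" and wf: "wfc \<Phi>" "wfc \<Psi>" and f: "ele \<Phi> f f \<Psi>"
  shows "equivalence_of_categories (Gpd \<Phi>) (Gpd \<Psi>) (fund_ob T \<Psi> f) (fund_ar T \<Psi> f) \<and>
    inj_on (fund_ob T \<Psi> f) (Ob (Gpd \<Phi>))"
proof -
  have nil: "wfc []" by simp
  note wf' = wf(2,1)
  obtain s \<theta> where s: "ele \<Psi> s s \<Phi>" and sf: "ele \<Phi> (app s f) (seg 0 (length \<Phi>)) \<Phi>"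
    and \<theta>: "ele \<Psi> \<theta> \<theta> (Idc \<Psi> (app f s) (seg 0 (length \<Psi>)))"
    by (rule class_A_retraction[OF A wf f])
  have lf: "length f = length \<Psi>" and ls: "length s = length \<Phi>" using ele_length[OF f] ele_length[OF s] by simp_all
  have r: "ele [] (app s (app f x)) x \<Phi>" if "ele [] x x \<Phi>" for x
  proof -
    have "app (seg 0 (length \<Phi>)) x = x"
      using ele_length[OF that] by (simp add: app_def sb_seg_hit)
    then show ?thesis
      using app_ele[OF wf(1,1) nil sf that] app_app[OF s lf, of x] by simp
  qed
  let ?F = "fund_ob T \<Psi> f" and ?Fa = "fund_ar T \<Psi> f" and ?G = "fund_ob T \<Phi> s" and ?Ga = "fund_ar T \<Phi> s"
  note Gr = Gpd_groupoid[OF wf(1)] Gpd_groupoid[OF wf(2)]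
  have fe: "ele [] (app f x) (app f x) \<Psi>" if "ele [] x x \<Phi>" for x by (rule app_ele[OF wf nil f that])
  have se: "ele [] (app s x) (app s x) \<Phi>" if "ele [] x x \<Psi>" for x by (rule app_ele[OF wf' nil s that])
  have GF: "?G (?F X) = X" if "X \<in> Ob (Gpd \<Phi>)" for X
  proof -
    from that obtain a where a: "ele [] a a \<Phi>" "X = pt_class T \<Phi> a" by (auto simp: Ob_Gpd)
    have "pt_class T \<Phi> (app s (app f a)) = pt_class T \<Phi> a"
      using pt_class_eq[OF wf(1) a(1)] r[OF a(1)] by simp
    then show ?thesis by (simp add: a(2) fund_ob_pt[OF wf f a(1)] fund_ob_pt[OF wf' s fe[OF a(1)]])
  qed
  have GFa: "?Ga (?Fa B) = B" if "B \<in> Ar (Gpd \<Phi>)" for B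
  proof -
    from that obtain a b p where B: "path \<Phi> a b p" "B = arr \<Phi> a b p" by (auto simp: Ar_Gpd)
    then have e: "ele [] a a \<Phi>" "ele [] b b \<Phi>" "ele [] p p (Idc \<Phi> a b)" by (simp_all add: path_def)
    note pf = path_ap[OF wf f B(1)]
    note c = arr_conv[OF wf(1) r[OF e(1)] r[OF e(2)] path_ap[OF wf' s pf]]
    have "arr \<Phi> a b (ap s (app f a) (app f b) (ap f a b p)) = arr \<Phi> a b p"
      by (rule arr_eqI[OF wf(1) e(1,2) c(1) B(1) ap_retraction[OF wf f s sf e]])
    then show ?thesis
      by (simp add: B(2) fund_ar_arr[OF wf f B(1)] fund_ar_arr[OF wf' s pf] c(2))
  qed
  have inj: "inj_on ?F (Ob (Gpd \<Phi>))" by (rule inj_on_inverseI[where g = ?G]) (rule GF)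
  have cat: "category (Gpd \<Phi>)" "category (Gpd \<Psi>)" using Gr by (simp_all add: groupoid_def)
  \<comment> \<open>The composite on this side is strictly the identity on objects and arrows, so
    identities serve as components.\<close>
  have \<eta>: "nat_iso (Gpd \<Phi>) (Gpd \<Phi>) (\<lambda>X. X) (\<lambda>f. f) (?G \<circ> ?F) (?Ga \<circ> ?Fa) (Idn (Gpd \<Phi>))"
    unfolding nat_iso_def
  proof (intro conjI ballI)
    fix X assume X: "X \<in> Ob (Gpd \<Phi>)"
    then show "is_iso (Gpd \<Phi>) (Idn (Gpd \<Phi>) X)" "Dom (Gpd \<Phi>) (Idn (Gpd \<Phi>) X) = X"
        "Cod (Gpd \<Phi>) (Idn (Gpd \<Phi>) X) = (?G \<circ> ?F) X"
      using cat(1) Gr(1) GF[OF X] by (simp_all add: category_def groupoid_def)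
  next
    fix B assume B: "B \<in> Ar (Gpd \<Phi>)"
    then show "Cmp (Gpd \<Phi>) (Idn (Gpd \<Phi>) (Cod (Gpd \<Phi>) B)) B = Cmp (Gpd \<Phi>) ((?Ga \<circ> ?Fa) B) (Idn (Gpd \<Phi>) (Dom (Gpd \<Phi>) B))"
      using cat(1) GFa[OF B] by (simp add: category_def)
  qed
  \<comment> \<open>Objects are classes of points, so a representative is chosen to evaluate
    \<theta>; congruence shows below that the resulting arrow is independent of the choice.\<close>
  define \<epsilon> where "\<epsilon> Y = (let y = (SOME y. y \<in> Y) in arr \<Psi> (app f (app s y)) y (app \<theta> y))" for Y
  have v: "ele \<Psi> (seg 0 (length \<Psi>)) (seg 0 (length \<Psi>)) \<Psi>"
    using closed_ele_seg[OF wf(2) nil] by simp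
  have \<theta>_ty: "subst_tele (cat x Var) (Idc \<Psi> (app f s) (seg 0 (length \<Psi>))) = Idc \<Psi> (app f (app s x)) x"
    if "length x = length \<Psi>" for x
    using that lf ls wf(2) by (simp add: Idc_closed_subst app_subst[OF f] sb_seg_hit) (simp add: app_def)
  have \<theta>e: "ele [] (app \<theta> y) (app \<theta> y') (Idc \<Psi> (app f (app s y)) y)" if "ele [] y y' \<Psi>" for y y'
    using app_ele_dep[OF wf(2) nil \<theta> that] \<theta>_ty[of y] ele_length[OF that] by simp
  have \<theta>p: "path \<Psi> (app f (app s y)) y (app \<theta> y)" if "ele [] y y \<Psi>" for y
    using that \<theta>e[OF that] fe[OF se[OF that]] by (simp add: path_def)
  have \<epsilon>: "\<epsilon> (pt_class T \<Psi> y) = arr \<Psi> (app f (app s y)) y (app \<theta> y)" if y: "ele [] y y \<Psi>" for y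
  proof -
    define y' where "y' = (SOME y'. y' \<in> pt_class T \<Psi> y)"
    have "y' \<in> pt_class T \<Psi> y" unfolding y'_def by (rule someI[of _ y]) (simp add: mem_pt_class y)
    then have y': "ele [] y y' \<Psi>" by (simp add: mem_pt_class)
    have "arr \<Psi> (app f (app s y)) y (app \<theta> y) = arr \<Psi> (app f (app s y')) y' (app \<theta> y')"
      by (rule arr_eqI[OF wf(2) app_ele[OF wf nil f app_ele[OF wf' nil s y']] y' \<theta>p[OF y] \<theta>p[OF ele_refl2C[OF wf(2) y']]
            hty_refl[OF Idc_wfC[OF wf(2) fe[OF se[OF y]] y] \<theta>e[OF y']]])
    then show ?thesis by (simp add: \<epsilon>_def y'_def Let_def)
  qed
  have \<epsilon>_nat: "nat_iso (Gpd \<Psi>) (Gpd \<Psi>) (?F \<circ> ?G) (?Fa \<circ> ?Ga) (\<lambda>Y. Y) (\<lambda>g. g) \<epsilon>"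
    unfolding nat_iso_def
  proof (intro conjI ballI)
    fix Y assume "Y \<in> Ob (Gpd \<Psi>)"
    then obtain y where y: "ele [] y y \<Psi>" "Y = pt_class T \<Psi> y" by (auto simp: Ob_Gpd)
    have "\<epsilon> Y \<in> Ar (Gpd \<Psi>)" using arr_Ar[OF \<theta>p[OF y(1)]] by (simp add: y(2) \<epsilon>[OF y(1)])
    then show "is_iso (Gpd \<Psi>) (\<epsilon> Y)" using Gr(2) by (simp add: groupoid_def)
    show "Dom (Gpd \<Psi>) (\<epsilon> Y) = (?F \<circ> ?G) Y" "Cod (Gpd \<Psi>) (\<epsilon> Y) = Y"
      by (simp_all add: y(2) \<epsilon>[OF y(1)] fund_ob_pt[OF wf' s y(1)] fund_ob_pt[OF wf f se[OF y(1)]])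
  next
    fix B assume "B \<in> Ar (Gpd \<Psi>)"
    then obtain a b q where B: "path \<Psi> a b q" "B = arr \<Psi> a b q" by (auto simp: Ar_Gpd)
    then have e: "ele [] a a \<Psi>" "ele [] b b \<Psi>" "ele [] q q (Idc \<Psi> a b)" by (simp_all add: path_def)
    let ?z = "app f (app s a)" and ?z' = "app f (app s b)" and ?q = "ap f (app s a) (app s b) (ap s a b q)"
    note za = fe[OF se[OF e(1)]]
    note pq = path_ap[OF wf f path_ap[OF wf' s B(1)]]
    note rz = path_rl[OF wf(2) za]
    note t1 = path_trs[OF wf(2) rz pq] and t2 = path_trs[OF wf(2) \<theta>p[OF e(1)] B(1)]
    note t3 = path_trs[OF wf(2) pq \<theta>p[OF e(2)]]
    have eq: "arr \<Psi> ?z b (transport ?z' b (app \<theta> b) (transport ?z ?z' ?q (rl ?z))) =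
        arr \<Psi> ?z b (transport ?z b (transport a b q (app \<theta> a)) (rl ?z))"
      by (rule arr_eqI[OF wf(2) za e(2) path_trs[OF wf(2) t1 \<theta>p[OF e(2)]] path_trs[OF wf(2) rz t2]
            ap_natural[OF wf f s \<theta> e]])
    \<comment> \<open>The unit law of the groupoid removes the reflexivity factors that
      \<open>ap_natural\<close> carries.\<close>
    have unit: "Cmp (Gpd \<Psi>) C (arr \<Psi> ?z ?z (rl ?z)) = C" if "C \<in> Ar (Gpd \<Psi>)" "Dom (Gpd \<Psi>) C = pt_class T \<Psi> ?z" for C
      using that cat(2) Idn_arr[OF wf(2) za] unfolding category_def by metis
    have u1: "arr \<Psi> ?z ?z' (transport ?z ?z' ?q (rl ?z)) = arr \<Psi> ?z ?z' ?q"
      using unit[of "arr \<Psi> ?z ?z' ?q"] Cmp_arr[OF wf(2) rz pq] arr_Ar[OF pq] by simp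
    have u2: "arr \<Psi> ?z b (transport ?z b (transport a b q (app \<theta> a)) (rl ?z)) = arr \<Psi> ?z b (transport a b q (app \<theta> a))"
      using unit[of "arr \<Psi> ?z b (transport a b q (app \<theta> a))"] Cmp_arr[OF wf(2) rz t2] arr_Ar[OF t2] by simp
    have "Cmp (Gpd \<Psi>) (arr \<Psi> ?z' b (app \<theta> b)) (arr \<Psi> ?z ?z' ?q) = Cmp (Gpd \<Psi>) (arr \<Psi> a b q) (arr \<Psi> ?z a (app \<theta> a))"
      using eq Cmp_arr[OF wf(2) t1 \<theta>p[OF e(2)]] Cmp_arr[OF wf(2) \<theta>p[OF e(1)] B(1)] by (simp add: u1 u2)
    then show "Cmp (Gpd \<Psi>) (\<epsilon> (Cod (Gpd \<Psi>) B)) ((?Fa \<circ> ?Ga) B) = Cmp (Gpd \<Psi>) B (\<epsilon> (Dom (Gpd \<Psi>) B))"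
      by (simp add: B(2) \<epsilon> e fund_ar_arr[OF wf' s B(1)] fund_ar_arr[OF wf f path_ap[OF wf' s B(1)]])
  qed
  show ?thesis
    unfolding equivalence_of_categories_def
    using fund_functor[OF wf f] fund_functor[OF wf' s] \<eta> \<epsilon>_nat inj by blast
qed

section \<open>Fibration property for maps in the second class\<close>

lemma class_B_lift:
  assumes B: "carrow T \<Phi> \<Psi> f \<in> class_B T" and wf: "wfc \<Phi>" "wfc \<Psi>" and f: "ele \<Phi> f f \<Psi>"
    and a: "ele [] a a \<Phi>"
  obtains j where "ele (based \<Psi> (app f a)) j j \<Phi>"
    "ele [] (app j (rl (app f a) @ app f a)) a \<Phi>"
    "ele (based \<Psi> (app f a)) (app f j) (seg (length \<Psi>) (length \<Psi>)) \<Psi>"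
proof -
  let ?c = "app f a" and ?n = "length \<Psi>"
  let ?E = "based \<Psi> ?c" and ?r = "rl ?c @ ?c" and ?y = "seg ?n ?n"
  have nil: "wfc []" by simp
  have c: "ele [] ?c ?c \<Psi>" by (rule app_ele[OF wf nil f a])
  have E: "wfc ?E" using based_wf[OF wf(2) nil c] by simp
  have r: "ele [] ?r ?r ?E"
    using based_ele[OF wf(2) nil c c] path_rl[OF wf(2) c] by (simp add: path_def)
  note y = based_generic(1)[OF wf(2) c]
  have "lifts CC (carrow T [] ?E ?r) (carrow T \<Phi> \<Psi> f)"
    using B based_point_class_A[OF wf(2) c] by (simp add: class_B_def)
  \<comment> \<open>The endpoint projection sends the centre to f(a), so the square with a on top
    commutes.\<close>
  moreover have "app ?y ?r = ?c"
    using ele_length[OF c] by (simp add: app_def sb_seg_hit sb_seg_skip)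
  then have "Cmp CC (carrow T \<Phi> \<Psi> f) (carrow T [] \<Phi> a) = Cmp CC (carrow T ?E \<Psi> ?y) (carrow T [] ?E ?r)"
    using cc_cmp[OF nil wf a f] cc_cmp[OF nil E wf(2) r y] by simp
  ultimately obtain J where J: "J \<in> Ar CC" "Dom CC J = ctx_class T ?E" "Cod CC J = ctx_class T \<Phi>"
    "Cmp CC J (carrow T [] ?E ?r) = carrow T [] \<Phi> a" "Cmp CC (carrow T \<Phi> \<Psi> f) J = carrow T ?E \<Psi> ?y"
    using carrow_Ar[OF nil wf(1) a] carrow_Ar[OF E wf(2) y] unfolding lifts_def
    by (metis carrow_Dom_Cod)
  from cc_arr[OF J(1-3) E wf(1)] obtain j where j: "ele ?E j j \<Phi>" "J = carrow T ?E \<Phi> j" .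
  have 1: "ele [] (app j ?r) a \<Phi>"
    using J(4) cc_cmp[OF nil E wf(1) r j(1)] carrow_eq[OF nil wf(1) app_ele[OF E wf(1) nil j(1) r] a] j(2) by simp
  have 2: "ele ?E (app f j) ?y \<Psi>"
    using J(5) cc_cmp[OF E wf j(1) f] carrow_eq[OF E wf(2) app_ele[OF wf E f j(1)] y] j(2) by simp
  show thesis by (rule that[OF j(1) 1 2])
qed

lemma class_B_path_lift:
  assumes B: "carrow T \<Phi> \<Psi> f \<in> class_B T" and wf: "wfc \<Phi>" "wfc \<Psi>" and f: "ele \<Phi> f f \<Psi>"
    and a: "ele [] a a \<Phi>" and q: "path \<Psi> (app f a) b q"
  obtains a' p where "path \<Phi> a a' p" "ele [] (app f a') b \<Psi>" "hty (Idc \<Psi> (app f a) b) (ap f a a' p) q"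
proof -
  define c where "c = app f a"
  let ?n = "length \<Psi>"
  let ?E = "based \<Psi> c" and ?r = "rl c @ c" and ?y = "seg ?n ?n" and ?u = "seg 0 ?n"
  have nil: "wfc []" by simp
  have c: "ele [] c c \<Psi>" unfolding c_def by (rule app_ele[OF wf nil f a])
  have lc: "length c = ?n" using ele_length[OF c] by simp
  have E: "wfc ?E" using based_wf[OF wf(2) nil c] by simp
  have r: "ele [] ?r ?r ?E"
    using based_ele[OF wf(2) nil c c] path_rl[OF wf(2) c] by (simp add: path_def)
  note y = based_generic(1)[OF wf(2) c] and u = based_generic(2)[OF wf(2) c]
  have yu: "sb (cat (s @ t) Var) ?y = t" "sb (cat (s @ t) Var) ?u = s" if "length s = ?n" "length t = ?n" for s t
    using that by (simp_all add: sb_seg_hit sb_seg_skip)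
  obtain j where j: "ele ?E j j \<Phi>" "ele [] (app j ?r) a \<Phi>" "ele ?E (app f j) ?y \<Psi>"
    using class_B_lift[OF B wf f a, folded c_def] by blast
  have aE: "ele ?E a a \<Phi>" by (rule ele_weaken[OF a E])
  have la: "length a = length \<Phi>" "length j = length \<Phi>" using ele_length[OF a] ele_length[OF j(1)] by simp_all
  have S1: "subst_tele (cat z Var) (Idc \<Phi> a j) = Idc \<Phi> a (app j z)" for z
    using la wf(1) ele_closed[OF a] by (simp add: Idc_closed_subst app_def)
  have w1: "wfc (Idc \<Phi> a j @ ?E)" by (rule Idc_closed_wf[OF wf(1) E aE j(1)])
  have aj: "ele [] a (app j ?r) \<Phi>" by (rule ele_symC[OF wf(1) j(2)])
  \<comment> \<open>At the centre j is definitionally a, so reflexivity at a can start the induction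
    that produces the path \<alpha> from a to j.\<close>
  have e1: "ele [] (rl a) (rl a) (subst_tele (cat ?r Var) (Idc \<Phi> a j))"
    unfolding S1 using ele_conv[OF Idc_congC[OF wf(1) a aj]] path_rl[OF wf(1) a] by (simp add: path_def)
  obtain \<alpha> where \<alpha>: "ele ?E \<alpha> \<alpha> (Idc \<Phi> a j)" "ele [] (app \<alpha> ?r) (rl a) (Idc \<Phi> a (app j ?r))"
    using based_path_induction[OF wf(2) c w1 e1] unfolding S1 by blast
  have l\<alpha>: "length \<alpha> = length \<Phi>" using ele_Idc_length[OF aE j(1) \<alpha>(1)] by simp
  have cE: "ele ?E c c \<Psi>" by (rule ele_weaken[OF c E])
  have w2: "wfc (Idc \<Psi> c ?y @ ?E)" by (rule Idc_closed_wf[OF wf(2) E cE y])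
  have "ele ?E (ap f a j \<alpha>) (ap f a j \<alpha>) (Idc \<Psi> c (app f j))"
    using ap_ele[OF wf f E aE j(1) \<alpha>(1)] by (simp add: c_def)
  \<comment> \<open>Because f(j) = y definitionally, the image of \<alpha> lies in the same identity
    context as u and can be compared with it.\<close>
  moreover have "teq ?E (Idc \<Psi> c (app f j)) (Idc \<Psi> c ?y)"
    using Idc_cong[OF _ cE j(3)] closed_wf[OF wf(2) E] teq_refl by blast
  ultimately have apE: "ele ?E (ap f a j \<alpha>) (ap f a j \<alpha>) (Idc \<Psi> c ?y)" using ele_conv by blast
  \<comment> \<open>Elements of this family are homotopies from the image of \<alpha> to u.\<close>
  let ?\<Omega> = "Idc (Idc \<Psi> c ?y) (ap f a j \<alpha>) ?u"
  have w3: "wfc (?\<Omega> @ ?E)" by (rule Idc_wf[OF w2 apE u])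
  have lI: "length (Idc \<Psi> c ?y) = ?n" using lc by (simp add: length_Idc)
  have lap: "length (ap f a j \<alpha>) = ?n" using ele_length[OF apE] lI by simp
  have S2: "subst_tele (cat (s @ t) Var) ?\<Omega> = Idc (Idc \<Psi> c t) (ap f a (app j (s @ t)) (app \<alpha> (s @ t))) s"
    if "length s = ?n" "length t = ?n" for s t
  proof -
    have "subst_tele (cat (s @ t) Var) ?\<Omega> = Idc (Idc \<Psi> (sb (cat (s @ t) Var) c) (sb (cat (s @ t) Var) ?y))
        (sb (cat (s @ t) Var) (ap f a j \<alpha>)) (sb (cat (s @ t) Var) ?u)"
      using lI lap lc wf(2) by (simp add: Idc_subst subst_tele_closed)
    also have "sb (cat (s @ t) Var) (ap f a j \<alpha>) = ap f a (app j (s @ t)) (app \<alpha> (s @ t))"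
      using ap_subst[OF f la l\<alpha>, of "cat (s @ t) Var"] ele_closed[OF a] by (simp add: app_def)
    finally show ?thesis using yu[OF that] ele_closed[OF c] by simp
  qed
  have lr: "length (rl c) = ?n" using lc by simp
  have ejr: "ele [] c (app f (app j ?r)) \<Psi>" unfolding c_def by (rule app_ele[OF wf nil f aj[unfolded c_def]])
  \<comment> \<open>At the centre \<alpha> is reflexivity, so its image computes to reflexivity at
    c, which is also the value of u there. The second based induction can therefore start from a
    reflexivity homotopy.\<close>
  have "ele [] (ap f a (app j ?r) (app \<alpha> ?r)) (ap f a a (rl a)) (Idc \<Psi> c (app f (app j ?r)))"
    using ap_ele[OF wf f nil a j(2) \<alpha>(2)] by (simp add: c_def)
  then have 1: "ele [] (ap f a (app j ?r) (app \<alpha> ?r)) (ap f a a (rl a)) (Idc \<Psi> c c)"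
    using ele_conv[OF teq_sym[OF Idc_congC[OF wf(2) c ejr]]] by blast
  have 2: "ele [] (ap f a a (rl a)) (rl c) (Idc \<Psi> c c)"
    using ap_rl[OF wf f nil a] by (simp add: c_def)
  have wc: "wfc (Idc \<Psi> c c)" by (rule Idc_wfC[OF wf(2) c c])
  have rc: "ele [] (rl c) (rl c) (Idc \<Psi> c c)" using path_rl[OF wf(2) c] by (simp add: path_def)
  have 3: "ele [] (rl c) (ap f a (app j ?r) (app \<alpha> ?r)) (Idc \<Psi> c c)"
    by (rule ele_symC[OF wc ele_transC[OF wc 1 2]])
  have "ele [] (rl (rl c)) (rl (rl c)) (Idc (Idc \<Psi> c c) (rl c) (rl c))"
    using path_rl[OF wc rc] by (simp add: path_def)
  from ele_conv[OF Idc_congC[OF wc 3 rc] this]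
  have e2: "ele [] (rl (rl c)) (rl (rl c)) (subst_tele (cat ?r Var) ?\<Omega>)"
    unfolding S2[OF lr lc] .
  obtain \<kappa> where \<kappa>: "ele ?E \<kappa> \<kappa> ?\<Omega>"
    using based_path_induction[OF wf(2) c w3 e2] by blast
  have b: "ele [] b b \<Psi>" and q0: "ele [] q q (Idc \<Psi> c b)" using q by (simp_all add: path_def c_def)
  \<comment> \<open>The lift and the homotopy exist over the whole based context; the given path q
    to b is one of its points, at which they are evaluated.\<close>
  let ?z = "q @ b"
  have lb: "length q = ?n" "length b = ?n" using ele_length[OF b] ele_Idc_length[OF c b q0] by simp_all
  have z: "ele [] ?z ?z ?E" by (rule based_ele[OF wf(2) nil c b q0])
  have jz: "ele [] (app j ?z) (app j ?z) \<Phi>" by (rule app_ele[OF E wf(1) nil j(1) z])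
  have "ele [] (app \<alpha> ?z) (app \<alpha> ?z) (Idc \<Phi> a (app j ?z))"
    using app_ele_dep[OF E nil \<alpha>(1) z] unfolding S1 .
  then have p: "path \<Phi> a (app j ?z) (app \<alpha> ?z)" using a jz by (simp add: path_def)
  have "ele [] (app \<kappa> ?z) (app \<kappa> ?z) (Idc (Idc \<Psi> c b) (ap f a (app j ?z) (app \<alpha> ?z)) q)"
    using app_ele_dep[OF E nil \<kappa> z] unfolding S2[OF lb] .
  then have h: "hty (Idc \<Psi> (app f a) b) (ap f a (app j ?z) (app \<alpha> ?z)) q"
    unfolding hty_def c_def by blast
  have "app ?y ?z = b" using yu(1)[OF lb] by (simp add: app_def)
  then have "ele [] (app f (app j ?z)) b \<Psi>"
    using app_ele[OF E wf(2) nil j(3) z] app_app[OF f la(2)] by simp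
  with p show thesis using h by (rule that)
qed

lemma class_B_fibration:
  assumes B: "carrow T \<Phi> \<Psi> f \<in> class_B T" and wf: "wfc \<Phi>" "wfc \<Psi>" and f: "ele \<Phi> f f \<Psi>"
  shows "grothendieck_fibration (Gpd \<Phi>) (Gpd \<Psi>) (fund_ob T \<Psi> f) (fund_ar T \<Psi> f)"
  unfolding grothendieck_fibration_def
proof (intro conjI ballI impI)
  show "groupoid (Gpd \<Phi>)" "groupoid (Gpd \<Psi>)" using Gpd_groupoid wf by blast+
  show "is_functor (Gpd \<Phi>) (Gpd \<Psi>) (fund_ob T \<Psi> f) (fund_ar T \<Psi> f)" by (rule fund_functor[OF wf f])
  fix X Q assume X: "X \<in> Ob (Gpd \<Phi>)" and Q: "Q \<in> Ar (Gpd \<Psi>)" and d: "Dom (Gpd \<Psi>) Q = fund_ob T \<Psi> f X"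
  have nil: "wfc []" by simp
  from X obtain a where a: "ele [] a a \<Phi>" "X = pt_class T \<Phi> a" by (auto simp: Ob_Gpd)
  from Q obtain c b q where q: "path \<Psi> c b q" "Q = arr \<Psi> c b q" by (auto simp: Ar_Gpd)
  have fa: "ele [] (app f a) (app f a) \<Psi>" by (rule app_ele[OF wf nil f a(1)])
  have c: "ele [] c (app f a) \<Psi>"
    using d q pt_class_eq[OF wf(2) fa] by (simp add: a(2) fund_ob_pt[OF wf f a(1)])
  have b: "ele [] b b \<Psi>" using q by (simp add: path_def)
  \<comment> \<open>The domain of the arrow is f(a) only as a class, so its path is first converted
    to start at f(a) itself.\<close>
  note q' = arr_conv[OF wf(2) c b q(1)]
  from class_B_path_lift[OF B wf f a(1) q'(1)] obtain a' p where
    p: "path \<Phi> a a' p" "ele [] (app f a') b \<Psi>" "hty (Idc \<Psi> (app f a) b) (ap f a a' p) q" .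
  \<comment> \<open>Likewise the end of the lifted path lies over b up to definitional equality,
    which is equality of objects.\<close>
  note c' = arr_conv[OF wf(2) fa p(2) path_ap[OF wf f p(1)]]
  have "arr \<Psi> (app f a) b (ap f a a' p) = arr \<Psi> (app f a) b q"
    by (rule arr_eqI[OF wf(2) fa b c'(1) q'(1) p(3)])
  then have "fund_ar T \<Psi> f (arr \<Phi> a a' p) = Q"
    by (simp add: fund_ar_arr[OF wf f p(1)] c'(2) q(2) q'(2))
  moreover have "fund_ob T \<Psi> f (pt_class T \<Phi> a') = pt_class T \<Psi> b"
    using fund_ob_pt[OF wf f, of a'] p pt_class_eq[OF wf(2) b] by (simp add: path_def)
  ultimately show "\<exists>\<alpha>\<in>Ar (Gpd \<Phi>). Dom (Gpd \<Phi>) \<alpha> = X \<and> fund_ob T \<Psi> f (Cod (Gpd \<Phi>) \<alpha>) = Cod (Gpd \<Psi>) Q \<and> fund_ar T \<Psi> f \<alpha> = Q"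
    using arr_Ar[OF p(1)] by (intro bexI[of _ "arr \<Phi> a a' p"]) (simp_all add: a(2) q(2))
qed

end

theorem theorem5p3:
  fixes T :: "'s judgement set" and \<Phi> \<Psi> :: "'s ctx" and f :: "'s tup"
  assumes "type_theory T"
    and "wf_ctx T \<Phi>" and "wf_ctx T \<Psi>" and "elem T \<Phi> f \<Psi>"
  shows "(carrow T \<Phi> \<Psi> f \<in> class_A T \<longrightarrow>
            equivalence_of_categories (fund_groupoid T \<Phi>) (fund_groupoid T \<Psi>)
              (fund_ob T \<Psi> f) (fund_ar T \<Psi> f) \<and>
            inj_on (fund_ob T \<Psi> f) (Ob (fund_groupoid T \<Phi>))) \<and>
         (carrow T \<Phi> \<Psi> f \<in> class_B T \<longrightarrow>
            grothendieck_fibration (fund_groupoid T \<Phi>) (fund_groupoid T \<Psi>)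
              (fund_ob T \<Psi> f) (fund_ar T \<Psi> f))"
proof -
  interpret type_theory T by fact
  have f: "ele \<Phi> f f \<Psi>" using assms(4) by (simp add: elem_iff)
  show ?thesis
    using class_A_equivalence[OF _ assms(2,3) f] class_B_fibration[OF _ assms(2,3) f] by blast
qed

end
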